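(* Let $G$ be a non-trivial discrete group. For each $i\in\mathbb{N}$ let $\mathcal{H}_i$ be a Hilbert space and $\alpha_i$ an action of $G$ on $\mathcal{B}(\mathcal{H}_i)$, and write each $\alpha_i$ as $\alpha_{i,g}=\mathrm{Ad}(U_i(g))$, $g\in G$, where $U_i$ is a projective unitary representation of $G$ on $\mathcal{H}_i$ with associated 2-cocycle $u_i\in Z^2(G,\mathbb{T})$. Assume that, for some $u\in Z^2(G,\mathbb{T})$, $[u_i]=[u]$ for every $i$ and $[u]\neq[1]$ in $H^2(G,\mathbb{T})$. Then $\odot_i\alpha_i$ does not extend to an action of $G$ on the von Neumann algebra $\otimes_i(\mathcal{B}(\mathcal{H}_i),\phi_i)$, regardless of the choice of unit vectors $\phi_i\in\mathcal{H}_i$.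
   Context: $Z^2(G,\mathbb{T})$ is the group (pointwise product) of normalized 2-cocycles, i.e. maps $u:G\times G\to\mathbb{T}$ (circle group) with $u(x,y)u(xy,z)=u(y,z)u(x,yz)$ and $u(x,e)=u(e,x)=1$. $B^2(G,\mathbb{T})$ is the subgroup of coboundaries $(\mathrm{d}\rho)(x,y)=\rho(x)\rho(y)\overline{\rho(xy)}$ with $\rho:G\to\mathbb{T}$, $\rho(e)=1$. $H^2(G,\mathbb{T})=Z^2(G,\mathbb{T})/B^2(G,\mathbb{T})$, and $[u]$ is the class of $u$. A projective unitary representation $U$ of $G$ on $\mathcal{H}$ associated with $u\in Z^2(G,\mathbb{T})$ is a map from $G$ to the unitaries on $\mathcal{H}$ with $U(x)U(y)=u(x,y)U(xy)$ for all $x,y\in G$. $\mathrm{Ad}(U)(T)=UTU^*$. An action of $G$ on a von Neumann algebra $\mathcal{M}$ is a homomorphism $G\to\mathrm{Aut}(\mathcal{M})$. For unit vectors $\phi_i\in\mathcal{H}_i$, $\bigotimes_i^{\phi}\mathcal{H}_i$ (with $\phi=(\phi_i)$) is the completed inductive limit of the spaces $\mathcal{H}_1\otimes\cdots\otimes\mathcal{H}_n$ under the isometries $\psi\mapsto\psi\otimes\phi_{n+1}$. For von Neumann algebras $\mathcal{M}_i\subset\mathcal{B}(\mathcal{H}_i)$, $\odot_i\mathcal{M}_i$ (resp. $\otimes_i(\mathcal{M}_i,\phi_i)$) is the $*$-algebra (resp. von Neumann algebra) on $\bigotimes_i^{\phi}\mathcal{H}_i$ generated by the operators $\otimes_iT_i$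 with $T_i\in\mathcal{M}_i$ and $T_i=I_i$ (the identity on $\mathcal{H}_i$) for all but finitely many $i$. Given actions $\alpha_i$ of $G$ on $\mathcal{M}_i$, $\odot_i\alpha_i$ is the action of $G$ on $\odot_i\mathcal{M}_i$ determined, for every finite $J\subset\mathbb{N}$, by $(\otimes_{i\in J}T_i)\otimes(\otimes_{i\notin J}I_i)\mapsto(\otimes_{i\in J}\alpha_{i,g}(T_i))\otimes(\otimes_{i\notin J}I_i)$. *)

theory Defs
  imports Complex_Main "HOL-Algebra.Coset" "HOL-Library.Poly_Mapping"
begin

section \<open>Complex Hilbert spaces with explicit carriers\<close>

text \<open>The inner product \<open>ip\<close> is linear in its first argument. Carriers are explicit because
  the tensor products below depend on a family of spaces indexed by natural numbers.\<close>

record 'a hspace =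
  vecs :: "'a set"
  vzero :: "'a"
  vadd :: "'a \<Rightarrow> 'a \<Rightarrow> 'a"
  vscale :: "complex \<Rightarrow> 'a \<Rightarrow> 'a"
  ip :: "'a \<Rightarrow> 'a \<Rightarrow> complex"

definition vnorm :: "('a, 'z) hspace_scheme \<Rightarrow> 'a \<Rightarrow> real" where
  "vnorm H x = sqrt (Re (ip H x x))"

definition vdist :: "('a, 'z) hspace_scheme \<Rightarrow> 'a \<Rightarrow> 'a \<Rightarrow> real" where
  "vdist H x y = vnorm H (vadd H x (vscale H (- 1) y))"

locale hilbert_space =
  fixes H :: "('a, 'z) hspace_scheme"
  assumes zero_closed: "vzero H \<in> vecs H"
    and add_closed: "\<lbrakk>x \<in> vecs H; y \<in> vecs H\<rbrakk> \<Longrightarrow> vadd H x y \<in> vecs H"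
    and scale_closed: "x \<in> vecs H \<Longrightarrow> vscale H a x \<in> vecs H"
    and add_assoc: "\<lbrakk>x \<in> vecs H; y \<in> vecs H; z \<in> vecs H\<rbrakk>
      \<Longrightarrow> vadd H (vadd H x y) z = vadd H x (vadd H y z)"
    and add_commute: "\<lbrakk>x \<in> vecs H; y \<in> vecs H\<rbrakk> \<Longrightarrow> vadd H x y = vadd H y x"
    and add_zero: "x \<in> vecs H \<Longrightarrow> vadd H x (vzero H) = x"
    and add_inverse: "x \<in> vecs H \<Longrightarrow> vadd H x (vscale H (- 1) x) = vzero H"
    and scale_one: "x \<in> vecs H \<Longrightarrow> vscale H 1 x = x"
    and scale_scale: "x \<in> vecs H \<Longrightarrow> vscale H a (vscale H b x) = vscale H (a * b) x"
    and scale_add_left: "x \<in> vecs H \<Longrightarrow> vscale H (a + b) x = vadd H (vscale H a x) (vscale H b x)"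
    and scale_add_right: "\<lbrakk>x \<in> vecs H; y \<in> vecs H\<rbrakk>
      \<Longrightarrow> vscale H a (vadd H x y) = vadd H (vscale H a x) (vscale H a y)"
    and ip_add: "\<lbrakk>x \<in> vecs H; y \<in> vecs H; z \<in> vecs H\<rbrakk>
      \<Longrightarrow> ip H (vadd H x y) z = ip H x z + ip H y z"
    and ip_scale: "\<lbrakk>x \<in> vecs H; y \<in> vecs H\<rbrakk> \<Longrightarrow> ip H (vscale H a x) y = a * ip H x y"
    and ip_cnj: "\<lbrakk>x \<in> vecs H; y \<in> vecs H\<rbrakk> \<Longrightarrow> ip H y x = cnj (ip H x y)"
    and ip_nonneg: "x \<in> vecs H \<Longrightarrow> 0 \<le> Re (ip H x x)"
    and ip_definite: "\<lbrakk>x \<in> vecs H; ip H x x = 0\<rbrakk> \<Longrightarrow> x = vzero H"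
    and complete: "\<And>X :: nat \<Rightarrow> 'a. \<lbrakk>\<And>n. X n \<in> vecs H; \<And>e. 0 < e \<Longrightarrow> \<exists>N. \<forall>m\<ge>N. \<forall>n\<ge>N. vdist H (X m) (X n) < e\<rbrakk>
      \<Longrightarrow> \<exists>x\<in>vecs H. (\<lambda>n. vdist H (X n) x) \<longlonglongrightarrow> 0"


section \<open>Bounded operators and von Neumann algebras\<close>

text \<open>Operators are extensional functions on the carrier, so that equality of functions is equality
  of operators.\<close>

definition bops :: "('a, 'z) hspace_scheme \<Rightarrow> ('a \<Rightarrow> 'a) set" where
  "bops H = {T \<in> vecs H \<rightarrow>\<^sub>E vecs H.
     (\<forall>x\<in>vecs H. \<forall>y\<in>vecs H. T (vadd H x y) = vadd H (T x) (T y)) \<and>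
     (\<forall>a. \<forall>x\<in>vecs H. T (vscale H a x) = vscale H a (T x)) \<and>
     (\<exists>C. \<forall>x\<in>vecs H. vnorm H (T x) \<le> C * vnorm H x)}"

definition id_op :: "('a, 'z) hspace_scheme \<Rightarrow> 'a \<Rightarrow> 'a" where
  "id_op H = (\<lambda>x\<in>vecs H. x)"

definition zero_op :: "('a, 'z) hspace_scheme \<Rightarrow> 'a \<Rightarrow> 'a" where
  "zero_op H = (\<lambda>x\<in>vecs H. vzero H)"

definition add_op :: "('a, 'z) hspace_scheme \<Rightarrow> ('a \<Rightarrow> 'a) \<Rightarrow> ('a \<Rightarrow> 'a) \<Rightarrow> 'a \<Rightarrow> 'a" where
  "add_op H S T = (\<lambda>x\<in>vecs H. vadd H (S x) (T x))"

definition scale_op :: "('a, 'z) hspace_scheme \<Rightarrow> complex \<Rightarrow> ('a \<Rightarrow> 'a) \<Rightarrow> 'a \<Rightarrow> 'a" where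
  "scale_op H a T = (\<lambda>x\<in>vecs H. vscale H a (T x))"

definition mult_op :: "('a, 'z) hspace_scheme \<Rightarrow> ('a \<Rightarrow> 'a) \<Rightarrow> ('a \<Rightarrow> 'a) \<Rightarrow> 'a \<Rightarrow> 'a" where
  "mult_op H S T = compose (vecs H) S T"

definition adjoint :: "('a, 'z) hspace_scheme \<Rightarrow> ('a \<Rightarrow> 'a) \<Rightarrow> 'a \<Rightarrow> 'a" where
  "adjoint H T = (THE S. S \<in> bops H \<and> (\<forall>x\<in>vecs H. \<forall>y\<in>vecs H. ip H (T x) y = ip H x (S y)))"

definition unitaries :: "('a, 'z) hspace_scheme \<Rightarrow> ('a \<Rightarrow> 'a) set" where
  "unitaries H = {U \<in> bops H. mult_op H (adjoint H U) U = id_op H \<and>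
                              mult_op H U (adjoint H U) = id_op H}"

definition Ad :: "('a, 'z) hspace_scheme \<Rightarrow> ('a \<Rightarrow> 'a) \<Rightarrow> ('a \<Rightarrow> 'a) \<Rightarrow> 'a \<Rightarrow> 'a" where
  "Ad H U T = mult_op H (mult_op H U T) (adjoint H U)"

definition star_subalgebra :: "('a, 'z) hspace_scheme \<Rightarrow> ('a \<Rightarrow> 'a) set \<Rightarrow> bool" where
  "star_subalgebra H A \<longleftrightarrow> A \<subseteq> bops H \<and> zero_op H \<in> A \<and>
     (\<forall>S\<in>A. \<forall>T\<in>A. add_op H S T \<in> A \<and> mult_op H S T \<in> A) \<and>
     (\<forall>T\<in>A. adjoint H T \<in> A \<and> (\<forall>a. scale_op H a T \<in> A))"

definition commutant :: "('a, 'z) hspace_scheme \<Rightarrow> ('a \<Rightarrow> 'a) set \<Rightarrow> ('a \<Rightarrow> 'a) set" where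
  "commutant H A = {T \<in> bops H. \<forall>S\<in>A. mult_op H T S = mult_op H S T}"

definition von_neumann_algebra :: "('a, 'z) hspace_scheme \<Rightarrow> ('a \<Rightarrow> 'a) set \<Rightarrow> bool" where
  "von_neumann_algebra H A \<longleftrightarrow> star_subalgebra H A \<and> commutant H (commutant H A) = A"

definition star_automorphism ::
    "('a, 'z) hspace_scheme \<Rightarrow> ('a \<Rightarrow> 'a) set \<Rightarrow> (('a \<Rightarrow> 'a) \<Rightarrow> ('a \<Rightarrow> 'a)) \<Rightarrow> bool" where
  "star_automorphism H A \<theta> \<longleftrightarrow> bij_betw \<theta> A A \<and>
     (\<forall>S\<in>A. \<forall>T\<in>A. \<theta> (add_op H S T) = add_op H (\<theta> S) (\<theta> T) \<and>
                    \<theta> (mult_op H S T) = mult_op H (\<theta> S) (\<theta> T)) \<and>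
     (\<forall>T\<in>A. \<theta> (adjoint H T) = adjoint H (\<theta> T) \<and>
             (\<forall>a. \<theta> (scale_op H a T) = scale_op H a (\<theta> T)))"

definition is_action ::
    "('g, 'm) monoid_scheme \<Rightarrow> ('a, 'z) hspace_scheme \<Rightarrow> ('a \<Rightarrow> 'a) set \<Rightarrow>
     ('g \<Rightarrow> ('a \<Rightarrow> 'a) \<Rightarrow> ('a \<Rightarrow> 'a)) \<Rightarrow> bool" where
  "is_action G H A \<alpha> \<longleftrightarrow>
     (\<forall>g\<in>carrier G. star_automorphism H A (\<alpha> g)) \<and>
     (\<forall>g\<in>carrier G. \<forall>h\<in>carrier G. \<forall>T\<in>A. \<alpha> (g \<otimes>\<^bsub>G\<^esub> h) T = \<alpha> g (\<alpha> h T))"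


section \<open>Circle-valued 2-cocycles and projective representations\<close>

definition Z2 :: "('g, 'm) monoid_scheme \<Rightarrow> ('g \<times> 'g \<Rightarrow> complex) monoid" where
  "Z2 G = \<lparr>
     carrier = {u \<in> (carrier G \<times> carrier G) \<rightarrow>\<^sub>E {z. cmod z = 1}.
       (\<forall>x\<in>carrier G. \<forall>y\<in>carrier G. \<forall>z\<in>carrier G.
          u (x, y) * u (x \<otimes>\<^bsub>G\<^esub> y, z) = u (y, z) * u (x, y \<otimes>\<^bsub>G\<^esub> z)) \<and>
       (\<forall>x\<in>carrier G. u (x, \<one>\<^bsub>G\<^esub>) = 1 \<and> u (\<one>\<^bsub>G\<^esub>, x) = 1)},
     mult = (\<lambda>u v. \<lambda>p\<in>carrier G \<times> carrier G. u p * v p),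
     one = (\<lambda>p\<in>carrier G \<times> carrier G. 1) \<rparr>"

definition coboundary :: "('g, 'm) monoid_scheme \<Rightarrow> ('g \<Rightarrow> complex) \<Rightarrow> 'g \<times> 'g \<Rightarrow> complex" where
  "coboundary G \<rho> = (\<lambda>(x, y)\<in>carrier G \<times> carrier G. \<rho> x * \<rho> y * cnj (\<rho> (x \<otimes>\<^bsub>G\<^esub> y)))"

definition B2 :: "('g, 'm) monoid_scheme \<Rightarrow> ('g \<times> 'g \<Rightarrow> complex) set" where
  "B2 G = {coboundary G \<rho> | \<rho>. \<rho> \<in> carrier G \<rightarrow> {z. cmod z = 1} \<and> \<rho> \<one>\<^bsub>G\<^esub> = 1}"

definition H2 :: "('g, 'm) monoid_scheme \<Rightarrow> ('g \<times> 'g \<Rightarrow> complex) set monoid" where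
  "H2 G = Z2 G Mod B2 G"

definition cohomology_class ::
    "('g, 'm) monoid_scheme \<Rightarrow> ('g \<times> 'g \<Rightarrow> complex) \<Rightarrow> ('g \<times> 'g \<Rightarrow> complex) set" where
  "cohomology_class G u = B2 G #>\<^bsub>Z2 G\<^esub> u"

definition projective_rep ::
    "('g, 'm) monoid_scheme \<Rightarrow> ('a, 'z) hspace_scheme \<Rightarrow> ('g \<times> 'g \<Rightarrow> complex) \<Rightarrow>
     ('g \<Rightarrow> 'a \<Rightarrow> 'a) \<Rightarrow> bool" where
  "projective_rep G H u U \<longleftrightarrow> u \<in> carrier (Z2 G) \<and> U \<in> carrier G \<rightarrow> unitaries H \<and>
     (\<forall>x\<in>carrier G. \<forall>y\<in>carrier G.
        mult_op H (U x) (U y) = scale_op H (u (x, y)) (U (x \<otimes>\<^bsub>G\<^esub> y)))"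


section \<open>The Hilbert space generated by a positive definite kernel\<close>

text \<open>Given a positive semidefinite \<open>k\<close> on \<open>X\<close>, the free complex vector space on \<open>X\<close> carries
  the form extending \<open>\<langle>x, y\<rangle> = k x y\<close>. Its Hausdorff completion is realised, following von Neumann, as
  a space of functions on \<open>X\<close>: the vector \<open>\<xi>\<close> is the function \<open>y \<mapsto> \<langle>\<xi>, y\<rangle>\<close>, set to zero
  outside \<open>X\<close>. A function belongs to the space iff it is the pointwise limit on \<open>X\<close> of a sequence of
  formal combinations that is Cauchy for the form.\<close>

definition free_space :: "'x set \<Rightarrow> ('x \<Rightarrow>\<^sub>0 complex) set" where
  "free_space X = {c. Poly_Mapping.keys c \<subseteq> X}"

definition kernel_form ::
    "('x \<Rightarrow> 'x \<Rightarrow> complex) \<Rightarrow> ('x \<Rightarrow>\<^sub>0 complex) \<Rightarrow> ('x \<Rightarrow>\<^sub>0 complex) \<Rightarrow> complex" where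
  "kernel_form k c d = (\<Sum>x\<in>Poly_Mapping.keys c. \<Sum>y\<in>Poly_Mapping.keys d.
     Poly_Mapping.lookup c x * cnj (Poly_Mapping.lookup d y) * k x y)"

definition approximates ::
    "'x set \<Rightarrow> ('x \<Rightarrow> 'x \<Rightarrow> complex) \<Rightarrow> (nat \<Rightarrow> 'x \<Rightarrow>\<^sub>0 complex) \<Rightarrow> ('x \<Rightarrow> complex) \<Rightarrow> bool" where
  "approximates X k c f \<longleftrightarrow> (\<forall>n. c n \<in> free_space X) \<and>
     (\<forall>e>0. \<exists>N. \<forall>m\<ge>N. \<forall>n\<ge>N. cmod (kernel_form k (c m - c n) (c m - c n)) < e) \<and>
     (\<forall>y\<in>X. (\<lambda>n. \<Sum>x\<in>Poly_Mapping.keys (c n). Poly_Mapping.lookup (c n) x * k x y) \<longlonglongrightarrow> f y) \<and>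
     (\<forall>y. y \<notin> X \<longrightarrow> f y = 0)"

definition kernel_space :: "'x set \<Rightarrow> ('x \<Rightarrow> 'x \<Rightarrow> complex) \<Rightarrow> ('x \<Rightarrow> complex) hspace" where
  "kernel_space X k = \<lparr>
     vecs = {f. \<exists>c. approximates X k c f},
     vzero = (\<lambda>y. 0),
     vadd = (\<lambda>f g y. f y + g y),
     vscale = (\<lambda>a f y. a * f y),
     ip = (\<lambda>f g. THE z. \<exists>c d. approximates X k c f \<and> approximates X k d g \<and>
                              (\<lambda>n. kernel_form k (c n) (d n)) \<longlonglongrightarrow> z) \<rparr>"

definition kernel_gen :: "'x set \<Rightarrow> ('x \<Rightarrow> 'x \<Rightarrow> complex) \<Rightarrow> 'x \<Rightarrow> 'x \<Rightarrow> complex" where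
  "kernel_gen X k x = (\<lambda>y. if y \<in> X then k x y else 0)"


section \<open>Finite tensor products\<close>

text \<open>The tensor product of \<open>H i\<close>, \<open>i \<in> I\<close>, for finite \<open>I\<close>: the Hilbert space generated by the
  elementary tensors, with \<open>\<langle>\<Otimes> s i, \<Otimes> t i\<rangle> = (\<Prod>i\<in>I. \<langle>s i, t i\<rangle>)\<close>. A vector \<open>\<psi>\<close> is thus the conjugate
  multilinear functional \<open>t \<mapsto> \<langle>\<psi>, \<Otimes> t i\<rangle>\<close>.\<close>

definition tuples :: "nat set \<Rightarrow> (nat \<Rightarrow> 'a hspace) \<Rightarrow> (nat \<Rightarrow> 'a) set" where
  "tuples I H = (\<Pi>\<^sub>E i\<in>I. vecs (H i))"

definition tensor_kernel ::
    "nat set \<Rightarrow> (nat \<Rightarrow> 'a hspace) \<Rightarrow> (nat \<Rightarrow> 'a) \<Rightarrow> (nat \<Rightarrow> 'a) \<Rightarrow> complex" where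
  "tensor_kernel I H s t = (\<Prod>i\<in>I. ip (H i) (s i) (t i))"

definition fin_tensor :: "nat set \<Rightarrow> (nat \<Rightarrow> 'a hspace) \<Rightarrow> ((nat \<Rightarrow> 'a) \<Rightarrow> complex) hspace" where
  "fin_tensor I H = kernel_space (tuples I H) (tensor_kernel I H)"

definition elem_tensor ::
    "nat set \<Rightarrow> (nat \<Rightarrow> 'a hspace) \<Rightarrow> (nat \<Rightarrow> 'a) \<Rightarrow> (nat \<Rightarrow> 'a) \<Rightarrow> complex" where
  "elem_tensor I H s = kernel_gen (tuples I H) (tensor_kernel I H) s"

text \<open>The isometry \<open>\<psi> \<mapsto> \<psi> \<otimes> \<phi> (n + 1)\<close>: as functionals,
  \<open>(\<psi> \<otimes> v) t = \<psi> (t\<^sub>0, \<dots>, t\<^sub>n) * \<langle>v, t (n + 1)\<rangle>\<close>.\<close>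

definition append_vec ::
    "(nat \<Rightarrow> 'a hspace) \<Rightarrow> (nat \<Rightarrow> 'a) \<Rightarrow> nat \<Rightarrow> ((nat \<Rightarrow> 'a) \<Rightarrow> complex) \<Rightarrow> ((nat \<Rightarrow> 'a) \<Rightarrow> complex)" where
  "append_vec H \<phi> n \<psi> = (\<lambda>t. if t \<in> tuples {..Suc n} H
     then \<psi> (restrict t {..n}) * ip (H (Suc n)) (\<phi> (Suc n)) (t (Suc n)) else 0)"


section \<open>Completed inductive limits and infinite tensor products\<close>

text \<open>For Hilbert spaces \<open>E n\<close> and isometries \<open>j n\<close> from \<open>E n\<close> to \<open>E (Suc n)\<close>, the generators are the
  pairs \<open>(n, \<xi>)\<close> with \<open>\<xi>\<close> in \<open>E n\<close>; the inner product of two of them is computed after moving both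
  into a common \<open>E N\<close>. Hence \<open>(n, \<xi>)\<close> and \<open>(Suc n, j n \<xi>)\<close> give the same vector, and
  \<open>limit_emb E j n\<close> is the canonical isometry of \<open>E n\<close> into the limit.\<close>

primrec shift :: "(nat \<Rightarrow> 'e \<Rightarrow> 'e) \<Rightarrow> nat \<Rightarrow> nat \<Rightarrow> 'e \<Rightarrow> 'e" where
  "shift j n 0 \<xi> = \<xi>"
| "shift j n (Suc d) \<xi> = j (n + d) (shift j n d \<xi>)"

definition limit_kernel ::
    "(nat \<Rightarrow> 'e hspace) \<Rightarrow> (nat \<Rightarrow> 'e \<Rightarrow> 'e) \<Rightarrow> nat \<times> 'e \<Rightarrow> nat \<times> 'e \<Rightarrow> complex" where
  "limit_kernel E j p q = (let N = max (fst p) (fst q) in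
     ip (E N) (shift j (fst p) (N - fst p) (snd p)) (shift j (fst q) (N - fst q) (snd q)))"

definition inductive_limit ::
    "(nat \<Rightarrow> 'e hspace) \<Rightarrow> (nat \<Rightarrow> 'e \<Rightarrow> 'e) \<Rightarrow> (nat \<times> 'e \<Rightarrow> complex) hspace" where
  "inductive_limit E j = kernel_space (SIGMA n:UNIV. vecs (E n)) (limit_kernel E j)"

definition limit_emb ::
    "(nat \<Rightarrow> 'e hspace) \<Rightarrow> (nat \<Rightarrow> 'e \<Rightarrow> 'e) \<Rightarrow> nat \<Rightarrow> 'e \<Rightarrow> (nat \<times> 'e \<Rightarrow> complex)" where
  "limit_emb E j n \<xi> = kernel_gen (SIGMA n:UNIV. vecs (E n)) (limit_kernel E j) (n, \<xi>)"

type_synonym 'a itensor = "nat \<times> ((nat \<Rightarrow> 'a) \<Rightarrow> complex) \<Rightarrow> complex"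

definition inf_tensor :: "(nat \<Rightarrow> 'a hspace) \<Rightarrow> (nat \<Rightarrow> 'a) \<Rightarrow> 'a itensor hspace" where
  "inf_tensor H \<phi> = inductive_limit (\<lambda>n. fin_tensor {..n} H) (append_vec H \<phi>)"

definition tensor_emb ::
    "(nat \<Rightarrow> 'a hspace) \<Rightarrow> (nat \<Rightarrow> 'a) \<Rightarrow> nat \<Rightarrow> ((nat \<Rightarrow> 'a) \<Rightarrow> complex) \<Rightarrow> 'a itensor" where
  "tensor_emb H \<phi> = limit_emb (\<lambda>n. fin_tensor {..n} H) (append_vec H \<phi>)"

text \<open>The operator \<open>\<Otimes> T i\<close>, for bounded \<open>T i\<close> with \<open>T i\<close> the identity for all but finitely many \<open>i\<close>.\<close>

definition tensor_op ::
    "(nat \<Rightarrow> 'a hspace) \<Rightarrow> (nat \<Rightarrow> 'a) \<Rightarrow> (nat \<Rightarrow> 'a \<Rightarrow> 'a) \<Rightarrow> 'a itensor \<Rightarrow> 'a itensor" where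
  "tensor_op H \<phi> T = (THE X. X \<in> bops (inf_tensor H \<phi>) \<and>
     (\<forall>n. (\<forall>i>n. T i = id_op (H i)) \<longrightarrow> (\<forall>s\<in>tuples {..n} H.
        X (tensor_emb H \<phi> n (elem_tensor {..n} H s)) =
        tensor_emb H \<phi> n (elem_tensor {..n} H (\<lambda>i\<in>{..n}. T i (s i))))))"

definition elem_ops ::
    "(nat \<Rightarrow> 'a hspace) \<Rightarrow> (nat \<Rightarrow> 'a) \<Rightarrow> (nat \<Rightarrow> ('a \<Rightarrow> 'a) set) \<Rightarrow> ('a itensor \<Rightarrow> 'a itensor) set" where
  "elem_ops H \<phi> M = {tensor_op H \<phi> T | T. (\<forall>i. T i \<in> M i) \<and> finite {i. T i \<noteq> id_op (H i)}}"

definition alg_tensor ::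
    "(nat \<Rightarrow> 'a hspace) \<Rightarrow> (nat \<Rightarrow> 'a) \<Rightarrow> (nat \<Rightarrow> ('a \<Rightarrow> 'a) set) \<Rightarrow> ('a itensor \<Rightarrow> 'a itensor) set" where
  "alg_tensor H \<phi> M = star_subalgebra (inf_tensor H \<phi>) hull elem_ops H \<phi> M"

definition vn_tensor ::
    "(nat \<Rightarrow> 'a hspace) \<Rightarrow> (nat \<Rightarrow> 'a) \<Rightarrow> (nat \<Rightarrow> ('a \<Rightarrow> 'a) set) \<Rightarrow> ('a itensor \<Rightarrow> 'a itensor) set" where
  "vn_tensor H \<phi> M = von_neumann_algebra (inf_tensor H \<phi>) hull elem_ops H \<phi> M"

text \<open>\<open>is_alg_tensor_action G H \<phi> M \<alpha> \<gamma>\<close> says that \<open>\<gamma>\<close> is the algebraic tensor product of the actions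
  \<open>\<alpha> i\<close>. Its defining formula determines \<open>\<gamma>\<close> on \<^const>\<open>alg_tensor\<close>; elsewhere \<open>\<gamma>\<close> is arbitrary.\<close>

definition is_alg_tensor_action ::
    "('g, 'm) monoid_scheme \<Rightarrow> (nat \<Rightarrow> 'a hspace) \<Rightarrow> (nat \<Rightarrow> 'a) \<Rightarrow> (nat \<Rightarrow> ('a \<Rightarrow> 'a) set) \<Rightarrow>
     (nat \<Rightarrow> 'g \<Rightarrow> ('a \<Rightarrow> 'a) \<Rightarrow> ('a \<Rightarrow> 'a)) \<Rightarrow>
     ('g \<Rightarrow> ('a itensor \<Rightarrow> 'a itensor) \<Rightarrow> ('a itensor \<Rightarrow> 'a itensor)) \<Rightarrow> bool" where
  "is_alg_tensor_action G H \<phi> M \<alpha> \<gamma> \<longleftrightarrow> is_action G (inf_tensor H \<phi>) (alg_tensor H \<phi> M) \<gamma> \<and>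
     (\<forall>g\<in>carrier G. \<forall>J. finite J \<longrightarrow> (\<forall>T. (\<forall>i\<in>J. T i \<in> M i) \<longrightarrow>
        \<gamma> g (tensor_op H \<phi> (\<lambda>i. if i \<in> J then T i else id_op (H i))) =
        tensor_op H \<phi> (\<lambda>i. if i \<in> J then \<alpha> i g (T i) else id_op (H i))))"

text \<open>An action \<open>\<beta>\<close> on the von Neumann tensor product extends the algebraic tensor product of the
  \<open>\<alpha> i\<close> iff its restriction to \<^const>\<open>alg_tensor\<close> is that action.\<close>

definition extends_alg_tensor_action ::
    "('g, 'm) monoid_scheme \<Rightarrow> (nat \<Rightarrow> 'a hspace) \<Rightarrow> (nat \<Rightarrow> 'a) \<Rightarrow> (nat \<Rightarrow> ('a \<Rightarrow> 'a) set) \<Rightarrow>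
     (nat \<Rightarrow> 'g \<Rightarrow> ('a \<Rightarrow> 'a) \<Rightarrow> ('a \<Rightarrow> 'a)) \<Rightarrow>
     ('g \<Rightarrow> ('a itensor \<Rightarrow> 'a itensor) \<Rightarrow> ('a itensor \<Rightarrow> 'a itensor)) \<Rightarrow> bool" where
  "extends_alg_tensor_action G H \<phi> M \<alpha> \<beta> \<longleftrightarrow>
     is_alg_tensor_action G H \<phi> M \<alpha> (\<lambda>g. restrict (\<beta> g) (alg_tensor H \<phi> M))"

end

theory Submission
  imports "HOL-Analysis.Function_Topology" Defs
begin

text \<open>If the algebraic action extends, let \<open>p\<close> be the projection onto the line of
  \<open>\<Otimes>\<^sub>i \<phi> i\<close>. It belongs to the von Neumann tensor product and lies below the projection \<open>e m\<close>
  onto \<open>\<phi> m\<close> at site \<open>m\<close>, for every \<open>m\<close>. Hence the image of \<open>p\<close> under the automorphism of \<open>g\<close> is non-zero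
  and lies below all projections onto \<open>U m g (\<phi> m)\<close> at site \<open>m\<close>. A non-zero vector fixed by all of these
  forces the products of the overlaps \<open>\<bar>\<langle>\<phi> m, U m g (\<phi> m)\<rangle>\<bar>\<close> to stay away from zero, so the overlaps
  tend to \<open>1\<close>. If \<open>c m g\<close> is the phase of \<open>\<langle>U m g (\<phi> m), \<phi> m\<rangle>\<close>, then \<open>u m\<close> is asymptotic to the
  coboundary of \<open>c m\<close>, so that \<open>v\<close> is a pointwise limit of coboundaries. By compactness it is a
  coboundary itself, contrary to the hypothesis.\<close>

text \<open>A \<open>star_automorphism\<close> is purely algebraic: its definition contains no weak
  continuity, so the image of \<open>p\<close> is not computed as a limit of the images of the
  products \<open>e 0 ... e n\<close>. Only the identities \<open>e m p = p\<close> and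
  \<open>p \<noteq> 0\<close> are transported; that \<open>p\<close> is available to the
  automorphism at all is a double commutant argument. A vector \<xi> fixed by the transported
  projections controls all overlaps at once. Its inner product with
  \<open>s \<otimes> \<phi> (n + 1) \<otimes> ...\<close> does not change when finitely many of
  these \<open>\<phi> m\<close> are replaced by their projections onto the lines of
  \<open>U m g (\<phi> m)\<close>, whose norms are the overlaps. Some such inner product is non-zero
  because elementary vectors are total. The spaces are completions given by kernels and
  \<open>tensor_op\<close> is a definite description, so operators must first be constructed.
  Boundedness of an operator in one slot is the positivity of a product of kernels, whence Schur's
  theorem. Totality of a set is used in the form that only zero is orthogonal to it, which avoids
  closed spans.\<close>

section \<open>Hilbert spaces\<close>

text \<open>The discriminant bound behind each Cauchy-Schwarz inequality below: for inner products,
  kernel forms, Gram kernels and the residual in \<open>riesz\<close>. A multiple of the conjugate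
  of \<open>B\<close> as \<open>t\<close> makes the linear term real and negative; the factor
  \<open>1 / C\<close> is the optimal one.\<close>

lemma quadratic_nonneg_bound:
  fixes A C :: real and B :: complex
  assumes nonneg: "\<And>t. 0 \<le> A + 2 * Re (t * B) + (cmod t)\<^sup>2 * C" and "0 \<le> C"
  shows "(cmod B)\<^sup>2 \<le> A * C"
proof -
  have *: "0 \<le> A - 2 * s * (cmod B)\<^sup>2 + s\<^sup>2 * (cmod B)\<^sup>2 * C" for s :: real
  proof -
    have "Re ((- of_real s * cnj B) * B) = - s * (cmod B)\<^sup>2"
      by (simp add: mult.assoc complex_norm_square[symmetric] mult.commute[of "cnj B" B]
          flip: of_real_mult of_real_power)
    moreover have "(cmod (- of_real s * cnj B))\<^sup>2 = s\<^sup>2 * (cmod B)\<^sup>2"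
      by (simp add: norm_mult power_mult_distrib)
    ultimately show ?thesis
      using nonneg[of "- of_real s * cnj B"] by (simp add: algebra_simps)
  qed
  show ?thesis
  proof (cases "C = 0")
    case True
    have "B = 0"
    proof (rule ccontr)
      assume "B \<noteq> 0"
      \<comment> \<open>With \<open>C = 0\<close> the expression is affine in \<open>s\<close>, and
        this \<open>s\<close> gives it the value -1.\<close>
      then show False
        using *[of "(A + 1) / (2 * (cmod B)\<^sup>2)"] True by simp
    qed
    then show ?thesis by (simp add: True)
  next
    case False
    with \<open>0 \<le> C\<close> have "C > 0" by simp
    then show ?thesis
      using *[of "1 / C"] by (simp add: field_simps power2_eq_square)
  qed
qed

lemma abs_le_sqrt_mult:
  fixes a b c :: real
  assumes "a\<^sup>2 \<le> b\<^sup>2 * c\<^sup>2" "0 \<le> b" "0 \<le> c"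
  shows "a \<le> b * c"
  using assms by (metis mult_nonneg_nonneg power2_le_imp_le power_mult_distrib)

context hilbert_space
begin

section \<open>Consequences of the Hilbert space axioms, up to the Riesz representation
  theorem\<close>

lemma scale_zero: "x \<in> vecs H \<Longrightarrow> vscale H 0 x = vzero H"
  using scale_add_left[of x 1 "-1"] by (simp add: scale_one add_inverse)

lemma ip_zero_left: "y \<in> vecs H \<Longrightarrow> ip H (vzero H) y = 0"
  using ip_scale[of "vzero H" y 0] scale_zero[of "vzero H"] zero_closed by simp

lemma ip_zero_right: "y \<in> vecs H \<Longrightarrow> ip H y (vzero H) = 0"
  using ip_cnj[of "vzero H" y] ip_zero_left zero_closed by simp

lemma ip_add_right:
  "\<lbrakk>x \<in> vecs H; y \<in> vecs H; z \<in> vecs H\<rbrakk> \<Longrightarrow> ip H x (vadd H y z) = ip H x y + ip H x z"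
  using ip_cnj[of "vadd H y z" x] ip_cnj[of y x] ip_cnj[of z x] by (simp add: add_closed ip_add)

lemma ip_scale_right:
  "\<lbrakk>x \<in> vecs H; y \<in> vecs H\<rbrakk> \<Longrightarrow> ip H x (vscale H a y) = cnj a * ip H x y"
  using ip_cnj[of "vscale H a y" x] ip_cnj[of y x] by (simp add: scale_closed ip_scale)

abbreviation diff :: "'a \<Rightarrow> 'a \<Rightarrow> 'a" where
  "diff x y \<equiv> vadd H x (vscale H (- 1) y)"

lemma diff_closed: "\<lbrakk>x \<in> vecs H; y \<in> vecs H\<rbrakk> \<Longrightarrow> diff x y \<in> vecs H"
  by (simp add: add_closed scale_closed)

lemma ip_diff_left:
  "\<lbrakk>x \<in> vecs H; y \<in> vecs H; z \<in> vecs H\<rbrakk> \<Longrightarrow> ip H (diff x y) z = ip H x z - ip H y z"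
  by (simp add: ip_add ip_scale scale_closed)

lemma ip_diff_right:
  "\<lbrakk>x \<in> vecs H; y \<in> vecs H; z \<in> vecs H\<rbrakk> \<Longrightarrow> ip H x (diff y z) = ip H x y - ip H x z"
  by (simp add: ip_add_right ip_scale_right scale_closed)

lemma norm_nonneg: "x \<in> vecs H \<Longrightarrow> 0 \<le> vnorm H x"
  by (simp add: vnorm_def ip_nonneg)

lemma norm_square: "x \<in> vecs H \<Longrightarrow> (vnorm H x)\<^sup>2 = Re (ip H x x)"
  by (simp add: vnorm_def ip_nonneg)

lemma ip_self: "x \<in> vecs H \<Longrightarrow> ip H x x = of_real ((vnorm H x)\<^sup>2)"
  using ip_cnj[of x x] by (auto simp add: norm_square complex_eq_iff)

lemma diff_eq_zeroD:
  assumes "x \<in> vecs H" "y \<in> vecs H" "diff x y = vzero H"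
  shows "x = y"
proof -
  have "x = vadd H x (diff y y)" by (simp add: assms add_inverse add_zero)
  also have "\<dots> = vadd H (diff x y) y"
    using assms(1,2) by (simp add: add_assoc scale_closed add_commute[of y "vscale H (- 1) y"])
  also have "\<dots> = y"
    using assms add_zero[of y] add_commute[of y "vzero H"] zero_closed by simp
  finally show ?thesis .
qed

lemma eq_by_ip:
  assumes "x \<in> vecs H" "y \<in> vecs H" "\<And>z. z \<in> vecs H \<Longrightarrow> ip H x z = ip H y z"
  shows "x = y"
proof (rule diff_eq_zeroD)
  show "diff x y = vzero H"
    by (rule ip_definite) (use assms in \<open>simp_all add: diff_closed ip_diff_left\<close>)
qed (use assms in auto)

lemma cauchy_schwarz:
  assumes "x \<in> vecs H" "y \<in> vecs H"
  shows "cmod (ip H x y) \<le> vnorm H x * vnorm H y"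
proof (rule abs_le_sqrt_mult)
  have "(cmod (ip H x y))\<^sup>2 \<le> (vnorm H y)\<^sup>2 * (vnorm H x)\<^sup>2"
  proof (rule quadratic_nonneg_bound)
    fix t
    let ?z = "vadd H y (vscale H t x)"
    have "ip H ?z ?z = ip H y y + t * ip H x y + cnj t * cnj (ip H x y) + t * cnj t * ip H x x"
      using assms ip_cnj[of x y]
      by (simp add: ip_add ip_scale ip_add_right ip_scale_right scale_closed add_closed algebra_simps)
    also have "Re \<dots> = (vnorm H y)\<^sup>2 + 2 * Re (t * ip H x y) + (cmod t)\<^sup>2 * (vnorm H x)\<^sup>2"
      using assms by (simp add: ip_self complex_norm_square[symmetric] flip: of_real_power)
    finally show "0 \<le> (vnorm H y)\<^sup>2 + 2 * Re (t * ip H x y) + (cmod t)\<^sup>2 * (vnorm H x)\<^sup>2"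
      using ip_nonneg[of ?z] assms by (simp add: add_closed scale_closed)
  qed simp
  then show "(cmod (ip H x y))\<^sup>2 \<le> (vnorm H x)\<^sup>2 * (vnorm H y)\<^sup>2" by (simp add: mult.commute)
qed (use assms in \<open>auto simp: norm_nonneg\<close>)

lemma norm_triangle:
  assumes "x \<in> vecs H" "y \<in> vecs H"
  shows "vnorm H (vadd H x y) \<le> vnorm H x + vnorm H y"
proof (rule power2_le_imp_le)
  have "(vnorm H (vadd H x y))\<^sup>2 = (vnorm H x)\<^sup>2 + 2 * Re (ip H x y) + (vnorm H y)\<^sup>2"
    using assms ip_cnj[of x y]
    by (simp add: norm_square ip_add ip_add_right add_closed ip_nonneg)
  also have "\<dots> \<le> (vnorm H x)\<^sup>2 + 2 * (vnorm H x * vnorm H y) + (vnorm H y)\<^sup>2"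
    using cauchy_schwarz[OF assms] complex_Re_le_cmod[of "ip H x y"] by linarith
  finally show "(vnorm H (vadd H x y))\<^sup>2 \<le> (vnorm H x + vnorm H y)\<^sup>2"
    by (simp add: power2_eq_square algebra_simps)
qed (use assms in \<open>simp add: norm_nonneg\<close>)

lemma norm_scale: "x \<in> vecs H \<Longrightarrow> vnorm H (vscale H a x) = cmod a * vnorm H x"
proof -
  assume x: "x \<in> vecs H"
  have "ip H (vscale H a x) (vscale H a x) = (a * cnj a) * ip H x x"
    using x by (simp add: ip_scale ip_scale_right scale_closed)
  also have "Re \<dots> = (cmod a * vnorm H x)\<^sup>2"
    using x by (simp add: ip_self complex_norm_square[symmetric] power_mult_distrib flip: of_real_power of_real_mult)
  finally show ?thesis
    using x by (simp add: vnorm_def[of H "vscale H a x"] norm_nonneg)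
qed

lemma norm_zero: "vnorm H (vzero H) = 0"
  by (simp add: vnorm_def ip_zero_left zero_closed)

text \<open>The representing vector minimises \<open>Q\<close>: if \<open>L\<close> is the pairing
  with \<open>w\<close>, then \<open>Q x\<close> is the squared distance of \<open>x\<close> and
  \<open>w\<close> minus the squared norm of \<open>w\<close>. Completeness provides the minimiser,
  since a minimising sequence is Cauchy.\<close>

lemma riesz:
  assumes add: "\<And>x y. \<lbrakk>x \<in> vecs H; y \<in> vecs H\<rbrakk> \<Longrightarrow> L (vadd H x y) = L x + L y"
    and scale: "\<And>a x. x \<in> vecs H \<Longrightarrow> L (vscale H a x) = a * L x"
    and bound: "\<And>x. x \<in> vecs H \<Longrightarrow> cmod (L x) \<le> C * vnorm H x"
  shows "\<exists>w\<in>vecs H. \<forall>x\<in>vecs H. L x = ip H x w"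
proof -
  define Q where "Q x = (vnorm H x)\<^sup>2 - 2 * Re (L x)" for x
  define m where "m = Inf (Q ` vecs H)"
  have Q_ge: "- C\<^sup>2 \<le> Q x" if "x \<in> vecs H" for x
  proof -
    have "Re (L x) \<le> C * vnorm H x"
      using bound[OF that] complex_Re_le_cmod[of "L x"] by linarith
    moreover have "0 \<le> (vnorm H x - C)\<^sup>2" by simp
    ultimately show ?thesis by (simp add: Q_def power2_eq_square algebra_simps)
  qed
  then have bdd: "bdd_below (Q ` vecs H)" by (auto intro!: bdd_belowI[of _ "- C\<^sup>2"])
  have m_le: "m \<le> Q x" if "x \<in> vecs H" for x
    unfolding m_def using that bdd by (auto intro: cInf_lower)
  \<comment> \<open>a near minimiser of \<open>Q\<close> nearly represents \<open>L\<close>\<close>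
  have near: "cmod (ip H x y - L x) \<le> sqrt (Q y - m) * vnorm H x"
    if x: "x \<in> vecs H" and y: "y \<in> vecs H" for x y
  proof (rule abs_le_sqrt_mult)
    have "(cmod (ip H x y - L x))\<^sup>2 \<le> (Q y - m) * (vnorm H x)\<^sup>2"
    proof (rule quadratic_nonneg_bound)
      fix t
      let ?z = "vadd H y (vscale H t x)"
      have "ip H ?z ?z = ip H y y + t * ip H x y + cnj (t * ip H x y) + t * cnj t * ip H x x"
        using x y ip_cnj[of x y]
        by (simp add: ip_add ip_scale ip_add_right ip_scale_right scale_closed add_closed algebra_simps)
      also have "Re \<dots> = (vnorm H y)\<^sup>2 + 2 * Re (t * ip H x y) + (cmod t)\<^sup>2 * (vnorm H x)\<^sup>2"
        using x y by (simp add: ip_self complex_norm_square[symmetric] flip: of_real_power)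
      finally have "(vnorm H ?z)\<^sup>2 = (vnorm H y)\<^sup>2 + 2 * Re (t * ip H x y) + (cmod t)\<^sup>2 * (vnorm H x)\<^sup>2"
        using x y by (simp add: norm_square add_closed scale_closed ip_nonneg)
      moreover have "L ?z = L y + t * L x" using x y by (simp add: add scale scale_closed)
      ultimately have "Q ?z = Q y + 2 * Re (t * (ip H x y - L x)) + (cmod t)\<^sup>2 * (vnorm H x)\<^sup>2"
        unfolding Q_def by (simp add: algebra_simps)
      then show "0 \<le> Q y - m + 2 * Re (t * (ip H x y - L x)) + (cmod t)\<^sup>2 * (vnorm H x)\<^sup>2"
        using m_le[of ?z] x y by (simp add: add_closed scale_closed)
    qed simp
    then show "(cmod (ip H x y - L x))\<^sup>2 \<le> (sqrt (Q y - m))\<^sup>2 * (vnorm H x)\<^sup>2"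
      using m_le[OF y] by simp
  qed (use x y m_le in \<open>auto simp: norm_nonneg\<close>)
  have "\<exists>y\<in>vecs H. Q y < m + 1 / (real n + 1)" for n
    using cInf_lessD[of "Q ` vecs H" "m + 1 / (real n + 1)"] zero_closed unfolding m_def by auto
  then obtain y where y: "\<And>n. y n \<in> vecs H" "\<And>n. Q (y n) < m + 1 / (real n + 1)" by metis
  define \<delta> where "\<delta> n = sqrt (Q (y n) - m)" for n
  have \<delta>_nonneg: "0 \<le> \<delta> n" for n unfolding \<delta>_def using m_le[OF y(1)] by simp
  have "(\<lambda>n. 1 / (real n + 1)) \<longlonglongrightarrow> 0"
    using LIMSEQ_inverse_real_of_nat by (simp add: inverse_eq_divide add.commute)
  then have "(\<lambda>n. Q (y n) - m) \<longlonglongrightarrow> 0"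
    by (rule tendsto_sandwich[OF _ _ tendsto_const, rotated 2])
      (use y(2) m_le[OF y(1)] in \<open>auto intro!: always_eventually simp: less_imp_le algebra_simps\<close>)
  then have \<delta>_lim: "\<delta> \<longlonglongrightarrow> 0"
    unfolding \<delta>_def using tendsto_real_sqrt[of "\<lambda>n. Q (y n) - m" 0] by simp
  \<comment> \<open>Tested on the difference of \<open>y i\<close> and \<open>y j\<close>, the two
    residuals differ by exactly the squared norm of that difference.\<close>
  have dist: "vdist H (y i) (y j) \<le> \<delta> i + \<delta> j" for i j
  proof -
    let ?x = "diff (y i) (y j)"
    have x: "?x \<in> vecs H" using y by (simp add: diff_closed)
    have "(vnorm H ?x)\<^sup>2 = cmod (ip H ?x ?x)" using x by (simp add: ip_self norm_power)
    also have "ip H ?x ?x = (ip H ?x (y i) - L ?x) - (ip H ?x (y j) - L ?x)"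
      using x y by (simp add: ip_diff_right)
    also have "cmod \<dots> \<le> \<delta> i * vnorm H ?x + \<delta> j * vnorm H ?x"
      using near[OF x y(1)[of i]] near[OF x y(1)[of j]] norm_triangle_ineq4 unfolding \<delta>_def
      by (smt (verit))
    finally have "vnorm H ?x * vnorm H ?x \<le> (\<delta> i + \<delta> j) * vnorm H ?x"
      by (simp add: power2_eq_square algebra_simps)
    then show ?thesis
      unfolding vdist_def using norm_nonneg[OF x] \<delta>_nonneg[of i] \<delta>_nonneg[of j]
      by (cases "vnorm H ?x = 0") auto
  qed
  have "\<exists>w\<in>vecs H. (\<lambda>n. vdist H (y n) w) \<longlonglongrightarrow> 0"
  proof (rule complete)
    fix e :: real assume "0 < e"
    then obtain N where N: "\<And>n. n \<ge> N \<Longrightarrow> \<delta> n < e / 2"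
      using \<delta>_lim \<delta>_nonneg unfolding lim_sequentially dist_real_def
      by (metis abs_of_nonneg diff_zero half_gt_zero)
    then show "\<exists>N. \<forall>m\<ge>N. \<forall>n\<ge>N. vdist H (y m) (y n) < e"
      using dist by (intro exI[of _ N]) (smt (verit) field_sum_of_halves)
  qed (rule y)
  then obtain w where w: "w \<in> vecs H" "(\<lambda>n. vdist H (y n) w) \<longlonglongrightarrow> 0" by auto
  have "L x = ip H x w" if x: "x \<in> vecs H" for x
  proof -
    have "cmod (ip H x w - L x) \<le> \<delta> n * vnorm H x + vnorm H x * vdist H (y n) w" for n
    proof -
      have eq: "ip H x w - L x = (ip H x (y n) - L x) - ip H x (diff (y n) w)"
        using x w y by (simp add: ip_diff_right)
      have "cmod (ip H x w - L x) \<le> cmod (ip H x (y n) - L x) + cmod (ip H x (diff (y n) w))"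
        unfolding eq by (rule norm_triangle_ineq4)
      then show ?thesis
        using near[OF x y(1)[of n]] cauchy_schwarz[OF x diff_closed[OF y(1)[of n] w(1)]]
        unfolding \<delta>_def vdist_def by linarith
    qed
    moreover have "(\<lambda>n. \<delta> n * vnorm H x + vnorm H x * vdist H (y n) w) \<longlonglongrightarrow> 0"
      using tendsto_add[OF tendsto_mult_left_zero[OF \<delta>_lim, of "vnorm H x"]
          tendsto_mult_right_zero[OF w(2), of "vnorm H x"]] by simp
    ultimately have "cmod (ip H x w - L x) \<le> 0"
      by (intro LIMSEQ_le_const[where X = "\<lambda>n. \<delta> n * vnorm H x + vnorm H x * vdist H (y n) w"]) auto
    then show ?thesis by simp
  qed
  then show ?thesis using w by auto
qed

text \<open>The Riesz vector of \<open>L\<close> is orthogonal to \<open>S\<close>, hence zero. The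
  separation hypothesis stands in for density of the span of \<open>S\<close>.\<close>

lemma functional_eq_zero:
  assumes add: "\<And>x y. \<lbrakk>x \<in> vecs H; y \<in> vecs H\<rbrakk> \<Longrightarrow> L (vadd H x y) = L x + L y"
    and scale: "\<And>a x. x \<in> vecs H \<Longrightarrow> L (vscale H a x) = a * L x"
    and bound: "\<And>x. x \<in> vecs H \<Longrightarrow> cmod (L x) \<le> C * vnorm H x"
    and sub: "S \<subseteq> vecs H"
    and separating: "\<And>w. \<lbrakk>w \<in> vecs H; \<And>s. s \<in> S \<Longrightarrow> ip H w s = 0\<rbrakk> \<Longrightarrow> w = vzero H"
    and vanish: "\<And>s. s \<in> S \<Longrightarrow> L s = 0"
    and x: "x \<in> vecs H"
  shows "L x = 0"
proof -
  obtain w where w: "w \<in> vecs H" "\<And>x. x \<in> vecs H \<Longrightarrow> L x = ip H x w"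
    using riesz[of L C] add scale bound by blast
  have "w = vzero H"
  proof (rule separating[OF w(1)])
    fix s assume s: "s \<in> S"
    then show "ip H w s = 0"
      using w vanish[OF s] sub ip_cnj[of s w] by (auto simp: subset_iff)
  qed
  then show ?thesis using w x by (simp add: ip_zero_right)
qed

section \<open>Bounded operators, adjoints and rank one operators\<close>

lemma bopsD:
  assumes "T \<in> bops H"
  shows "x \<in> vecs H \<Longrightarrow> T x \<in> vecs H"
    and "\<lbrakk>x \<in> vecs H; y \<in> vecs H\<rbrakk> \<Longrightarrow> T (vadd H x y) = vadd H (T x) (T y)"
    and "x \<in> vecs H \<Longrightarrow> T (vscale H a x) = vscale H a (T x)"
    and "x \<notin> vecs H \<Longrightarrow> T x = undefined"
  using assms by (auto simp: bops_def)

lemma bops_bound: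
  assumes "T \<in> bops H"
  obtains C where "0 \<le> C" "\<And>x. x \<in> vecs H \<Longrightarrow> vnorm H (T x) \<le> C * vnorm H x"
proof -
  obtain C where C: "\<And>x. x \<in> vecs H \<Longrightarrow> vnorm H (T x) \<le> C * vnorm H x"
    using assms unfolding bops_def by blast
  have "vnorm H (T x) \<le> max 0 C * vnorm H x" if "x \<in> vecs H" for x
    using C[OF that] norm_nonneg[OF that] mult_right_mono[of C "max 0 C" "vnorm H x"] by simp
  then show ?thesis using that[of "max 0 C"] by simp
qed

lemma bops_eqI:
  assumes "S \<in> bops H" "T \<in> bops H" "\<And>x. x \<in> vecs H \<Longrightarrow> S x = T x"
  shows "S = T"
  using assms by (metis bopsD(4) ext)

lemma bopsI:
  assumes "T \<in> extensional (vecs H)"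
    and "\<And>x. x \<in> vecs H \<Longrightarrow> T x \<in> vecs H"
    and "\<And>x y. \<lbrakk>x \<in> vecs H; y \<in> vecs H\<rbrakk> \<Longrightarrow> T (vadd H x y) = vadd H (T x) (T y)"
    and "\<And>a x. x \<in> vecs H \<Longrightarrow> T (vscale H a x) = vscale H a (T x)"
    and "\<And>x. x \<in> vecs H \<Longrightarrow> vnorm H (T x) \<le> C * vnorm H x"
  shows "T \<in> bops H"
  unfolding bops_def using assms by (intro CollectI conjI exI[of _ C]) (auto simp: PiE_def)

text \<open>Riesz applied to \<open>x \<mapsto> \<langle>T x, y\<rangle>\<close> for each
  \<open>y\<close>; linearity in \<open>y\<close> comes from uniqueness of the representing
  vector.\<close>

lemma adjoint_exists:
  assumes T: "T \<in> bops H"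
  shows "\<exists>S\<in>bops H. \<forall>x\<in>vecs H. \<forall>y\<in>vecs H. ip H (T x) y = ip H x (S y)"
proof -
  obtain C where C: "0 \<le> C" "\<And>x. x \<in> vecs H \<Longrightarrow> vnorm H (T x) \<le> C * vnorm H x"
    using bops_bound[OF T] by blast
  have "\<exists>w\<in>vecs H. \<forall>x\<in>vecs H. ip H (T x) y = ip H x w" if y: "y \<in> vecs H" for y
  proof (rule riesz[where C = "C * vnorm H y"])
    fix x assume x: "x \<in> vecs H"
    have "cmod (ip H (T x) y) \<le> vnorm H (T x) * vnorm H y"
      using x y T by (simp add: cauchy_schwarz bopsD)
    also have "\<dots> \<le> C * vnorm H x * vnorm H y"
      using C x norm_nonneg[OF y] by (simp add: mult_right_mono)
    finally show "cmod (ip H (T x) y) \<le> C * vnorm H y * vnorm H x" by (simp add: mult_ac)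
  qed (use y T in \<open>simp_all add: bopsD ip_add ip_scale\<close>)
  then obtain S' where S': "\<And>y. y \<in> vecs H \<Longrightarrow> S' y \<in> vecs H"
    "\<And>x y. \<lbrakk>x \<in> vecs H; y \<in> vecs H\<rbrakk> \<Longrightarrow> ip H (T x) y = ip H x (S' y)"
    by metis
  have S'_eqI: "S' y = w" if "y \<in> vecs H" "w \<in> vecs H"
    "\<And>x. x \<in> vecs H \<Longrightarrow> ip H (T x) y = ip H x w" for y w
    using that S' by (intro eq_by_ip) (auto, metis ip_cnj)
  have "restrict S' (vecs H) \<in> bops H"
  proof (rule bopsI[where C = C])
    fix x y assume xy: "x \<in> vecs H" "y \<in> vecs H"
    have "S' (vadd H x y) = vadd H (S' x) (S' y)"
      using xy S' T by (intro S'_eqI) (simp_all add: add_closed ip_add_right bopsD)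
    then show "restrict S' (vecs H) (vadd H x y) = vadd H (restrict S' (vecs H) x) (restrict S' (vecs H) y)"
      using xy by (simp add: add_closed)
  next
    fix a x assume x: "x \<in> vecs H"
    have "S' (vscale H a x) = vscale H a (S' x)"
      using x S' T by (intro S'_eqI) (simp_all add: scale_closed ip_scale_right bopsD)
    then show "restrict S' (vecs H) (vscale H a x) = vscale H a (restrict S' (vecs H) x)"
      using x by (simp add: scale_closed)
  next
    fix x assume x: "x \<in> vecs H"
    let ?n = "vnorm H (S' x)"
    \<comment> \<open>The squared norm of \<open>S' x\<close> is the inner product of
      \<open>T (S' x)\<close> with \<open>x\<close>, so a bound for \<open>T\<close> is also one for
      its adjoint.\<close>
    have "?n * ?n = cmod (ip H (T (S' x)) x)"
      using S' x by (simp add: ip_self norm_power power2_eq_square norm_mult)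
    also have "\<dots> \<le> vnorm H (T (S' x)) * vnorm H x"
      using cauchy_schwarz[of "T (S' x)" x] x S' T by (simp add: bopsD)
    also have "\<dots> \<le> (C * ?n) * vnorm H x"
      using C x S' norm_nonneg[OF x] by (simp add: mult_right_mono)
    finally have "?n * ?n \<le> (C * vnorm H x) * ?n" by (simp add: mult_ac)
    then have "?n \<le> C * vnorm H x"
      using norm_nonneg[of "S' x"] S' x C(1) norm_nonneg[OF x]
      by (cases "?n = 0") auto
    then show "vnorm H (restrict S' (vecs H) x) \<le> C * vnorm H x"
      using x by simp
  qed (use S' in auto)
  then show ?thesis using S' by (intro bexI[of _ "restrict S' (vecs H)"]) auto
qed

lemma adjoint_unique:
  assumes "S \<in> bops H" "S' \<in> bops H"
    and "\<And>x y. \<lbrakk>x \<in> vecs H; y \<in> vecs H\<rbrakk> \<Longrightarrow> ip H x (S y) = ip H x (S' y)"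
  shows "S = S'"
proof (rule bops_eqI)
  fix y assume y: "y \<in> vecs H"
  show "S y = S' y"
    using assms y by (intro eq_by_ip) (auto simp: bopsD, metis bopsD(1) ip_cnj)
qed (use assms in auto)

lemma adjoint:
  assumes "T \<in> bops H"
  shows adjoint_closed: "adjoint H T \<in> bops H"
    and ip_adjoint: "\<lbrakk>x \<in> vecs H; y \<in> vecs H\<rbrakk> \<Longrightarrow> ip H (T x) y = ip H x (adjoint H T y)"
proof -
  have "\<exists>!S. S \<in> bops H \<and> (\<forall>x\<in>vecs H. \<forall>y\<in>vecs H. ip H (T x) y = ip H x (S y))"
    using adjoint_exists[OF assms] adjoint_unique by (metis (no_types, lifting))
  from theI'[OF this] show "adjoint H T \<in> bops H"
    "\<lbrakk>x \<in> vecs H; y \<in> vecs H\<rbrakk> \<Longrightarrow> ip H (T x) y = ip H x (adjoint H T y)"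
    unfolding adjoint_def by auto
qed

lemma zero_op_closed: "zero_op H \<in> bops H"
  by (rule bopsI[where C = 0])
    (auto simp: zero_op_def zero_closed add_closed scale_closed add_zero
      eq_by_ip ip_scale ip_zero_left norm_zero)

lemma id_op_closed: "id_op H \<in> bops H"
  by (rule bopsI[where C = 1]) (auto simp: id_op_def add_closed scale_closed)

lemma mult_op_apply: "x \<in> vecs H \<Longrightarrow> mult_op H S T x = S (T x)"
  by (simp add: mult_op_def compose_def)

lemma mult_op_closed:
  assumes S: "S \<in> bops H" and T: "T \<in> bops H"
  shows "mult_op H S T \<in> bops H"
proof -
  obtain C D where C: "0 \<le> C" "\<And>x. x \<in> vecs H \<Longrightarrow> vnorm H (S x) \<le> C * vnorm H x"
    and D: "\<And>x. x \<in> vecs H \<Longrightarrow> vnorm H (T x) \<le> D * vnorm H x"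
    using bops_bound[OF S] bops_bound[OF T] by metis
  show ?thesis
  proof (rule bopsI[where C = "C * D"])
    fix x assume x: "x \<in> vecs H"
    have "vnorm H (S (T x)) \<le> C * vnorm H (T x)" using C x T by (simp add: bopsD)
    also have "\<dots> \<le> C * (D * vnorm H x)" using C D x by (simp add: mult_left_mono)
    finally show "vnorm H (mult_op H S T x) \<le> C * D * vnorm H x"
      using x by (simp add: mult_op_apply mult_ac)
  qed (use S T in \<open>auto simp: mult_op_apply bopsD add_closed scale_closed\<close>,
      simp add: mult_op_def)
qed

lemma scale_op_closed:
  assumes T: "T \<in> bops H"
  shows "scale_op H a T \<in> bops H"
proof -
  obtain C where C: "\<And>x. x \<in> vecs H \<Longrightarrow> vnorm H (T x) \<le> C * vnorm H x"
    using bops_bound[OF T] by metis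
  show ?thesis
  proof (rule bopsI[where C = "cmod a * C"])
    fix x assume x: "x \<in> vecs H"
    then show "vnorm H (scale_op H a T x) \<le> cmod a * C * vnorm H x"
      using C[OF x] T by (simp add: scale_op_def norm_scale bopsD mult.assoc mult_left_mono)
  qed (use T in \<open>simp_all add: scale_op_def bopsD add_closed scale_closed scale_add_right
        scale_scale mult.commute[of a]\<close>)
qed

lemma add_op_closed:
  assumes S: "S \<in> bops H" and T: "T \<in> bops H"
  shows "add_op H S T \<in> bops H"
proof -
  obtain C D where C: "\<And>x. x \<in> vecs H \<Longrightarrow> vnorm H (S x) \<le> C * vnorm H x"
    and D: "\<And>x. x \<in> vecs H \<Longrightarrow> vnorm H (T x) \<le> D * vnorm H x"
    using bops_bound[OF S] bops_bound[OF T] by metis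
  show ?thesis
  proof (rule bopsI[where C = "C + D"])
    fix x assume x: "x \<in> vecs H"
    then show "vnorm H (add_op H S T x) \<le> (C + D) * vnorm H x"
      using C[OF x] D[OF x] norm_triangle[of "S x" "T x"] S T
      by (simp add: add_op_def bopsD algebra_simps)
  next
    fix x y assume xy: "x \<in> vecs H" "y \<in> vecs H"
    then show "add_op H S T (vadd H x y) = vadd H (add_op H S T x) (add_op H S T y)"
      using S T by (simp add: add_op_def add_closed bopsD) 
        (rule eq_by_ip, simp_all add: add_closed bopsD ip_add)
  qed (use S T in \<open>auto simp: add_op_def bopsD add_closed scale_closed scale_add_right\<close>)
qed

lemma star_subalgebra_bops: "star_subalgebra H (bops H)"
  by (simp add: star_subalgebra_def zero_op_closed add_op_closed mult_op_closed adjoint_closed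
      scale_op_closed)

text \<open>Makes \<open>bops H\<close> one of the algebras in the hull that defines
  \<open>vn_tensor\<close>, which therefore consists of bounded operators.\<close>

lemma von_neumann_algebra_bops: "von_neumann_algebra H (bops H)"
  using star_subalgebra_bops by (auto simp: von_neumann_algebra_def commutant_def)

text \<open>The orthogonal projection onto the line of \<open>w\<close> when \<open>w\<close> is a
  unit vector; for other non-zero \<open>w\<close>, that projection times the squared norm.\<close>

definition rank_one :: "'a \<Rightarrow> 'a \<Rightarrow> 'a" where
  "rank_one w = (\<lambda>x\<in>vecs H. vscale H (ip H x w) w)"

lemma rank_one_closed:
  assumes w: "w \<in> vecs H"
  shows "rank_one w \<in> bops H"
proof (rule bopsI[where C = "(vnorm H w)\<^sup>2"])
  fix x assume x: "x \<in> vecs H"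
  have "cmod (ip H x w) * vnorm H w \<le> (vnorm H x * vnorm H w) * vnorm H w"
    using cauchy_schwarz[OF x w] norm_nonneg[OF w] by (rule mult_right_mono)
  then show "vnorm H (rank_one w x) \<le> (vnorm H w)\<^sup>2 * vnorm H x"
    using x w by (simp add: rank_one_def norm_scale power2_eq_square mult_ac)
qed (use w in \<open>auto simp: rank_one_def scale_closed add_closed ip_add ip_scale scale_add_left scale_scale\<close>)

text \<open>The adjoint of \<open>U\<close> moves from \<open>x\<close> to \<open>w\<close> inside
  the inner product. As the actions have the form \<open>Ad\<close>, this gives the image of the
  projection onto a reference vector.\<close>

lemma Ad_rank_one:
  assumes U: "U \<in> unitaries H" and w: "w \<in> vecs H"
  shows "Ad H U (rank_one w) = rank_one (U w)"
proof -
  have U': "U \<in> bops H" using U by (simp add: unitaries_def)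
  show ?thesis
  proof (rule bops_eqI)
    fix x assume x: "x \<in> vecs H"
    have "ip H (adjoint H U x) w = ip H x (U w)"
      using ip_adjoint[OF U' w x] ip_cnj[of "U w" x] ip_cnj[of w "adjoint H U x"] U' w x
        adjoint_closed[OF U'] by (simp add: bopsD)
    then show "Ad H U (rank_one w) x = rank_one (U w) x"
      using U' w x adjoint_closed[OF U']
      by (simp add: Ad_def mult_op_apply rank_one_def bopsD)
  qed (use U' w in \<open>simp_all add: Ad_def mult_op_closed rank_one_closed adjoint_closed bopsD(1)\<close>)
qed

lemma unitary_ip:
  assumes U: "U \<in> unitaries H" and x: "x \<in> vecs H" and y: "y \<in> vecs H"
  shows "ip H (U x) (U y) = ip H x y"
proof -
  have "mult_op H (adjoint H U) U y = id_op H y" using U by (simp add: unitaries_def)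
  then have "adjoint H U (U y) = y" using y by (simp add: mult_op_apply id_op_def)
  then show ?thesis
    using ip_adjoint[of U x "U y"] U x y by (simp add: unitaries_def bopsD)
qed

text \<open>The combination of the \<open>h s\<close> is described by its inner products, which
  determine it by \<open>eq_by_ip\<close>, instead of by an iterated \<open>vadd\<close>.\<close>

lemma finite_combination:
  assumes "finite F" "\<And>s. s \<in> F \<Longrightarrow> h s \<in> vecs H"
  shows "\<exists>w\<in>vecs H. \<forall>z\<in>vecs H. ip H w z = (\<Sum>s\<in>F. c s * ip H (h s) z)"
  using assms
proof (induction F rule: finite_induct)
  case empty
  show ?case by (rule bexI[OF _ zero_closed]) (simp add: ip_zero_left)
next
  case (insert s F)
  then obtain w where "w \<in> vecs H" "\<And>z. z \<in> vecs H \<Longrightarrow> ip H w z = (\<Sum>s\<in>F. c s * ip H (h s) z)"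
    by auto
  with insert show ?case
    by (intro bexI[of _ "vadd H (vscale H (c s) (h s)) w"])
      (simp_all add: ip_add ip_scale scale_closed add_closed)
qed

end


section \<open>Spaces generated by positive definite kernels\<close>

lemma tendsto_zero_comparison:
  fixes f :: "nat \<Rightarrow> 'b::real_normed_vector" and g :: "nat \<Rightarrow> real"
  assumes "g \<longlonglongrightarrow> 0" "\<And>n. norm (f n) \<le> g n"
  shows "f \<longlonglongrightarrow> 0"
  by (rule tendsto_0_le[OF assms(1), where K = 1])
    (use assms(2) in \<open>auto intro!: always_eventually intro: order_trans[OF _ abs_ge_self]\<close>)

section \<open>Formal linear combinations and the sesquilinear form of a kernel\<close>

definition pm_sum :: "('x \<Rightarrow>\<^sub>0 complex) \<Rightarrow> ('x \<Rightarrow> complex) \<Rightarrow> complex" where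
  "pm_sum c h = (\<Sum>x\<in>Poly_Mapping.keys c. Poly_Mapping.lookup c x * h x)"

definition pm_scale :: "complex \<Rightarrow> ('x \<Rightarrow>\<^sub>0 complex) \<Rightarrow> ('x \<Rightarrow>\<^sub>0 complex)" where
  "pm_scale a = Poly_Mapping.map ((*) a)"

text \<open>The pushforward along \<open>a\<close>: coefficients of points with the same image add
  up.\<close>

definition push :: "('x \<Rightarrow> 'y) \<Rightarrow> ('x \<Rightarrow>\<^sub>0 complex) \<Rightarrow> ('y \<Rightarrow>\<^sub>0 complex)" where
  "push a c = (\<Sum>x\<in>Poly_Mapping.keys c. Poly_Mapping.single (a x) (Poly_Mapping.lookup c x))"

lemma lookup_pm_scale [simp]:
  "Poly_Mapping.lookup (pm_scale a c) x = a * Poly_Mapping.lookup c x"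
  by (simp add: pm_scale_def Poly_Mapping.map.rep_eq when_def)

lemma pm_sum_superset:
  assumes "finite A" "Poly_Mapping.keys c \<subseteq> A"
  shows "pm_sum c h = (\<Sum>x\<in>A. Poly_Mapping.lookup c x * h x)"
  unfolding pm_sum_def
  by (rule sum.mono_neutral_left) (use assms in \<open>auto simp: in_keys_iff\<close>)

lemma pm_sum_add: "pm_sum (c + d) h = pm_sum c h + pm_sum d h"
proof -
  let ?A = "Poly_Mapping.keys c \<union> Poly_Mapping.keys d"
  have "Poly_Mapping.keys (c + d) \<subseteq> ?A" by (rule keys_add)
  then show ?thesis
    by (simp add: pm_sum_superset[of ?A] lookup_add distrib_right sum.distrib)
qed

lemma pm_sum_scale: "pm_sum (pm_scale a c) h = a * pm_sum c h"
proof -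
  have "Poly_Mapping.keys (pm_scale a c) \<subseteq> Poly_Mapping.keys c"
    by (auto simp: in_keys_iff)
  then show ?thesis
    by (simp add: pm_sum_superset[of "Poly_Mapping.keys c"] sum_distrib_left mult.assoc)
qed

lemma diff_conv_pm_scale: "c - d = c + pm_scale (- 1) d"
  by (rule poly_mapping_eqI) (simp add: lookup_add lookup_minus)

lemma pm_sum_diff: "pm_sum (c - d) h = pm_sum c h - pm_sum d h"
  by (simp add: diff_conv_pm_scale pm_sum_add pm_sum_scale)

lemma pm_sum_zero [simp]: "pm_sum 0 h = 0"
  by (simp add: pm_sum_def)

lemma pm_sum_single [simp]: "pm_sum (Poly_Mapping.single x a) h = a * h x"
  by (simp add: pm_sum_def)

lemma pm_sum_sum: "pm_sum (sum f A) h = (\<Sum>x\<in>A. pm_sum (f x) h)"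
  by (induction A rule: infinite_finite_induct) (simp_all add: pm_sum_add)

lemma pm_sum_cong:
  "(\<And>x. x \<in> Poly_Mapping.keys c \<Longrightarrow> h x = h' x) \<Longrightarrow> pm_sum c h = pm_sum c h'"
  by (simp add: pm_sum_def)

lemma pm_sum_push: "pm_sum (push a c) h = pm_sum c (\<lambda>x. h (a x))"
  by (simp add: push_def pm_sum_sum) (simp add: pm_sum_def)

lemma pm_sum_diff_right: "pm_sum c (\<lambda>x. h x - h' x) = pm_sum c h - pm_sum c h'"
  by (simp add: pm_sum_def right_diff_distrib sum_subtractf)

lemma pm_sum_scale_right: "pm_sum c (\<lambda>x. a * h x) = a * pm_sum c h"
  by (simp add: pm_sum_def sum_distrib_left mult.left_commute)

lemma tendsto_pm_sum:
  assumes "\<And>x. x \<in> Poly_Mapping.keys c \<Longrightarrow> (\<lambda>n. h n x) \<longlonglongrightarrow> h' x"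
  shows "(\<lambda>n. pm_sum c (h n)) \<longlonglongrightarrow> pm_sum c h'"
  unfolding pm_sum_def by (intro tendsto_sum tendsto_mult tendsto_const assms)

lemma lookup_push:
  "Poly_Mapping.lookup (push a c) z = pm_sum c (\<lambda>x. if a x = z then 1 else 0)"
  by (auto simp: push_def lookup_sum lookup_single pm_sum_def when_def intro!: sum.cong)

lemma push_diff: "push a (c - d) = push a c - push a d"
  by (rule poly_mapping_eqI) (simp add: lookup_push lookup_minus pm_sum_diff)

text \<open>As two nested linear extensions, the form inherits linearity in \<open>c\<close> from
  \<open>pm_sum_add\<close> and its relatives. The primed variant nests them in the other order and
  serves the second argument.\<close>

lemma kernel_form_pm_sum:
  "kernel_form k c d = pm_sum c (\<lambda>x. cnj (pm_sum d (\<lambda>y. cnj (k x y))))"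
  by (simp add: kernel_form_def pm_sum_def sum_distrib_left mult.assoc)

lemma kernel_form_pm_sum':
  "kernel_form k c d = cnj (pm_sum d (\<lambda>y. cnj (pm_sum c (\<lambda>x. k x y))))"
  unfolding kernel_form_def pm_sum_def
  by (subst sum.swap) (simp add: sum_distrib_left mult.assoc mult.left_commute)

lemma kernel_form_add_left: "kernel_form k (c + c') d = kernel_form k c d + kernel_form k c' d"
  by (simp add: kernel_form_pm_sum pm_sum_add)

lemma kernel_form_scale_left: "kernel_form k (pm_scale a c) d = a * kernel_form k c d"
  by (simp add: kernel_form_pm_sum pm_sum_scale)

lemma kernel_form_diff_left: "kernel_form k (c - c') d = kernel_form k c d - kernel_form k c' d"
  by (simp add: kernel_form_pm_sum pm_sum_diff)

lemma kernel_form_add_right: "kernel_form k c (d + d') = kernel_form k c d + kernel_form k c d'"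
  by (simp add: kernel_form_pm_sum' pm_sum_add)

lemma kernel_form_scale_right: "kernel_form k c (pm_scale a d) = cnj a * kernel_form k c d"
  by (simp add: kernel_form_pm_sum' pm_sum_scale)

lemma kernel_form_diff_right: "kernel_form k c (d - d') = kernel_form k c d - kernel_form k c d'"
  by (simp add: kernel_form_pm_sum' pm_sum_diff)

lemma free_space_zero: "0 \<in> free_space X"
  by (simp add: free_space_def)

lemma free_space_add: "\<lbrakk>c \<in> free_space X; d \<in> free_space X\<rbrakk> \<Longrightarrow> c + d \<in> free_space X"
  using keys_add[of c d] by (auto simp: free_space_def)

lemma free_space_scale: "c \<in> free_space X \<Longrightarrow> pm_scale a c \<in> free_space X"
  by (auto simp: free_space_def in_keys_iff subset_iff)

lemma free_space_diff: "\<lbrakk>c \<in> free_space X; d \<in> free_space X\<rbrakk> \<Longrightarrow> c - d \<in> free_space X"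
  by (simp add: diff_conv_pm_scale free_space_add free_space_scale)

lemma free_space_single: "x \<in> X \<Longrightarrow> Poly_Mapping.single x a \<in> free_space X"
  by (simp add: free_space_def)

lemma free_space_sum:
  "(\<And>x. x \<in> A \<Longrightarrow> f x \<in> free_space X) \<Longrightarrow> sum f A \<in> free_space X"
  by (induction A rule: infinite_finite_induct) (simp_all add: free_space_zero free_space_add)

lemma free_space_push:
  "\<lbrakk>c \<in> free_space X; a \<in> X \<rightarrow> Y\<rbrakk> \<Longrightarrow> push a c \<in> free_space Y"
  unfolding push_def by (intro free_space_sum free_space_single) (auto simp: free_space_def)

section \<open>The Hilbert space of a positive semidefinite kernel\<close>

locale psd_kernel =
  fixes X :: "'x set" and k :: "'x \<Rightarrow> 'x \<Rightarrow> complex"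
  assumes hermitian: "\<lbrakk>x \<in> X; y \<in> X\<rbrakk> \<Longrightarrow> k y x = cnj (k x y)"
    and form_nonneg: "c \<in> free_space X \<Longrightarrow> 0 \<le> Re (kernel_form k c c)"
begin

abbreviation form where "form \<equiv> kernel_form k"
abbreviation K where "K \<equiv> kernel_space X k"
text \<open>Only a seminorm in general: different formal combinations may represent one vector of
  the completion, and \<open>combination\<close> sends each of them to the function that is this
  vector.\<close>

definition sn where "sn c = sqrt (Re (form c c))"
definition combination where "combination c = (\<lambda>y. if y \<in> X then pm_sum c (\<lambda>x. k x y) else 0)"

lemma form_cnj:
  assumes "c \<in> free_space X" "d \<in> free_space X"
  shows "form d c = cnj (form c d)"
proof -
  have "pm_sum d (\<lambda>y. cnj (pm_sum c (\<lambda>x. k x y))) = pm_sum d (\<lambda>x. cnj (pm_sum c (\<lambda>y. cnj (k x y))))"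
    using assms
    by (intro pm_sum_cong arg_cong[of _ _ cnj]) (auto simp: free_space_def intro!: hermitian)
  then show ?thesis by (simp add: kernel_form_pm_sum[of k d c] kernel_form_pm_sum'[of k c d])
qed

lemma sn_nonneg: "c \<in> free_space X \<Longrightarrow> 0 \<le> sn c"
  by (simp add: sn_def form_nonneg)

lemma sn_square: "c \<in> free_space X \<Longrightarrow> (sn c)\<^sup>2 = Re (form c c)"
  by (simp add: sn_def form_nonneg)

lemma form_self: "c \<in> free_space X \<Longrightarrow> form c c = of_real ((sn c)\<^sup>2)"
  using form_cnj[of c c] by (simp add: sn_square complex_eq_iff)

lemma form_cs:
  assumes "c \<in> free_space X" "d \<in> free_space X"
  shows "cmod (form c d) \<le> sn c * sn d"
proof (rule abs_le_sqrt_mult)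
  have "(cmod (form c d))\<^sup>2 \<le> (sn d)\<^sup>2 * (sn c)\<^sup>2"
  proof (rule quadratic_nonneg_bound)
    fix t
    let ?z = "d + pm_scale t c"
    have "form ?z ?z = form d d + t * form c d + cnj t * cnj (form c d) + t * cnj t * form c c"
      using assms form_cnj[of c d]
      by (simp add: kernel_form_add_left kernel_form_add_right kernel_form_scale_left
          kernel_form_scale_right algebra_simps)
    also have "Re \<dots> = (sn d)\<^sup>2 + 2 * Re (t * form c d) + (cmod t)\<^sup>2 * (sn c)\<^sup>2"
      using assms by (simp add: form_self complex_norm_square[symmetric] flip: of_real_power)
    finally show "0 \<le> (sn d)\<^sup>2 + 2 * Re (t * form c d) + (cmod t)\<^sup>2 * (sn c)\<^sup>2"
      using form_nonneg[of ?z] assms by (simp add: free_space_add free_space_scale)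
  qed simp
  then show "(cmod (form c d))\<^sup>2 \<le> (sn c)\<^sup>2 * (sn d)\<^sup>2" by (simp add: mult.commute)
qed (use assms in \<open>auto simp: sn_nonneg\<close>)

lemma sn_triangle:
  assumes "c \<in> free_space X" "d \<in> free_space X"
  shows "sn (c + d) \<le> sn c + sn d"
proof (rule power2_le_imp_le)
  have "(sn (c + d))\<^sup>2 = (sn c)\<^sup>2 + 2 * Re (form c d) + (sn d)\<^sup>2"
    using assms form_cnj[of c d]
    by (simp add: sn_square kernel_form_add_left kernel_form_add_right free_space_add)
  also have "\<dots> \<le> (sn c)\<^sup>2 + 2 * (sn c * sn d) + (sn d)\<^sup>2"
    using form_cs[OF assms] complex_Re_le_cmod[of "form c d"] by linarith
  finally show "(sn (c + d))\<^sup>2 \<le> (sn c + sn d)\<^sup>2"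
    by (simp add: power2_eq_square algebra_simps)
qed (use assms in \<open>simp add: sn_nonneg\<close>)

lemma sn_diff_commute: "sn (c - d) = sn (d - c)"
  by (simp add: sn_def kernel_form_diff_left kernel_form_diff_right algebra_simps)

lemma sn_triangle3:
  assumes "c \<in> free_space X" "d \<in> free_space X" "e \<in> free_space X"
  shows "sn (c - e) \<le> sn (c - d) + sn (d - e)"
  using sn_triangle[of "c - d" "d - e"] assms by (simp add: free_space_diff)

lemma sn_diff_bound:
  assumes "c \<in> free_space X" "d \<in> free_space X"
  shows "\<bar>sn c - sn d\<bar> \<le> sn (c - d)"
  using sn_triangle[of "c - d" d] sn_triangle[of "d - c" c] sn_diff_commute[of c d] assms
  by (simp add: free_space_diff)

lemma approximates_iff:
  "approximates X k c f \<longleftrightarrow> (\<forall>n. c n \<in> free_space X) \<and>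
     (\<forall>e>0. \<exists>N. \<forall>m\<ge>N. \<forall>n\<ge>N. sn (c m - c n) < e) \<and>
     (\<forall>y\<in>X. (\<lambda>n. pm_sum (c n) (\<lambda>x. k x y)) \<longlonglongrightarrow> f y) \<and> (\<forall>y. y \<notin> X \<longrightarrow> f y = 0)"
proof (cases "\<forall>n. c n \<in> free_space X")
  case True
  then have sn2: "cmod (form (c m - c n) (c m - c n)) = (sn (c m - c n))\<^sup>2" for m n
    by (simp add: form_self free_space_diff norm_power)
  have "(\<forall>e>0. \<exists>N. \<forall>m\<ge>N. \<forall>n\<ge>N. (sn (c m - c n))\<^sup>2 < e) \<longleftrightarrow>
        (\<forall>e>0. \<exists>N. \<forall>m\<ge>N. \<forall>n\<ge>N. sn (c m - c n) < e)" (is "?L \<longleftrightarrow> ?R")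
  proof
    assume L: ?L
    show ?R
    proof (intro allI impI)
      fix e :: real assume "0 < e"
      then have "0 < e\<^sup>2" by simp
      then show "\<exists>N. \<forall>m\<ge>N. \<forall>n\<ge>N. sn (c m - c n) < e"
        using L \<open>0 < e\<close> by (meson less_imp_le power_less_imp_less_base)
    qed
  next
    assume R: ?R
    show ?L
    proof (intro allI impI)
      fix e :: real assume "0 < e"
      then have "0 < sqrt e" by simp
      then obtain N where N: "\<And>m n. m \<ge> N \<Longrightarrow> n \<ge> N \<Longrightarrow> sn (c m - c n) < sqrt e" using R by meson
      have "(sn (c m - c n))\<^sup>2 < e" if "m \<ge> N" "n \<ge> N" for m n
        using N[OF that] True sn_nonneg[of "c m - c n"] \<open>0 < e\<close>
        by (metis free_space_diff less_imp_le power_strict_mono real_sqrt_pow2 zero_less_numeral)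
      then show "\<exists>N. \<forall>m\<ge>N. \<forall>n\<ge>N. (sn (c m - c n))\<^sup>2 < e" by blast
    qed
  qed
  then show ?thesis unfolding approximates_def sn2 pm_sum_def by blast
qed (auto simp: approximates_def)

lemma approximatesD:
  assumes "approximates X k c f"
  shows "c n \<in> free_space X"
    and "0 < e \<Longrightarrow> \<exists>N. \<forall>m\<ge>N. \<forall>n\<ge>N. sn (c m - c n) < e"
    and "y \<in> X \<Longrightarrow> (\<lambda>n. pm_sum (c n) (\<lambda>x. k x y)) \<longlonglongrightarrow> f y"
    and "y \<notin> X \<Longrightarrow> f y = 0"
  using assms by (auto simp: approximates_iff)

lemma approximates_add:
  assumes c: "approximates X k c f" and d: "approximates X k d g"
  shows "approximates X k (\<lambda>n. c n + d n) (\<lambda>y. f y + g y)"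
  unfolding approximates_iff
proof (intro conjI allI ballI impI)
  fix e :: real assume "0 < e"
  then obtain N M where N: "\<And>m n. m \<ge> N \<Longrightarrow> n \<ge> N \<Longrightarrow> sn (c m - c n) < e / 2"
    and M: "\<And>m n. m \<ge> M \<Longrightarrow> n \<ge> M \<Longrightarrow> sn (d m - d n) < e / 2"
    using approximatesD(2)[OF c, of "e / 2"] approximatesD(2)[OF d, of "e / 2"] half_gt_zero by metis
  have "sn ((c m + d m) - (c n + d n)) < e" if "m \<ge> max M N" "n \<ge> max M N" for m n
    using sn_triangle[of "c m - c n" "d m - d n"] N[of m n] M[of m n] that
      approximatesD(1)[OF c] approximatesD(1)[OF d]
    by (simp add: free_space_diff add_diff_add)
  then show "\<exists>N. \<forall>m\<ge>N. \<forall>n\<ge>N. sn ((c m + d m) - (c n + d n)) < e" by blast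
qed (use approximatesD[OF c] approximatesD[OF d] in
      \<open>auto simp: free_space_add pm_sum_add intro!: tendsto_add\<close>)

lemma sn_scale: "c \<in> free_space X \<Longrightarrow> sn (pm_scale a c) = cmod a * sn c"
proof -
  assume c: "c \<in> free_space X"
  have "form (pm_scale a c) (pm_scale a c) = (a * cnj a) * form c c"
    by (simp add: kernel_form_scale_left kernel_form_scale_right)
  also have "Re \<dots> = (cmod a * sn c)\<^sup>2"
    using c by (simp add: form_self complex_norm_square[symmetric] power_mult_distrib
        flip: of_real_power of_real_mult)
  finally show ?thesis
    using c by (simp add: sn_def[of "pm_scale a c"] sn_nonneg)
qed

lemma approximates_scale:
  assumes c: "approximates X k c f"
  shows "approximates X k (\<lambda>n. pm_scale a (c n)) (\<lambda>y. a * f y)"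
  unfolding approximates_iff
proof (intro conjI allI ballI impI)
  fix e :: real assume "0 < e"
  then have "0 < e / (cmod a + 1)" by (simp add: add_nonneg_pos)
  then obtain N where N: "\<And>m n. m \<ge> N \<Longrightarrow> n \<ge> N \<Longrightarrow> sn (c m - c n) < e / (cmod a + 1)"
    using approximatesD(2)[OF c] by meson
  have "sn (pm_scale a (c m) - pm_scale a (c n)) < e" if "m \<ge> N" "n \<ge> N" for m n
  proof -
    have eq: "pm_scale a (c m) - pm_scale a (c n) = pm_scale a (c m - c n)"
      by (rule poly_mapping_eqI) (simp add: lookup_minus algebra_simps)
    have "sn (pm_scale a (c m) - pm_scale a (c n)) \<le> (cmod a + 1) * sn (c m - c n)"
      unfolding eq using approximatesD(1)[OF c] sn_nonneg[of "c m - c n"]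
      by (simp add: sn_scale free_space_diff algebra_simps)
    also have "\<dots> < (cmod a + 1) * (e / (cmod a + 1))"
      using N[OF that] by (intro mult_strict_left_mono) (simp_all add: add_nonneg_pos)
    also have "\<dots> = e" using norm_ge_zero[of a] by (simp add: add_nonneg_eq_0_iff)
    finally show ?thesis .
  qed
  then show "\<exists>N. \<forall>m\<ge>N. \<forall>n\<ge>N. sn (pm_scale a (c m) - pm_scale a (c n)) < e" by blast
qed (use approximatesD[OF c] in
      \<open>auto simp: free_space_scale pm_sum_scale intro!: tendsto_mult\<close>)

lemma approximates_diff:
  assumes c: "approximates X k c f" and d: "approximates X k d g"
  shows "approximates X k (\<lambda>n. c n - d n) (\<lambda>y. f y + - 1 * g y)"
  using approximates_add[OF c approximates_scale[OF d, of "-1"]] by (simp add: diff_conv_pm_scale)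

lemma approximates_combination:
  "c \<in> free_space X \<Longrightarrow> approximates X k (\<lambda>_. c) (combination c)"
  by (simp add: approximates_iff combination_def sn_def kernel_form_pm_sum)

lemma sn_convergent:
  assumes c: "approximates X k c f"
  shows "convergent (\<lambda>n. sn (c n))"
proof (rule Cauchy_convergent, rule metric_CauchyI)
  fix e :: real assume "0 < e"
  then show "\<exists>M. \<forall>m\<ge>M. \<forall>n\<ge>M. dist (sn (c m)) (sn (c n)) < e"
    using approximatesD(2)[OF c] sn_diff_bound[OF approximatesD(1)[OF c] approximatesD(1)[OF c]]
    unfolding dist_real_def by (meson order_le_less_trans)
qed

lemma sn_bounded:
  assumes c: "approximates X k c f"
  obtains B where "0 < B" "\<And>n. sn (c n) \<le> B"
proof -
  have "Bseq (\<lambda>n. sn (c n))" using sn_convergent[OF c] by (rule convergent_imp_Bseq)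
  then obtain B where "0 < B" "\<And>n. norm (sn (c n)) \<le> B" by (auto elim: BseqE)
  then show ?thesis using that[of B] by (simp add: abs_le_iff)
qed

lemma form_tendsto_pairing:
  assumes c: "approximates X k c f" and d: "d \<in> free_space X"
  shows "(\<lambda>n. form (c n) d) \<longlonglongrightarrow> cnj (pm_sum d (\<lambda>y. cnj (f y)))"
  unfolding kernel_form_pm_sum'
  by (intro tendsto_cnj tendsto_pm_sum approximatesD(3)[OF c]) (use d in \<open>auto simp: free_space_def\<close>)

text \<open>This makes the description of the completion by functions faithful. Split
  \<open>form (c n) (c n)\<close> at a fixed \<open>c N\<close>: the part with
  \<open>c n - c N\<close> is small by the Cauchy property and boundedness, and the part with
  \<open>c N\<close> tends to 0 because pairing with one finite combination only involves pointwise
  limits.\<close>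

lemma sn_tendsto_zero:
  assumes c: "approximates X k c (\<lambda>y. 0)"
  shows "(\<lambda>n. sn (c n)) \<longlonglongrightarrow> 0"
proof -
  obtain B where B: "0 < B" "\<And>n. sn (c n) \<le> B" using sn_bounded[OF c] by blast
  have "(\<lambda>n. (sn (c n))\<^sup>2) \<longlonglongrightarrow> 0"
  proof (rule LIMSEQ_I)
    fix r :: real assume "0 < r"
    then have "0 < r / (2 * B)" using B by simp
    then obtain N where N: "\<And>m n. m \<ge> N \<Longrightarrow> n \<ge> N \<Longrightarrow> sn (c m - c n) < r / (2 * B)"
      using approximatesD(2)[OF c] by meson
    have "(\<lambda>n. form (c n) (c N)) \<longlonglongrightarrow> 0"
      using form_tendsto_pairing[OF c approximatesD(1)[OF c, of N]] by (simp add: pm_sum_def)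
    then obtain M where M: "\<And>n. n \<ge> M \<Longrightarrow> cmod (form (c n) (c N)) < r / 2"
      using \<open>0 < r\<close> LIMSEQ_D[of _ 0 "r / 2"] by force
    have "norm ((sn (c n))\<^sup>2 - 0) < r" if "n \<ge> max M N" for n
    proof -
      have "(sn (c n))\<^sup>2 = cmod (form (c n) (c n))"
        using approximatesD(1)[OF c] by (simp add: form_self norm_power)
      also have "form (c n) (c n) = form (c n) (c n - c N) + form (c n) (c N)"
        by (simp add: kernel_form_diff_right)
      also have "cmod \<dots> \<le> sn (c n) * sn (c n - c N) + cmod (form (c n) (c N))"
        using form_cs[of "c n" "c n - c N"] approximatesD(1)[OF c]
        by (intro order_trans[OF norm_triangle_ineq]) (simp add: free_space_diff)
      also have "sn (c n) * sn (c n - c N) \<le> B * (r / (2 * B))"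
        using B N[of n N] that sn_nonneg approximatesD(1)[OF c]
        by (intro mult_mono) (auto simp: free_space_diff less_imp_le)
      also have "B * (r / (2 * B)) = r / 2" using B by simp
      finally show ?thesis using M[of n] that by simp
    qed
    then show "\<exists>no. \<forall>n\<ge>no. norm ((sn (c n))\<^sup>2 - 0) < r" by blast
  qed
  then have "(\<lambda>n. sqrt ((sn (c n))\<^sup>2)) \<longlonglongrightarrow> sqrt 0" by (rule tendsto_real_sqrt)
  then show ?thesis using approximatesD(1)[OF c] by (simp add: sn_nonneg)
qed

lemma form_convergent:
  assumes c: "approximates X k c f" and d: "approximates X k d g"
  shows "convergent (\<lambda>n. form (c n) (d n))"
proof (rule Cauchy_convergent, rule metric_CauchyI)
  fix e :: real assume e: "0 < e"
  obtain B where B: "0 < B" "\<And>n. sn (c n) \<le> B" using sn_bounded[OF c] by blast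
  obtain D where D: "0 < D" "\<And>n. sn (d n) \<le> D" using sn_bounded[OF d] by blast
  obtain N where N: "\<And>m n. m \<ge> N \<Longrightarrow> n \<ge> N \<Longrightarrow> sn (c m - c n) < e / (2 * D)"
    using approximatesD(2)[OF c, of "e / (2 * D)"] e D by auto
  obtain M where M: "\<And>m n. m \<ge> M \<Longrightarrow> n \<ge> M \<Longrightarrow> sn (d m - d n) < e / (2 * B)"
    using approximatesD(2)[OF d, of "e / (2 * B)"] e B by auto
  have "dist (form (c m) (d m)) (form (c n) (d n)) < e" if "m \<ge> max M N" "n \<ge> max M N" for m n
  proof -
    have "dist (form (c m) (d m)) (form (c n) (d n)) =
        cmod (form (c m - c n) (d m) + form (c n) (d m - d n))"
      by (simp add: dist_norm kernel_form_diff_left kernel_form_diff_right)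
    also have "\<dots> \<le> sn (c m - c n) * sn (d m) + sn (c n) * sn (d m - d n)"
      using approximatesD(1)[OF c] approximatesD(1)[OF d]
      by (intro order_trans[OF norm_triangle_ineq] add_mono form_cs free_space_diff)
    also have "\<dots> \<le> sn (c m - c n) * D + B * sn (d m - d n)"
      using B D sn_nonneg approximatesD(1)[OF c] approximatesD(1)[OF d]
      by (intro add_mono mult_left_mono mult_right_mono) (auto simp: free_space_diff)
    also have "\<dots> < e / (2 * D) * D + B * (e / (2 * B))"
      using N[of m n] M[of m n] B D that
      by (intro add_strict_mono mult_strict_left_mono mult_strict_right_mono) auto
    also have "\<dots> = e" using B D by simp
    finally show ?thesis .
  qed
  then show "\<exists>M. \<forall>m\<ge>M. \<forall>n\<ge>M. dist (form (c m) (d m)) (form (c n) (d n)) < e" by blast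
qed

text \<open>Two approximations of one function differ by an approximation of zero, negligible by
  \<open>sn_tendsto_zero\<close>. This justifies the definite description of \<open>ip\<close> in
  \<open>kernel_space\<close>.\<close>

lemma form_limit_unique:
  assumes c: "approximates X k c f" "approximates X k c' f"
    and d: "approximates X k d g" "approximates X k d' g"
    and lim: "(\<lambda>n. form (c n) (d n)) \<longlonglongrightarrow> z" "(\<lambda>n. form (c' n) (d' n)) \<longlonglongrightarrow> z'"
  shows "z = z'"
proof -
  obtain B where B: "0 < B" "\<And>n. sn (c' n) \<le> B" using sn_bounded[OF c(2)] by blast
  obtain D where D: "0 < D" "\<And>n. sn (d n) \<le> D" using sn_bounded[OF d(1)] by blast
  have 1: "(\<lambda>n. sn (c n - c' n)) \<longlonglongrightarrow> 0" "(\<lambda>n. sn (d n - d' n)) \<longlonglongrightarrow> 0"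
    using sn_tendsto_zero approximates_diff[OF c] approximates_diff[OF d] by simp_all
  have "(\<lambda>n. form (c n) (d n) - form (c' n) (d' n)) \<longlonglongrightarrow> 0"
  proof (rule tendsto_zero_comparison)
    show "norm (form (c n) (d n) - form (c' n) (d' n)) \<le> sn (c n - c' n) * D + B * sn (d n - d' n)" for n
    proof -
      have "form (c n) (d n) - form (c' n) (d' n) = form (c n - c' n) (d n) + form (c' n) (d n - d' n)"
        by (simp add: kernel_form_diff_left kernel_form_diff_right)
      also have "cmod \<dots> \<le> sn (c n - c' n) * sn (d n) + sn (c' n) * sn (d n - d' n)"
        using approximatesD(1)[OF c(1)] approximatesD(1)[OF c(2)] approximatesD(1)[OF d(1)] approximatesD(1)[OF d(2)]
        by (intro order_trans[OF norm_triangle_ineq] add_mono form_cs free_space_diff)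
      also have "\<dots> \<le> sn (c n - c' n) * D + B * sn (d n - d' n)"
        using B D sn_nonneg approximatesD(1)[OF c(1)] approximatesD(1)[OF c(2)]
          approximatesD(1)[OF d(1)] approximatesD(1)[OF d(2)]
        by (intro add_mono mult_left_mono mult_right_mono) (auto simp: free_space_diff)
      finally show ?thesis .
    qed
    show "(\<lambda>n. sn (c n - c' n) * D + B * sn (d n - d' n)) \<longlonglongrightarrow> 0"
      using tendsto_add[OF tendsto_mult_left_zero[OF 1(1), of D] tendsto_mult_right_zero[OF 1(2), of B]]
      by simp
  qed
  moreover have "(\<lambda>n. form (c n) (d n) - form (c' n) (d' n)) \<longlonglongrightarrow> z - z'"
    using lim by (rule tendsto_diff)
  ultimately show ?thesis using LIMSEQ_unique by fastforce
qed

lemma kernel_space_simps: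
  "f \<in> vecs K \<longleftrightarrow> (\<exists>c. approximates X k c f)"
  "vzero K = (\<lambda>y. 0)" "vadd K = (\<lambda>f g y. f y + g y)" "vscale K = (\<lambda>a f y. a * f y)"
  by (simp_all add: kernel_space_def)

lemma ip_limit:
  assumes c: "approximates X k c f" and d: "approximates X k d g"
  shows "(\<lambda>n. form (c n) (d n)) \<longlonglongrightarrow> ip K f g"
proof -
  obtain z where z: "(\<lambda>n. form (c n) (d n)) \<longlonglongrightarrow> z"
    using form_convergent[OF c d] by (auto simp: convergent_def)
  have "ip K f g = (THE z. \<exists>c d. approximates X k c f \<and> approximates X k d g \<and>
      (\<lambda>n. form (c n) (d n)) \<longlonglongrightarrow> z)"
    by (simp add: kernel_space_def)
  also have "\<dots> = z"
  proof (rule the_equality)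
    fix w assume "\<exists>c d. approximates X k c f \<and> approximates X k d g \<and> (\<lambda>n. form (c n) (d n)) \<longlonglongrightarrow> w"
    then obtain c' d' where "approximates X k c' f" "approximates X k d' g"
      "(\<lambda>n. form (c' n) (d' n)) \<longlonglongrightarrow> w" by blast
    then show "w = z" using form_limit_unique[OF _ c _ d _ z] by blast
  qed (use c d z in blast)
  finally show ?thesis using z by simp
qed

lemma ip_eqI:
  "\<lbrakk>approximates X k c f; approximates X k d g; (\<lambda>n. form (c n) (d n)) \<longlonglongrightarrow> z\<rbrakk> \<Longrightarrow> ip K f g = z"
  using ip_limit LIMSEQ_unique by blast

lemma vnorm_limit:
  assumes c: "approximates X k c f"
  shows "(\<lambda>n. sn (c n)) \<longlonglongrightarrow> vnorm K f"
  unfolding sn_def vnorm_def using ip_limit[OF c c] by (intro tendsto_real_sqrt tendsto_Re)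

lemma vdist_limit:
  assumes c: "approximates X k c f" and d: "approximates X k d g"
  shows "(\<lambda>n. sn (c n - d n)) \<longlonglongrightarrow> vdist K f g"
  using vnorm_limit[OF approximates_diff[OF c d]] by (simp add: vdist_def kernel_space_simps)

lemma vdist_triangle:
  assumes "f \<in> vecs K" "g \<in> vecs K" "h \<in> vecs K"
  shows "vdist K f h \<le> vdist K f g + vdist K g h"
proof -
  obtain a b c where abc: "approximates X k a f" "approximates X k b g" "approximates X k c h"
    using assms by (auto simp: kernel_space_simps)
  show ?thesis
    by (rule LIMSEQ_le[OF vdist_limit[OF abc(1,3)] tendsto_add[OF vdist_limit[OF abc(1,2)] vdist_limit[OF abc(2,3)]]])
      (use sn_triangle3 approximatesD(1)[OF abc(1)] approximatesD(1)[OF abc(2)] approximatesD(1)[OF abc(3)] in auto)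
qed

lemma vdist_nonneg:
  assumes "f \<in> vecs K" "g \<in> vecs K"
  shows "0 \<le> vdist K f g"
proof -
  obtain a b where ab: "approximates X k a f" "approximates X k b g"
    using assms by (auto simp: kernel_space_simps)
  show ?thesis
    by (rule LIMSEQ_le_const[OF vdist_limit[OF ab]])
      (use sn_nonneg approximatesD(1)[OF ab(1)] approximatesD(1)[OF ab(2)] in \<open>auto simp: free_space_diff\<close>)
qed

lemma vdist_commute:
  assumes "f \<in> vecs K" "g \<in> vecs K"
  shows "vdist K f g = vdist K g f"
proof -
  obtain a b where ab: "approximates X k a f" "approximates X k b g"
    using assms by (auto simp: kernel_space_simps)
  show ?thesis
    using LIMSEQ_unique[OF vdist_limit[OF ab]] vdist_limit[OF ab(2,1)]
    unfolding sn_diff_commute[of "b _"] by blast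
qed

lemma combination_closed: "c \<in> free_space X \<Longrightarrow> combination c \<in> vecs K"
  using approximates_combination by (auto simp: kernel_space_simps)

lemma vdist_combination:
  "\<lbrakk>c \<in> free_space X; d \<in> free_space X\<rbrakk> \<Longrightarrow> vdist K (combination c) (combination d) = sn (c - d)"
  using vdist_limit[OF approximates_combination approximates_combination, of c d]
  by (simp add: LIMSEQ_const_iff)

lemma approximates_vdist:
  assumes c: "approximates X k c f"
  shows "(\<lambda>n. vdist K (combination (c n)) f) \<longlonglongrightarrow> 0"
proof (rule LIMSEQ_I)
  fix r :: real assume "0 < r"
  then obtain N where N: "\<And>m n. m \<ge> N \<Longrightarrow> n \<ge> N \<Longrightarrow> sn (c m - c n) < r / 2"
    using approximatesD(2)[OF c, of "r / 2"] by auto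
  have "norm (vdist K (combination (c n)) f - 0) < r" if n: "n \<ge> N" for n
  proof -
    have "vdist K (combination (c n)) f \<le> r / 2"
      by (rule LIMSEQ_le_const2[OF vdist_limit[OF approximates_combination[OF approximatesD(1)[OF c]] c]])
        (use N n less_imp_le in blast)
    moreover have "0 \<le> vdist K (combination (c n)) f"
      using c approximatesD(1)[OF c]
      by (intro vdist_nonneg combination_closed) (auto simp: kernel_space_simps)
    ultimately show ?thesis using \<open>0 < r\<close> by simp
  qed
  then show "\<exists>no. \<forall>n\<ge>no. norm (vdist K (combination (c n)) f - 0) < r" by blast
qed

lemma ip_combination:
  assumes f: "f \<in> vecs K" and d: "d \<in> free_space X"
  shows "ip K f (combination d) = cnj (pm_sum d (\<lambda>y. cnj (f y)))"
proof -
  obtain c where "approximates X k c f" using f by (auto simp: kernel_space_simps)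
  then show ?thesis
    using ip_eqI approximates_combination[OF d] form_tendsto_pairing d by blast
qed

lemma kernel_gen_combination: "kernel_gen X k x = combination (Poly_Mapping.single x 1)"
  by (simp add: kernel_gen_def combination_def cong: if_cong)

lemma kernel_gen_closed: "x \<in> X \<Longrightarrow> kernel_gen X k x \<in> vecs K"
  by (simp add: kernel_gen_combination combination_closed free_space_single)

lemma ip_kernel_gen: "\<lbrakk>f \<in> vecs K; x \<in> X\<rbrakk> \<Longrightarrow> ip K f (kernel_gen X k x) = f x"
  by (simp add: kernel_gen_combination ip_combination free_space_single)

text \<open>Evaluation at \<open>y\<close> is the pairing with the generator \<open>y\<close>. Hence
  Cauchy sequences for the seminorm converge pointwise on \<open>X\<close>.\<close>

lemma eval_bound:
  assumes c: "c \<in> free_space X" and y: "y \<in> X"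
  shows "cmod (pm_sum c (\<lambda>x. k x y)) \<le> sn c * sn (Poly_Mapping.single y 1)"
  using form_cs[OF c free_space_single[OF y, of 1]] by (simp add: kernel_form_pm_sum)

lemma hilbert_space_kernel_space: "hilbert_space K"
proof
  show "vzero K \<in> vecs K"
    using combination_closed[OF free_space_zero]
    by (simp add: combination_def kernel_space_simps cong: if_cong)
next
  fix f g assume "f \<in> vecs K" "g \<in> vecs K"
  then show "vadd K f g \<in> vecs K"
    using approximates_add by (fastforce simp: kernel_space_simps)
next
  fix f a assume "f \<in> vecs K"
  then show "vscale K a f \<in> vecs K"
    using approximates_scale by (fastforce simp: kernel_space_simps)
next
  fix f g h assume "f \<in> vecs K" "g \<in> vecs K" "h \<in> vecs K"
  then obtain a b c where abc: "approximates X k a f" "approximates X k b g" "approximates X k c h"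
    by (auto simp: kernel_space_simps)
  show "ip K (vadd K f g) h = ip K f h + ip K g h"
    using ip_eqI[OF approximates_add[OF abc(1,2)] abc(3)]
      tendsto_add[OF ip_limit[OF abc(1,3)] ip_limit[OF abc(2,3)]]
    by (simp add: kernel_space_simps kernel_form_add_left)
next
  fix f g t assume "f \<in> vecs K" "g \<in> vecs K"
  then obtain a b where ab: "approximates X k a f" "approximates X k b g"
    by (auto simp: kernel_space_simps)
  show "ip K (vscale K t f) g = t * ip K f g"
    using ip_eqI[OF approximates_scale[OF ab(1)] ab(2)]
      tendsto_mult[OF tendsto_const[of t] ip_limit[OF ab]]
    by (simp add: kernel_space_simps kernel_form_scale_left)
next
  fix f g assume "f \<in> vecs K" "g \<in> vecs K"
  then obtain a b where ab: "approximates X k a f" "approximates X k b g"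
    by (auto simp: kernel_space_simps)
  show "ip K g f = cnj (ip K f g)"
    using ip_eqI[OF ab(2,1)] tendsto_cnj[OF ip_limit[OF ab]]
      form_cnj[OF approximatesD(1)[OF ab(1)] approximatesD(1)[OF ab(2)]]
    by simp
next
  fix f assume "f \<in> vecs K"
  then obtain a where a: "approximates X k a f" by (auto simp: kernel_space_simps)
  show "0 \<le> Re (ip K f f)"
    by (rule LIMSEQ_le_const[OF tendsto_Re[OF ip_limit[OF a a]]])
      (use form_nonneg approximatesD(1)[OF a] in auto)
next
  fix f assume f: "f \<in> vecs K" "ip K f f = 0"
  then obtain a where a: "approximates X k a f" by (auto simp: kernel_space_simps)
  have "(\<lambda>n. sn (a n)) \<longlonglongrightarrow> 0" using vnorm_limit[OF a] f by (simp add: vnorm_def)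
  have "f y = 0" for y
  proof (cases "y \<in> X")
    case True
    have "(\<lambda>n. pm_sum (a n) (\<lambda>x. k x y)) \<longlonglongrightarrow> 0"
      by (rule tendsto_zero_comparison[OF tendsto_mult_left_zero[OF \<open>(\<lambda>n. sn (a n)) \<longlonglongrightarrow> 0\<close>,
              of "sn (Poly_Mapping.single y 1)"]])
        (rule eval_bound[OF approximatesD(1)[OF a] True])
    then show ?thesis using approximatesD(3)[OF a True] LIMSEQ_unique by blast
  qed (rule approximatesD(4)[OF a])
  then show "f = vzero K" by (auto simp: kernel_space_simps)
next
  fix F :: "nat \<Rightarrow> 'x \<Rightarrow> complex"
  assume F: "\<And>n. F n \<in> vecs K"
    and Cauchy: "\<And>e. 0 < e \<Longrightarrow> \<exists>N. \<forall>m\<ge>N. \<forall>n\<ge>N. vdist K (F m) (F n) < e"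
  \<comment> \<open>Diagonal choice: one formal combination close to each \<open>F n\<close> yields
    a single Cauchy sequence of combinations whose limit is also that of \<open>F\<close>.\<close>
  have "\<exists>d. d \<in> free_space X \<and> vdist K (combination d) (F n) < 1 / (real n + 1)" for n
  proof -
    obtain c where c: "approximates X k c (F n)" using F by (auto simp: kernel_space_simps)
    have "\<forall>\<^sub>F i in sequentially. vdist K (combination (c i)) (F n) < 1 / (real n + 1)"
      by (rule order_tendstoD(2)[OF approximates_vdist[OF c]]) simp
    then show ?thesis
      using approximatesD(1)[OF c] by (auto simp: eventually_sequentially)
  qed
  then obtain d where d: "\<And>n. d n \<in> free_space X"
    "\<And>n. vdist K (combination (d n)) (F n) < 1 / (real n + 1)" by metis
  have inv0: "(\<lambda>n. 1 / (real n + 1)) \<longlonglongrightarrow> 0"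
    using LIMSEQ_inverse_real_of_nat by (simp add: inverse_eq_divide add.commute)
  have d_cauchy: "\<exists>N. \<forall>m\<ge>N. \<forall>n\<ge>N. sn (d m - d n) < e" if e: "0 < e" for e :: real
  proof -
    obtain N where N: "\<And>m n. m \<ge> N \<Longrightarrow> n \<ge> N \<Longrightarrow> vdist K (F m) (F n) < e / 3"
      using Cauchy[of "e / 3"] e by (metis divide_pos_pos zero_less_numeral)
    obtain M where M: "\<And>n. n \<ge> M \<Longrightarrow> 1 / (real n + 1) < e / 3"
      using order_tendstoD(2)[OF inv0, of "e / 3"] e by (auto simp: eventually_sequentially)
    have "sn (d m - d n) < e" if "m \<ge> max M N" "n \<ge> max M N" for m n
    proof -
      have "sn (d m - d n) = vdist K (combination (d m)) (combination (d n))"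
        by (simp add: vdist_combination d)
      also have "\<dots> \<le> vdist K (combination (d m)) (F m) + (vdist K (F m) (F n) + vdist K (F n) (combination (d n)))"
        by (intro order_trans[OF vdist_triangle[of _ "F m"]] add_left_mono vdist_triangle
            combination_closed d F)
      also have "vdist K (F n) (combination (d n)) = vdist K (combination (d n)) (F n)"
        by (intro vdist_commute combination_closed d F)
      finally show ?thesis
        using d(2)[of m] d(2)[of n] N[of m n] M[of m] M[of n] that by simp
    qed
    then show ?thesis by blast
  qed
  have "convergent (\<lambda>n. pm_sum (d n) (\<lambda>x. k x y))" if y: "y \<in> X" for y
  proof (rule Cauchy_convergent, rule metric_CauchyI)
    fix e :: real assume e: "0 < e"
    let ?C = "sn (Poly_Mapping.single y 1) + 1"
    have C: "0 < ?C" using sn_nonneg[OF free_space_single[OF y, of 1]] by simp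
    then obtain N where N: "\<And>m n. m \<ge> N \<Longrightarrow> n \<ge> N \<Longrightarrow> sn (d m - d n) < e / ?C"
      using d_cauchy[of "e / ?C"] e by auto
    have "dist (pm_sum (d m) (\<lambda>x. k x y)) (pm_sum (d n) (\<lambda>x. k x y)) < e" if "m \<ge> N" "n \<ge> N" for m n
    proof -
      have "dist (pm_sum (d m) (\<lambda>x. k x y)) (pm_sum (d n) (\<lambda>x. k x y)) \<le> sn (d m - d n) * sn (Poly_Mapping.single y 1)"
        using eval_bound[OF free_space_diff[OF d(1) d(1)] y, of m n] by (simp add: dist_norm pm_sum_diff)
      also have "\<dots> \<le> sn (d m - d n) * ?C"
        using sn_nonneg[OF free_space_diff[OF d(1) d(1)]] by (intro mult_left_mono) auto
      also have "\<dots> < e / ?C * ?C" using N[OF that] C by (rule mult_strict_right_mono)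
      also have "\<dots> = e" using C by simp
      finally show ?thesis .
    qed
    then show "\<exists>M. \<forall>m\<ge>M. \<forall>n\<ge>M. dist (pm_sum (d m) (\<lambda>x. k x y)) (pm_sum (d n) (\<lambda>x. k x y)) < e"
      by blast
  qed
  then obtain f0 where f0: "\<And>y. y \<in> X \<Longrightarrow> (\<lambda>n. pm_sum (d n) (\<lambda>x. k x y)) \<longlonglongrightarrow> f0 y"
    unfolding convergent_def by metis
  \<comment> \<open>The value 0 off \<open>X\<close> is demanded by
    \<open>approximates\<close>.\<close>
  define f where "f y = (if y \<in> X then f0 y else 0)" for y
  have f: "approximates X k d f"
    unfolding approximates_iff using d d_cauchy f0 by (auto simp: f_def)
  then have fK: "f \<in> vecs K" by (auto simp: kernel_space_simps)
  have "(\<lambda>n. vdist K (F n) f) \<longlonglongrightarrow> 0"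
  proof (rule tendsto_zero_comparison)
    show "norm (vdist K (F n) f) \<le> 1 / (real n + 1) + vdist K (combination (d n)) f" for n
      using vdist_triangle[OF F combination_closed[OF d(1)] fK, of n n] d(2)[of n]
        vdist_commute[OF F combination_closed[OF d(1)], of n n] vdist_nonneg[OF F fK, of n] by simp
    show "(\<lambda>n. 1 / (real n + 1) + vdist K (combination (d n)) f) \<longlonglongrightarrow> 0"
      using tendsto_add[OF inv0 approximates_vdist[OF f]] by simp
  qed
  then show "\<exists>f\<in>vecs K. (\<lambda>n. vdist K (F n) f) \<longlonglongrightarrow> 0" using fK by blast
qed (auto simp: kernel_space_simps fun_eq_iff algebra_simps)

sublocale K: hilbert_space K
  by (rule hilbert_space_kernel_space)

text \<open>By the reproducing property \<open>ip_kernel_gen\<close>, the hypothesis is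
  orthogonality to all generators.\<close>

lemma eq_zero_by_gens:
  "\<lbrakk>f \<in> vecs K; \<And>x. x \<in> X \<Longrightarrow> f x = 0\<rbrakk> \<Longrightarrow> f = vzero K"
  using approximatesD(4) by (fastforce simp: kernel_space_simps)

end

text \<open>A map \<open>a\<close> between generating sets that is bounded for the forms induces
  \<open>f \<mapsto> (y \<mapsto> \<mu> y * f (b y))\<close> on the Hilbert spaces as soon as the vector of \<open>X\<close> representing the
  functional \<open>\<langle>a \<cdot>, y\<rangle>\<close> is a multiple of a generator \<open>b y\<close>.\<close>

locale kernel_map = X: psd_kernel X k + Y: psd_kernel Y l
  for X :: "'x set" and k and Y :: "'y set" and l +
  fixes a :: "'x \<Rightarrow> 'y" and b :: "'y \<Rightarrow> 'x" and \<mu> :: "'y \<Rightarrow> complex" and C :: real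
  assumes a_closed: "a \<in> X \<rightarrow> Y"
    and b_closed: "b \<in> Y \<rightarrow> X"
    and a_b: "\<lbrakk>x \<in> X; y \<in> Y\<rbrakk> \<Longrightarrow> l (a x) y = \<mu> y * k x (b y)"
    and C_nonneg: "0 \<le> C"
    and bounded: "c \<in> free_space X \<Longrightarrow>
      Re (kernel_form l (push a c) (push a c)) \<le> C\<^sup>2 * Re (kernel_form k c c)"
begin

definition J :: "('x \<Rightarrow> complex) \<Rightarrow> 'y \<Rightarrow> complex" where
  "J f = (\<lambda>y. if y \<in> Y then \<mu> y * f (b y) else 0)"

lemma sn_push: "c \<in> free_space X \<Longrightarrow> Y.sn (push a c) \<le> C * X.sn c"
  using real_sqrt_le_mono[OF bounded, of c] C_nonneg
  by (simp add: X.sn_def Y.sn_def real_sqrt_mult)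

lemma approximates_J:
  assumes c: "approximates X k c f"
  shows "approximates Y l (\<lambda>n. push a (c n)) (J f)"
  unfolding Y.approximates_iff
proof (intro conjI allI ballI impI)
  fix e :: real assume "0 < e"
  then have "0 < e / (C + 1)" using C_nonneg by simp
  then obtain N where N: "\<And>m n. m \<ge> N \<Longrightarrow> n \<ge> N \<Longrightarrow> X.sn (c m - c n) < e / (C + 1)"
    using X.approximatesD(2)[OF c] by meson
  have "Y.sn (push a (c m) - push a (c n)) < e" if "m \<ge> N" "n \<ge> N" for m n
  proof -
    have mem: "c m - c n \<in> free_space X" by (intro free_space_diff X.approximatesD(1)[OF c])
    have "Y.sn (push a (c m) - push a (c n)) \<le> (C + 1) * X.sn (c m - c n)"
      using sn_push[OF mem] X.sn_nonneg[OF mem] by (simp add: push_diff distrib_right)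
    also have "\<dots> < (C + 1) * (e / (C + 1))"
      using N[OF that] C_nonneg by (intro mult_strict_left_mono) auto
    also have "\<dots> = e" using C_nonneg by simp
    finally show ?thesis .
  qed
  then show "\<exists>N. \<forall>m\<ge>N. \<forall>n\<ge>N. Y.sn (push a (c m) - push a (c n)) < e" by blast
next
  fix y assume y: "y \<in> Y"
  have "pm_sum (push a (c n)) (\<lambda>x. l x y) = \<mu> y * pm_sum (c n) (\<lambda>x. k x (b y))" for n
    unfolding pm_sum_push pm_sum_scale_right[symmetric]
    using X.approximatesD(1)[OF c, of n] a_b y by (intro pm_sum_cong) (auto simp: free_space_def)
  then show "(\<lambda>n. pm_sum (push a (c n)) (\<lambda>x. l x y)) \<longlonglongrightarrow> J f y"
    using X.approximatesD(3)[OF c, of "b y"] b_closed y by (auto simp: J_def intro!: tendsto_mult)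
qed (use free_space_push[OF X.approximatesD(1)[OF c] a_closed] in \<open>auto simp: J_def\<close>)

lemma J_closed: "f \<in> vecs X.K \<Longrightarrow> J f \<in> vecs Y.K"
  using approximates_J by (auto simp: X.kernel_space_simps Y.kernel_space_simps)

lemma J_norm: "f \<in> vecs X.K \<Longrightarrow> vnorm Y.K (J f) \<le> C * vnorm X.K f"
proof -
  assume "f \<in> vecs X.K"
  then obtain c where c: "approximates X k c f" by (auto simp: X.kernel_space_simps)
  show ?thesis
    by (rule LIMSEQ_le[OF Y.vnorm_limit[OF approximates_J[OF c]]
          tendsto_mult[OF tendsto_const X.vnorm_limit[OF c]]])
      (use sn_push X.approximatesD(1)[OF c] in auto)
qed

lemma J_add: "J (vadd X.K f g) = vadd Y.K (J f) (J g)"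
  by (auto simp: J_def X.kernel_space_simps Y.kernel_space_simps algebra_simps)

lemma J_scale: "J (vscale X.K t f) = vscale Y.K t (J f)"
  by (auto simp: J_def X.kernel_space_simps Y.kernel_space_simps)

lemma J_kernel_gen: "x \<in> X \<Longrightarrow> J (kernel_gen X k x) = kernel_gen Y l (a x)"
  using b_closed by (auto simp: J_def kernel_gen_def a_b fun_eq_iff)

lemma J_isometric:
  assumes iso: "\<And>x x'. \<lbrakk>x \<in> X; x' \<in> X\<rbrakk> \<Longrightarrow> l (a x) (a x') = k x x'"
    and f: "f \<in> vecs X.K" and g: "g \<in> vecs X.K"
  shows "ip Y.K (J f) (J g) = ip X.K f g"
proof -
  obtain c d where cd: "approximates X k c f" "approximates X k d g"
    using f g by (auto simp: X.kernel_space_simps)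
  have "kernel_form l (push a (c n)) (push a (d n)) = kernel_form k (c n) (d n)" for n
    unfolding kernel_form_pm_sum pm_sum_push
    using X.approximatesD(1)[OF cd(1), of n] X.approximatesD(1)[OF cd(2), of n] iso
    by (intro pm_sum_cong arg_cong[of _ _ cnj]) (auto simp: free_space_def)
  then show ?thesis
    using Y.ip_eqI[OF approximates_J[OF cd(1)] approximates_J[OF cd(2)]] X.ip_limit[OF cd] by simp
qed

text \<open>With weight 1, \<open>a_b\<close> is the adjoint relation on generators. So the adjoint
  of the operator induced by \<open>a\<close> is the one induced by \<open>b\<close>, once
  \<open>b\<close> is bounded for the forms as well.\<close>

lemma J_adjoint:
  assumes map: "kernel_map Y l X k b a (\<lambda>_. 1) D" and \<mu>: "\<And>y. \<mu> y = 1"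
    and f: "f \<in> vecs X.K" and g: "g \<in> vecs Y.K"
  shows "ip Y.K (J f) g = ip X.K f (kernel_map.J X a (\<lambda>_. 1) g)"
proof -
  interpret B: kernel_map Y l X k b a "\<lambda>_. 1" D by (rule map)
  obtain c d where cd: "approximates X k c f" "approximates Y l d g"
    using f g by (auto simp: X.kernel_space_simps Y.kernel_space_simps)
  have "kernel_form l (push a (c n)) (d n) = kernel_form k (c n) (push b (d n))" for n
    unfolding kernel_form_pm_sum pm_sum_push
    using X.approximatesD(1)[OF cd(1), of n] Y.approximatesD(1)[OF cd(2), of n]
    by (intro pm_sum_cong arg_cong[of _ _ cnj]) (auto simp: free_space_def subset_iff a_b \<mu>)
  then show ?thesis
    using Y.ip_eqI[OF approximates_J[OF cd(1)] cd(2)] X.ip_limit[OF cd(1) B.approximates_J[OF cd(2)]]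
    by simp
qed

end


section \<open>Schur products and inductive limits\<close>

definition quad_form :: "'x set \<Rightarrow> ('x \<Rightarrow> 'x \<Rightarrow> complex) \<Rightarrow> ('x \<Rightarrow> complex) \<Rightarrow> complex" where
  "quad_form F k c = (\<Sum>x\<in>F. \<Sum>y\<in>F. c x * cnj (c y) * k x y)"

text \<open>Positivity is stated over explicit finite sets with arbitrary coefficient functions, not
  over \<open>free_space\<close>; this passes to subsets of \<open>X\<close> and permits induction
  on the finite set.\<close>

definition gram_psd :: "'x set \<Rightarrow> ('x \<Rightarrow> 'x \<Rightarrow> complex) \<Rightarrow> bool" where
  "gram_psd X k \<longleftrightarrow> (\<forall>x\<in>X. \<forall>y\<in>X. k y x = cnj (k x y)) \<and>
     (\<forall>F c. finite F \<longrightarrow> F \<subseteq> X \<longrightarrow> 0 \<le> Re (quad_form F k c))"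

lemma gram_psd_hermitian: "\<lbrakk>gram_psd X k; x \<in> X; y \<in> X\<rbrakk> \<Longrightarrow> k y x = cnj (k x y)"
  unfolding gram_psd_def by blast

lemma gram_psd_nonneg: "\<lbrakk>gram_psd X k; finite F; F \<subseteq> X\<rbrakk> \<Longrightarrow> 0 \<le> Re (quad_form F k c)"
  unfolding gram_psd_def by blast

lemma gram_psd_subset: "\<lbrakk>gram_psd X k; Y \<subseteq> X\<rbrakk> \<Longrightarrow> gram_psd Y k"
  unfolding gram_psd_def by blast

lemma psd_kernel_if_gram_psd: "gram_psd X k \<Longrightarrow> psd_kernel X k"
proof
  fix c assume "gram_psd X k" "c \<in> free_space X"
  then have "0 \<le> Re (quad_form (Poly_Mapping.keys c) k (Poly_Mapping.lookup c))"
    by (intro gram_psd_nonneg) (auto simp: free_space_def)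
  then show "0 \<le> Re (kernel_form k c c)" by (simp add: kernel_form_def quad_form_def)
qed (rule gram_psd_hermitian)

lemma quad_form_insert:
  assumes "finite F" "z \<notin> F"
  shows "quad_form (insert z F) k c = c z * cnj (c z) * k z z + c z * (\<Sum>y\<in>F. cnj (c y) * k z y)
    + cnj (c z) * (\<Sum>x\<in>F. c x * k x z) + quad_form F k c"
  using assms by (simp add: quad_form_def sum.distrib sum_distrib_left algebra_simps)

lemma quad_form_cong:
  "\<lbrakk>\<And>x. x \<in> F \<Longrightarrow> c x = d x; \<And>x y. \<lbrakk>x \<in> F; y \<in> F\<rbrakk> \<Longrightarrow> k x y = l x y\<rbrakk> \<Longrightarrow> quad_form F k c = quad_form F l d"
  by (simp add: quad_form_def)

lemma gram_psd_diag:
  assumes "gram_psd X k" "z \<in> X"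
  shows "k z z = of_real (Re (k z z))" "0 \<le> Re (k z z)"
proof -
  have "k z z = cnj (k z z)" using assms unfolding gram_psd_def by blast
  then have "Im (k z z) = 0" by (metis complex_cnj_cancel_iff cnj.simps(2) neg_equal_zero)
  then show "k z z = of_real (Re (k z z))" by (simp add: complex_eq_iff)
  show "0 \<le> Re (k z z)"
    using gram_psd_nonneg[OF assms(1), of "{z}" "\<lambda>_. 1"] assms(2) by (simp add: quad_form_def)
qed

text \<open>The form on \<open>insert z F\<close> is a quadratic polynomial in the coefficient at
  \<open>z\<close>. Its discriminant bound is the positivity of the Schur complement of
  \<open>k z z\<close>.\<close>

lemma gram_psd_schur_complement:
  assumes k: "gram_psd (insert z F) k" and F: "finite F" "z \<notin> F"
  shows "(cmod (\<Sum>x\<in>F. c x * k x z))\<^sup>2 \<le> Re (quad_form F k c) * Re (k z z)"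
proof (rule quadratic_nonneg_bound)
  fix t
  let ?B = "\<Sum>x\<in>F. c x * k x z" and ?c = "\<lambda>x. if x = z then cnj t else c x"
  have "k z y = cnj (k y z)" if "y \<in> F" for y
    using gram_psd_hermitian[OF k, of y z] that by simp
  then have *: "(\<Sum>y\<in>F. cnj (c y) * k z y) = cnj ?B" by simp
  have kzz: "k z z = of_real (Re (k z z))" by (rule gram_psd_diag[OF k]) simp
  have "quad_form (insert z F) k ?c = ?c z * cnj (?c z) * k z z + ?c z * (\<Sum>y\<in>F. cnj (?c y) * k z y)
      + cnj (?c z) * (\<Sum>x\<in>F. ?c x * k x z) + quad_form F k ?c"
    using F by (rule quad_form_insert)
  also have "(\<Sum>y\<in>F. cnj (?c y) * k z y) = (\<Sum>y\<in>F. cnj (c y) * k z y)"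
    using F by (intro sum.cong) auto
  also have "(\<Sum>x\<in>F. ?c x * k x z) = ?B" using F by (intro sum.cong) auto
  also have "quad_form F k ?c = quad_form F k c" using F by (intro quad_form_cong) auto
  also have "Re (?c z * cnj (?c z) * k z z + ?c z * (\<Sum>y\<in>F. cnj (c y) * k z y)
      + cnj (?c z) * ?B + quad_form F k c)
    = Re (quad_form F k c) + 2 * Re (t * ?B) + (cmod t)\<^sup>2 * Re (k z z)"
  proof -
    have "Re (cnj t * t * k z z) = (cmod t)\<^sup>2 * Re (k z z)"
      by (subst kzz) (simp add: complex_norm_square[symmetric] mult.commute[of "cnj t" t]
          flip: of_real_mult of_real_power)
    moreover have "Re (cnj t * cnj ?B) = Re (t * ?B)"
      by (metis complex_cnj_mult cnj.simps(1))
    ultimately show ?thesis unfolding * by simp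
  qed
  finally show "0 \<le> Re (quad_form F k c) + 2 * Re (t * ?B) + (cmod t)\<^sup>2 * Re (k z z)"
    using k F unfolding gram_psd_def by (metis finite_insert order_refl)
qed (rule gram_psd_diag[OF k], simp)

text \<open>Induction on the finite set, for all \<open>k\<close>. Splitting off the rank one kernel
  \<open>k x z * k z y / r\<close> leaves a \<open>k'\<close> that is positive by the Schur
  complement and vanishes in the row and column of \<open>z\<close>, so its product with
  \<open>l\<close> only sees \<open>F\<close>. The part split off contributes the form of
  \<open>l\<close> at the new coefficients \<open>d\<close>, divided by \<open>r\<close>.\<close>

lemma schur_product_finite:
  assumes "finite F" "gram_psd F k" "gram_psd F l"
  shows "0 \<le> Re (quad_form F (\<lambda>x y. k x y * l x y) c)"
  using assms
proof (induction F arbitrary: k rule: finite_induct)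
  case empty
  then show ?case by (simp add: quad_form_def)
next
  case (insert z F)
  note k = insert.prems(1) and l = insert.prems(2)
  define r where "r = Re (k z z)"
  have kzz: "k z z = of_real r" and r: "0 \<le> r"
    unfolding r_def using gram_psd_diag[OF k, of z] by auto
  \<comment> \<open>For \<open>r = 0\<close> the quotient is 0 and \<open>k'\<close> is
    \<open>k\<close>; the row of \<open>z\<close> then vanishes by the discriminant bound on
    \<open>{z, x}\<close>.\<close>
  define k' where "k' x y = k x y - k x z * k z y / of_real r" for x y
  have herm: "k y x = cnj (k x y)" if "x \<in> insert z F" "y \<in> insert z F" for x y
    using k that unfolding gram_psd_def by blast
  have k': "gram_psd F k'"
    unfolding gram_psd_def
  proof (intro conjI ballI allI impI)
    fix x y assume xy: "x \<in> F" "y \<in> F"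
    then show "k' y x = cnj (k' x y)"
      using herm[of x y] herm[of x z] herm[of z y] by (simp add: k'_def mult.commute)
  next
    fix F' c assume F': "finite F'" "F' \<subseteq> F"
    let ?B = "\<Sum>x\<in>F'. c x * k x z"
    have B: "(cmod ?B)\<^sup>2 \<le> Re (quad_form F' k c) * r"
      unfolding r_def using F' insert.hyps gram_psd_subset[OF k, of "insert z F'"]
      by (intro gram_psd_schur_complement) auto
    have nonneg: "0 \<le> Re (quad_form F' k c)" using k F' unfolding gram_psd_def by blast
    have "k z y = cnj (k y z)" if "y \<in> F'" for y
      using herm[of y z] F' that by auto
    then have "(\<Sum>y\<in>F'. cnj (c y) * k z y) = cnj ?B" by simp
    moreover have "quad_form F' k' c =
        quad_form F' k c - ?B * (\<Sum>y\<in>F'. cnj (c y) * k z y) / of_real r"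
      unfolding quad_form_def k'_def
      by (simp add: sum_product sum_subtractf sum_divide_distrib right_diff_distrib mult_ac)
    ultimately have "quad_form F' k' c = quad_form F' k c - of_real ((cmod ?B)\<^sup>2 / r)"
      by (simp only: complex_norm_square of_real_divide)
    then have "Re (quad_form F' k' c) = Re (quad_form F' k c) - (cmod ?B)\<^sup>2 / r"
      by (simp del: of_real_divide of_real_power)
    then show "0 \<le> Re (quad_form F' k' c)"
      using B nonneg r by (cases "r = 0") (auto simp: divide_le_eq)
  qed
  have k'_z: "k' x z = 0" if x: "x \<in> insert z F" for x
  proof (cases "r = 0")
    case True
    have "k x z = 0" if "x \<in> F"
    proof -
      have "(cmod (\<Sum>x\<in>{x}. 1 * k x z))\<^sup>2 \<le> Re (quad_form {x} k (\<lambda>_. 1)) * Re (k z z)"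
        using that insert.hyps gram_psd_subset[OF k, of "{z, x}"]
        by (intro gram_psd_schur_complement) auto
      then show ?thesis using True by (simp add: kzz)
    qed
    then show ?thesis using x True by (auto simp: k'_def kzz)
  qed (simp add: k'_def kzz)
  have k'_z': "k' z x = 0" if x: "x \<in> insert z F" for x
    using k'_z[OF x] herm[of x z] herm[of z z] x by (simp add: k'_def kzz) (metis complex_cnj_zero_iff complex_cnj_diff complex_cnj_divide complex_cnj_mult complex_cnj_complex_of_real mult.commute)
  define d where "d x = c x * k x z" for x
  have "quad_form (insert z F) (\<lambda>x y. k x y * l x y) c =
      quad_form (insert z F) (\<lambda>x y. k' x y * l x y) c + quad_form (insert z F) l d / of_real r"
  proof -
    have "c x * cnj (c y) * (k x y * l x y) =
        c x * cnj (c y) * (k' x y * l x y) + d x * cnj (d y) * l x y / of_real r"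
      if "x \<in> insert z F" "y \<in> insert z F" for x y
      using herm[of y z] that by (simp add: d_def k'_def algebra_simps)
    then show ?thesis
      unfolding quad_form_def sum_divide_distrib sum.distrib[symmetric] by (intro sum.cong refl) 
  qed
  also have "quad_form (insert z F) (\<lambda>x y. k' x y * l x y) c = quad_form F (\<lambda>x y. k' x y * l x y) c"
    using insert.hyps by (simp add: quad_form_insert k'_z k'_z')
  also have "Re (\<dots> + quad_form (insert z F) l d / of_real r) =
      Re (quad_form F (\<lambda>x y. k' x y * l x y) c) + Re (quad_form (insert z F) l d) / r"
    by simp
  also have "\<dots> \<ge> 0"
  proof (rule add_nonneg_nonneg)
    show "0 \<le> Re (quad_form F (\<lambda>x y. k' x y * l x y) c)"
      using k' gram_psd_subset[OF l] by (intro insert.IH) auto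
    have "0 \<le> Re (quad_form (insert z F) l d)"
      using l insert.hyps unfolding gram_psd_def by (metis finite_insert order_refl)
    then show "0 \<le> Re (quad_form (insert z F) l d) / r" using r by simp
  qed
  finally show ?case .
qed

lemma gram_psd_cong:
  assumes "\<And>x y. \<lbrakk>x \<in> X; y \<in> X\<rbrakk> \<Longrightarrow> k x y = l x y"
  shows "gram_psd X k \<longleftrightarrow> gram_psd X l"
proof -
  have "quad_form F k c = quad_form F l c" if "F \<subseteq> X" for F c
    using that assms by (intro quad_form_cong) auto
  then show ?thesis using assms unfolding gram_psd_def by simp
qed

text \<open>Turns the bound required by \<open>kernel_map\<close> into positivity of a difference of
  kernels, to which Schur products apply.\<close>

lemma bounded_if_gram_psd:
  assumes psd: "gram_psd X (\<lambda>x y. of_real (C\<^sup>2) * k x y - l (a x) (a y))" and c: "c \<in> free_space X"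
  shows "Re (kernel_form l (push a c) (push a c)) \<le> C\<^sup>2 * Re (kernel_form k c c)"
proof -
  interpret psd_kernel X "\<lambda>x y. of_real (C\<^sup>2) * k x y - l (a x) (a y)"
    using psd by (rule psd_kernel_if_gram_psd)
  have "kernel_form (\<lambda>x y. of_real (C\<^sup>2) * k x y - l (a x) (a y)) c c =
      of_real (C\<^sup>2) * kernel_form k c c - kernel_form l (push a c) (push a c)"
    unfolding kernel_form_pm_sum pm_sum_push
    by (simp add: pm_sum_diff_right pm_sum_scale_right del: of_real_power)
  then show ?thesis
    using form_nonneg[OF c] by (simp del: of_real_power)
qed

lemma gram_psd_mult:
  assumes k: "gram_psd X k" and l: "gram_psd X l"
  shows "gram_psd X (\<lambda>x y. k x y * l x y)"
  unfolding gram_psd_def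
proof (intro conjI ballI allI impI)
  fix F c assume "finite F" "F \<subseteq> X"
  then show "0 \<le> Re (quad_form F (\<lambda>x y. k x y * l x y) c)"
    using schur_product_finite gram_psd_subset[OF k] gram_psd_subset[OF l] by blast
next
  fix x y assume "x \<in> X" "y \<in> X"
  then show "k y x * l y x = cnj (k x y * l x y)"
    using k l unfolding gram_psd_def by (metis complex_cnj_mult)
qed

lemma gram_psd_const: "gram_psd X (\<lambda>x y. 1)"
  unfolding gram_psd_def
proof (intro conjI ballI allI impI)
  fix F and c :: "'a \<Rightarrow> complex"
  have "quad_form F (\<lambda>x y. 1) c = of_real ((cmod (sum c F))\<^sup>2)"
    unfolding complex_norm_square by (simp add: quad_form_def sum_product)
  then show "0 \<le> Re (quad_form F (\<lambda>x y. 1) c)"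
    by (simp del: of_real_power)
qed simp

text \<open>The quadratic form is the squared norm of \<open>C w\<close> minus that of
  \<open>T w\<close>, where \<open>w\<close> combines the \<open>h x\<close> with the coefficients
  \<open>c\<close>.\<close>

lemma (in hilbert_space) gram_psd_bounded:
  assumes T: "T \<in> bops H" and C: "\<And>x. x \<in> vecs H \<Longrightarrow> vnorm H (T x) \<le> C * vnorm H x" "0 \<le> C"
    and h: "\<And>x. x \<in> X \<Longrightarrow> h x \<in> vecs H"
  shows "gram_psd X (\<lambda>x y. of_real (C\<^sup>2) * ip H (h x) (h y) - ip H (T (h x)) (T (h y)))"
  unfolding gram_psd_def
proof (intro conjI ballI allI impI)
  fix x y assume "x \<in> X" "y \<in> X"
  then show "of_real (C\<^sup>2) * ip H (h y) (h x) - ip H (T (h y)) (T (h x)) =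
      cnj (of_real (C\<^sup>2) * ip H (h x) (h y) - ip H (T (h x)) (T (h y)))"
    using ip_cnj[of "h x" "h y"] ip_cnj[of "T (h x)" "T (h y)"] T h by (simp add: bopsD(1))
next
  fix F c assume F: "finite F" "F \<subseteq> X"
  then have hF: "h x \<in> vecs H" if "x \<in> F" for x using h that by blast
  obtain w where w: "w \<in> vecs H" "\<And>z. z \<in> vecs H \<Longrightarrow> ip H w z = (\<Sum>x\<in>F. c x * ip H (h x) z)"
    using finite_combination[of F h c] F hF by blast
  \<comment> \<open>As \<open>w\<close> is known only through its inner products, \<open>T\<close>
    is moved to the other side first.\<close>
  have Tw: "ip H (T w) z = (\<Sum>x\<in>F. c x * ip H (T (h x)) z)" if "z \<in> vecs H" for z
    using that w hF by (simp add: ip_adjoint[OF T] bopsD(1)[OF adjoint_closed[OF T]])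
  have gram: "quad_form F (\<lambda>x y. ip H (h' x) (h' y)) c = ip H w' w'"
    if "\<And>x. x \<in> F \<Longrightarrow> h' x \<in> vecs H" "w' \<in> vecs H"
      "\<And>z. z \<in> vecs H \<Longrightarrow> ip H w' z = (\<Sum>x\<in>F. c x * ip H (h' x) z)" for h' w'
  proof -
    have "quad_form F (\<lambda>x y. ip H (h' x) (h' y)) c = (\<Sum>y\<in>F. cnj (c y) * ip H w' (h' y))"
      unfolding quad_form_def using that
      by (subst sum.swap) (auto simp: sum_distrib_left mult_ac intro!: sum.cong)
    also have "\<dots> = cnj (\<Sum>y\<in>F. c y * ip H (h' y) w')"
      unfolding cnj_sum complex_cnj_mult using that(1,2) by (intro sum.cong refl) (metis ip_cnj)
    also have "\<dots> = cnj (ip H w' w')" using that by simp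
    finally show ?thesis using ip_cnj[of w' w'] that by simp
  qed
  have "quad_form F (\<lambda>x y. of_real (C\<^sup>2) * ip H (h x) (h y) - ip H (T (h x)) (T (h y))) c
      = of_real (C\<^sup>2) * quad_form F (\<lambda>x y. ip H (h x) (h y)) c
        - quad_form F (\<lambda>x y. ip H (T (h x)) (T (h y))) c"
    by (simp add: quad_form_def sum_distrib_left sum_subtractf algebra_simps)
  also have "\<dots> = of_real (C\<^sup>2) * ip H w w - ip H (T w) (T w)"
    using gram[of h w] gram[of "\<lambda>x. T (h x)" "T w"] hF w Tw T by (simp add: bopsD(1))
  also have "\<dots> = of_real ((C * vnorm H w)\<^sup>2 - (vnorm H (T w))\<^sup>2)"
    using w(1) T by (simp add: ip_self bopsD(1) power_mult_distrib)
  finally show "0 \<le> Re (quad_form F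
      (\<lambda>x y. of_real (C\<^sup>2) * ip H (h x) (h y) - ip H (T (h x)) (T (h y))) c)"
    using power_mono[OF C(1)[OF w(1)] norm_nonneg[OF bopsD(1)[OF T w(1)]], of 2]
    by (simp del: of_real_power of_real_mult of_real_diff)
qed

lemma (in hilbert_space) gram_psd_ip:
  assumes h: "\<And>x. x \<in> X \<Longrightarrow> h x \<in> vecs H"
  shows "gram_psd X (\<lambda>x y. ip H (h x) (h y))"
proof -
  \<comment> \<open>With the zero operator and the bound 1, only the Gram kernel remains.\<close>
  have "gram_psd X (\<lambda>x y. of_real (1\<^sup>2) * ip H (h x) (h y) - ip H (zero_op H (h x)) (zero_op H (h y)))"
    by (rule gram_psd_bounded[OF zero_op_closed]) (auto simp: h zero_op_def norm_zero norm_nonneg)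
  also have "?this \<longleftrightarrow> gram_psd X (\<lambda>x y. ip H (h x) (h y))"
    by (rule gram_psd_cong) (simp add: h zero_op_def ip_zero_left zero_closed)
  finally show ?thesis .
qed

lemma gram_psd_tensor:
  assumes "\<And>i. hilbert_space (H i)" "finite I" "\<And>s i. \<lbrakk>s \<in> X; i \<in> I\<rbrakk> \<Longrightarrow> s i \<in> vecs (H i)"
  shows "gram_psd X (\<lambda>s t. \<Prod>i\<in>I. ip (H i) (s i) (t i))"
  using assms(2,3)
proof (induction I rule: finite_induct)
  case empty
  then show ?case by (simp add: gram_psd_const)
next
  case (insert i I)
  then show ?case
    using gram_psd_mult[OF hilbert_space.gram_psd_ip[OF assms(1), of X "\<lambda>s. s i" i] insert.IH] by simp
qed

lemma psd_kernel_tensor: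
  assumes "\<And>i. hilbert_space (H i)" "finite I"
  shows "psd_kernel (tuples I H) (tensor_kernel I H)"
proof -
  have "gram_psd (tuples I H) (\<lambda>s t. \<Prod>i\<in>I. ip (H i) (s i) (t i))"
    by (rule gram_psd_tensor[OF assms]) (auto simp: tuples_def)
  then show ?thesis
    unfolding tensor_kernel_def by (rule psd_kernel_if_gram_psd)
qed


section \<open>Completed inductive limits of Hilbert spaces\<close>

locale inductive_system =
  fixes E :: "nat \<Rightarrow> 'e hspace" and j :: "nat \<Rightarrow> 'e \<Rightarrow> 'e"
  assumes hilbert: "hilbert_space (E n)"
    and j_closed: "x \<in> vecs (E n) \<Longrightarrow> j n x \<in> vecs (E (Suc n))"
    and j_add: "\<lbrakk>x \<in> vecs (E n); y \<in> vecs (E n)\<rbrakk> \<Longrightarrow> j n (vadd (E n) x y) = vadd (E (Suc n)) (j n x) (j n y)"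
    and j_scale: "x \<in> vecs (E n) \<Longrightarrow> j n (vscale (E n) a x) = vscale (E (Suc n)) a (j n x)"
    and j_ip: "\<lbrakk>x \<in> vecs (E n); y \<in> vecs (E n)\<rbrakk> \<Longrightarrow> ip (E (Suc n)) (j n x) (j n y) = ip (E n) x y"
begin

text \<open>Indexed by the target level, whereas \<open>shift\<close> counts steps; lifts then
  compose as in \<open>lift_lift\<close>.\<close>

definition lift :: "nat \<Rightarrow> nat \<Rightarrow> 'e \<Rightarrow> 'e" where
  "lift n N x = shift j n (N - n) x"

abbreviation gens where "gens \<equiv> (SIGMA n:UNIV. vecs (E n))"
abbreviation L where "L \<equiv> inductive_limit E j"
abbreviation emb where "emb \<equiv> limit_emb E j"

lemma lift_same [simp]: "lift n n x = x"
  by (simp add: lift_def)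

lemma lift_Suc: "n \<le> N \<Longrightarrow> lift n (Suc N) x = j N (lift n N x)"
  by (simp add: lift_def Suc_diff_le)

lemma lift_lift: "\<lbrakk>n \<le> M; M \<le> N\<rbrakk> \<Longrightarrow> lift M N (lift n M x) = lift n N x"
proof (induction N)
  case (Suc N)
  then show ?case by (cases "M = Suc N") (auto simp: lift_Suc)
qed simp

lemma lift_closed: "\<lbrakk>n \<le> N; x \<in> vecs (E n)\<rbrakk> \<Longrightarrow> lift n N x \<in> vecs (E N)"
proof (induction N)
  case (Suc N)
  then show ?case by (cases "n = Suc N") (auto simp: lift_Suc j_closed)
qed simp

lemma lift_add:
  "\<lbrakk>n \<le> N; x \<in> vecs (E n); y \<in> vecs (E n)\<rbrakk> \<Longrightarrow> lift n N (vadd (E n) x y) = vadd (E N) (lift n N x) (lift n N y)"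
proof (induction N)
  case (Suc N)
  then show ?case by (cases "n = Suc N") (auto simp: lift_Suc j_add lift_closed)
qed simp

lemma lift_scale:
  "\<lbrakk>n \<le> N; x \<in> vecs (E n)\<rbrakk> \<Longrightarrow> lift n N (vscale (E n) a x) = vscale (E N) a (lift n N x)"
proof (induction N)
  case (Suc N)
  then show ?case by (cases "n = Suc N") (auto simp: lift_Suc j_scale lift_closed)
qed simp

lemma lift_ip:
  "\<lbrakk>n \<le> N; x \<in> vecs (E n); y \<in> vecs (E n)\<rbrakk> \<Longrightarrow> ip (E N) (lift n N x) (lift n N y) = ip (E n) x y"
proof (induction N)
  case (Suc N)
  then show ?case by (cases "n = Suc N") (auto simp: lift_Suc j_ip lift_closed)
qed simp

lemma limit_kernel_lift:
  assumes "n \<le> N" "m \<le> N" "x \<in> vecs (E n)" "y \<in> vecs (E m)"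
  shows "limit_kernel E j (n, x) (m, y) = ip (E N) (lift n N x) (lift m N y)"
proof -
  let ?M = "max n m"
  have "limit_kernel E j (n, x) (m, y) = ip (E ?M) (lift n ?M x) (lift m ?M y)"
    by (simp add: limit_kernel_def lift_def Let_def)
  also have "\<dots> = ip (E N) (lift ?M N (lift n ?M x)) (lift ?M N (lift m ?M y))"
    using assms by (intro lift_ip[symmetric] lift_closed) auto
  finally show ?thesis using assms by (simp add: lift_lift)
qed

text \<open>Finitely many generators can be lifted to one common level, where the kernel is a Gram
  kernel.\<close>

lemma psd_kernel_limit: "psd_kernel gens (limit_kernel E j)"
proof (rule psd_kernel_if_gram_psd, unfold gram_psd_def, intro conjI ballI allI impI)
  fix p q assume "p \<in> gens" "q \<in> gens"
  then show "limit_kernel E j q p = cnj (limit_kernel E j p q)"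
    using limit_kernel_lift[of "fst p" "max (fst p) (fst q)" "fst q" "snd p" "snd q"]
      limit_kernel_lift[of "fst q" "max (fst p) (fst q)" "fst p" "snd q" "snd p"]
    by (auto intro!: hilbert_space.ip_cnj[OF hilbert] lift_closed)
next
  fix F c assume F: "finite F" "F \<subseteq> gens"
  define N where "N = Max (insert 0 (fst ` F))"
  have N: "fst p \<le> N" if "p \<in> F" for p using F that unfolding N_def by (intro Max_ge) auto
  interpret EN: hilbert_space "E N" by (rule hilbert)
  let ?h = "\<lambda>p. lift (fst p) N (snd p)"
  have "?h p \<in> vecs (E N)" if "p \<in> F" for p
    using that F N by (intro lift_closed) auto
  then have "gram_psd F (\<lambda>p q. ip (E N) (?h p) (?h q))"
    by (rule EN.gram_psd_ip)
  then have "0 \<le> Re (quad_form F (\<lambda>p q. ip (E N) (?h p) (?h q)) c)"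
    using F unfolding gram_psd_def by blast
  also have "quad_form F (\<lambda>p q. ip (E N) (?h p) (?h q)) c = quad_form F (limit_kernel E j) c"
  proof (intro quad_form_cong refl)
    fix p q assume "p \<in> F" "q \<in> F"
    then show "ip (E N) (?h p) (?h q) = limit_kernel E j p q"
      using N[of p] N[of q] subsetD[OF F(2), of p] subsetD[OF F(2), of q]
        limit_kernel_lift[of "fst p" N "fst q" "snd p" "snd q"] by auto
  qed
  finally show "0 \<le> Re (quad_form F (limit_kernel E j) c)" .
qed

sublocale psd_kernel gens "limit_kernel E j"
  by (rule psd_kernel_limit)

lemma K_eq_L: "K = L"
  by (simp add: inductive_limit_def)

lemma hilbert_space_L: "hilbert_space L"
  using hilbert_space_kernel_space by (simp add: K_eq_L)

lemma emb_closed: "x \<in> vecs (E n) \<Longrightarrow> emb n x \<in> vecs L"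
  using kernel_gen_closed[of "(n, x)"] by (simp add: limit_emb_def K_eq_L)

lemma ip_emb: "\<lbrakk>w \<in> vecs L; x \<in> vecs (E n)\<rbrakk> \<Longrightarrow> ip L w (emb n x) = w (n, x)"
  using ip_kernel_gen[of w "(n, x)"] by (simp add: limit_emb_def K_eq_L)

lemma emb_apply:
  "x \<in> vecs (E n) \<Longrightarrow> emb n x = (\<lambda>q. if q \<in> gens then limit_kernel E j (n, x) q else 0)"
  by (simp add: limit_emb_def kernel_gen_def)

lemma emb_lift: "\<lbrakk>n \<le> N; x \<in> vecs (E n)\<rbrakk> \<Longrightarrow> emb N (lift n N x) = emb n x"
proof
  fix q :: "nat \<times> 'e" assume n: "n \<le> N" and x: "x \<in> vecs (E n)"
  obtain m y where q: "q = (m, y)" by fastforce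
  show "emb N (lift n N x) q = emb n x q"
    using limit_kernel_lift[of N "max N m" m "lift n N x" y] limit_kernel_lift[of n "max N m" m x y] n x
    by (auto simp: emb_apply q lift_closed lift_lift)
qed

lemma emb_add:
  assumes "x \<in> vecs (E n)" "y \<in> vecs (E n)"
  shows "emb n (vadd (E n) x y) = vadd L (emb n x) (emb n y)"
proof
  fix q :: "nat \<times> 'e"
  interpret En: hilbert_space "E n" by (rule hilbert)
  obtain m z where q: "q = (m, z)" by fastforce
  interpret EN: hilbert_space "E (max n m)" by (rule hilbert)
  show "emb n (vadd (E n) x y) q = vadd L (emb n x) (emb n y) q"
    using limit_kernel_lift[of n "max n m" m _ z] assms
    by (auto simp: emb_apply q En.add_closed lift_add EN.ip_add lift_closed
        kernel_space_simps[unfolded K_eq_L])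
qed

lemma emb_scale:
  assumes "x \<in> vecs (E n)"
  shows "emb n (vscale (E n) a x) = vscale L a (emb n x)"
proof
  fix q :: "nat \<times> 'e"
  interpret En: hilbert_space "E n" by (rule hilbert)
  obtain m z where q: "q = (m, z)" by fastforce
  interpret EN: hilbert_space "E (max n m)" by (rule hilbert)
  show "emb n (vscale (E n) a x) q = vscale L a (emb n x) q"
    using limit_kernel_lift[of n "max n m" m _ z] assms
    by (auto simp: emb_apply q En.scale_closed lift_scale EN.ip_scale lift_closed
        kernel_space_simps[unfolded K_eq_L])
qed

lemma ip_emb_emb:
  "\<lbrakk>x \<in> vecs (E n); y \<in> vecs (E n)\<rbrakk> \<Longrightarrow> ip L (emb n x) (emb n y) = ip (E n) x y"
  using limit_kernel_lift[of n n n x y] by (simp add: ip_emb emb_closed) (simp add: emb_apply)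

lemma norm_emb: "x \<in> vecs (E n) \<Longrightarrow> vnorm L (emb n x) = vnorm (E n) x"
  by (simp add: vnorm_def ip_emb_emb)

text \<open>On each level from \<open>m\<close> on,
  \<open>x \<mapsto> \<langle>emb n x, w\<rangle>\<close> is a bounded functional vanishing on
  \<open>S n\<close>; lower levels are lifted to \<open>m\<close>. Starting at \<open>m\<close>
  suits operators in slot \<open>m\<close>, which act on elementary vectors only from that level
  on.\<close>

lemma eq_zero_if_orthogonal:
  assumes w: "w \<in> vecs L"
    and S: "\<And>n. m \<le> n \<Longrightarrow> S n \<subseteq> vecs (E n)"
    and separating: "\<And>n v. \<lbrakk>m \<le> n; v \<in> vecs (E n); \<And>s. s \<in> S n \<Longrightarrow> ip (E n) v s = 0\<rbrakk> \<Longrightarrow> v = vzero (E n)"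
    and orth: "\<And>n s. \<lbrakk>m \<le> n; s \<in> S n\<rbrakk> \<Longrightarrow> ip L w (emb n s) = 0"
  shows "w = vzero L"
proof -
  interpret L: hilbert_space L by (rule hilbert_space_L)
  have zero: "ip L (emb n x) w = 0" if n: "m \<le> n" and x: "x \<in> vecs (E n)" for n x
  proof (rule hilbert_space.functional_eq_zero[OF hilbert, where S = "S n" and C = "vnorm L w"])
    fix y assume y: "y \<in> vecs (E n)"
    show "cmod (ip L (emb n y) w) \<le> vnorm L w * vnorm (E n) y"
      using L.cauchy_schwarz[OF emb_closed[OF y] w] y by (simp add: norm_emb mult.commute)
  next
    fix s assume s: "s \<in> S n"
    then have "emb n s \<in> vecs L" using S[OF n] by (auto intro: emb_closed)
    then show "ip L (emb n s) w = 0" using orth[OF n s] L.ip_cnj[OF w, of "emb n s"] by simp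
  qed (use n x w S separating in \<open>simp_all add: emb_add emb_scale emb_closed L.ip_add L.ip_scale\<close>)
  show ?thesis
  proof (rule eq_zero_by_gens[unfolded K_eq_L, OF w])
    fix p assume p: "p \<in> gens"
    obtain n x where nx: "p = (n, x)" "x \<in> vecs (E n)" using p by auto
    have "ip L (emb (max n m) (lift n (max n m) x)) w = 0"
      using nx by (intro zero lift_closed) auto
    then have "ip L (emb n x) w = 0" using nx by (simp add: emb_lift)
    then show "w p = 0"
      using ip_emb[OF w nx(2)] L.ip_cnj[OF emb_closed[OF nx(2)] w] nx(1) by simp
  qed
qed

text \<open>\<open>A\<close> and \<open>B\<close> act on a generator after lifting it to level
  \<open>m\<close> if necessary. Compatibility with the maps \<open>j n\<close> makes the level
  irrelevant, so the adjoint relation and the bound can be checked for finitely many generators at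
  one common level.\<close>

lemma operator_extension:
  assumes A: "\<And>n. m \<le> n \<Longrightarrow> A n \<in> bops (E n)" and B: "\<And>n. m \<le> n \<Longrightarrow> B n \<in> bops (E n)"
    and C: "0 \<le> C" "\<And>n x. \<lbrakk>m \<le> n; x \<in> vecs (E n)\<rbrakk> \<Longrightarrow> vnorm (E n) (A n x) \<le> C * vnorm (E n) x"
    and adj: "\<And>n x y. \<lbrakk>m \<le> n; x \<in> vecs (E n); y \<in> vecs (E n)\<rbrakk> \<Longrightarrow> ip (E n) (A n x) y = ip (E n) x (B n y)"
    and A_j: "\<And>n x. \<lbrakk>m \<le> n; x \<in> vecs (E n)\<rbrakk> \<Longrightarrow> A (Suc n) (j n x) = j n (A n x)"
    and B_j: "\<And>n x. \<lbrakk>m \<le> n; x \<in> vecs (E n)\<rbrakk> \<Longrightarrow> B (Suc n) (j n x) = j n (B n x)"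
  shows "\<exists>e\<in>bops L. \<forall>n\<ge>m. \<forall>x\<in>vecs (E n). e (emb n x) = emb n (A n x)"
proof -
  define ext where "ext D = (\<lambda>(n, x). (max n m, D (max n m) (lift n (max n m) x)))"
    for D :: "nat \<Rightarrow> 'e \<Rightarrow> 'e"
  have closed: "A n x \<in> vecs (E n)" "B n x \<in> vecs (E n)" if "m \<le> n" "x \<in> vecs (E n)" for n x
    using hilbert_space.bopsD(1)[OF hilbert] A B that by auto
  have ext_closed: "ext D \<in> gens \<rightarrow> gens"
    if "\<And>n x. \<lbrakk>m \<le> n; x \<in> vecs (E n)\<rbrakk> \<Longrightarrow> D n x \<in> vecs (E n)" for D
    by (auto simp: ext_def intro!: that lift_closed)
  have lift_ext: "lift (fst (ext D p)) N (snd (ext D p)) = D N (lift (fst p) N (snd p))"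
    if D: "\<And>n x. \<lbrakk>m \<le> n; x \<in> vecs (E n)\<rbrakk> \<Longrightarrow> D n x \<in> vecs (E n)"
      "\<And>n x. \<lbrakk>m \<le> n; x \<in> vecs (E n)\<rbrakk> \<Longrightarrow> D (Suc n) (j n x) = j n (D n x)"
      and p: "p \<in> gens" "fst p \<le> N" "m \<le> N" for D p N
  proof -
    have D_lift: "D N (lift n N x) = lift n N (D n x)" if "m \<le> n" "n \<le> N" "x \<in> vecs (E n)" for n N x
      using that(2,1,3)
    proof (induction N)
      case (Suc N)
      then show ?case by (cases "n = Suc N") (auto simp: lift_Suc D lift_closed)
    qed simp
    show ?thesis
      using p D_lift[of "max (fst p) m" N "lift (fst p) (max (fst p) m) (snd p)"]
      by (auto simp: ext_def lift_closed lift_lift)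
  qed
  have kernel_at: "limit_kernel E j p q = ip (E N) (lift (fst p) N (snd p)) (lift (fst q) N (snd q))"
    if "p \<in> gens" "q \<in> gens" "fst p \<le> N" "fst q \<le> N" for p q N
    using limit_kernel_lift[of "fst p" N "fst q" "snd p" "snd q"] that by auto
  have a_closed: "ext A \<in> gens \<rightarrow> gens" and b_closed: "ext B \<in> gens \<rightarrow> gens"
    by (intro ext_closed closed; assumption)+
  have fst_ext: "fst (ext D p) \<le> N" if "fst p \<le> N" "m \<le> N" for D p N
    using that by (auto simp: ext_def split: prod.split)
  interpret M: kernel_map gens "limit_kernel E j" gens "limit_kernel E j" "ext A" "ext B" "\<lambda>_. 1" C
  proof
    fix p q assume p: "p \<in> gens" and q: "q \<in> gens"
    let ?N = "max m (max (fst p) (fst q))"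
    have "limit_kernel E j (ext A p) q = ip (E ?N) (A ?N (lift (fst p) ?N (snd p))) (lift (fst q) ?N (snd q))"
      using p q a_closed by (subst kernel_at[of _ _ ?N]) (auto simp: fst_ext lift_ext closed A_j)
    also have "\<dots> = ip (E ?N) (lift (fst p) ?N (snd p)) (B ?N (lift (fst q) ?N (snd q)))"
      using p q by (intro adj lift_closed) auto
    also have "\<dots> = limit_kernel E j p (ext B q)"
      using p q b_closed by (subst kernel_at[of _ _ ?N]) (auto simp: fst_ext lift_ext closed B_j)
    finally show "limit_kernel E j (ext A p) q = 1 * limit_kernel E j p (ext B q)" by simp
  next
    fix c assume c: "c \<in> free_space gens"
    have "gram_psd gens (\<lambda>p q. of_real (C\<^sup>2) * limit_kernel E j p q - limit_kernel E j (ext A p) (ext A q))"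
      unfolding gram_psd_def
    proof (intro conjI ballI allI impI)
      fix p q assume p: "p \<in> gens" and q: "q \<in> gens"
      then have "ext A p \<in> gens" "ext A q \<in> gens" using a_closed by blast+
      then show "of_real (C\<^sup>2) * limit_kernel E j q p - limit_kernel E j (ext A q) (ext A p) =
          cnj (of_real (C\<^sup>2) * limit_kernel E j p q - limit_kernel E j (ext A p) (ext A q))"
        using hermitian[OF p q] hermitian[of "ext A p" "ext A q"] by simp
    next
      fix F d assume F: "finite F" "F \<subseteq> gens"
      define N where "N = Max (insert m (fst ` F))"
      have N: "fst p \<le> N" if "p \<in> F" for p using F that unfolding N_def by (intro Max_ge) auto
      have m: "m \<le> N" using F unfolding N_def by (intro Max_ge) auto
      interpret EN: hilbert_space "E N" by (rule hilbert)
      let ?h = "\<lambda>p. lift (fst p) N (snd p)"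
      have h: "?h p \<in> vecs (E N)" if "p \<in> F" for p
        using that F N by (intro lift_closed) auto
      have "gram_psd F (\<lambda>p q. of_real (C\<^sup>2) * ip (E N) (?h p) (?h q)
          - ip (E N) (A N (?h p)) (A N (?h q)))"
        using A[OF m] C h m by (intro EN.gram_psd_bounded) auto
      then have "0 \<le> Re (quad_form F (\<lambda>p q. of_real (C\<^sup>2) * ip (E N) (?h p) (?h q)
          - ip (E N) (A N (?h p)) (A N (?h q))) d)"
        by (rule gram_psd_nonneg[OF _ F(1) order_refl])
      also have "quad_form F (\<lambda>p q. of_real (C\<^sup>2) * ip (E N) (?h p) (?h q)
          - ip (E N) (A N (?h p)) (A N (?h q))) d =
        quad_form F (\<lambda>p q. of_real (C\<^sup>2) * limit_kernel E j p q
          - limit_kernel E j (ext A p) (ext A q)) d"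
      proof (intro quad_form_cong refl)
        fix p q assume pq: "p \<in> F" "q \<in> F"
        then have pq': "p \<in> gens" "q \<in> gens" "ext A p \<in> gens" "ext A q \<in> gens"
          using F a_closed by blast+
        have "limit_kernel E j p q = ip (E N) (?h p) (?h q)"
          using kernel_at[of p q N] pq' N pq by simp
        moreover have "limit_kernel E j (ext A p) (ext A q) = ip (E N) (A N (?h p)) (A N (?h q))"
          using kernel_at[of "ext A p" "ext A q" N] pq' N[OF pq(1)] N[OF pq(2)] m
          by (simp add: fst_ext lift_ext closed A_j)
        ultimately show "of_real (C\<^sup>2) * ip (E N) (?h p) (?h q) - ip (E N) (A N (?h p)) (A N (?h q)) =
            of_real (C\<^sup>2) * limit_kernel E j p q - limit_kernel E j (ext A p) (ext A q)" by simp
      qed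
      finally show "0 \<le> Re (quad_form F (\<lambda>p q. of_real (C\<^sup>2) * limit_kernel E j p q
          - limit_kernel E j (ext A p) (ext A q)) d)" .
    qed
    then show "Re (kernel_form (limit_kernel E j) (push (ext A) c) (push (ext A) c))
        \<le> C\<^sup>2 * Re (kernel_form (limit_kernel E j) c c)"
      using c by (rule bounded_if_gram_psd)
  qed (use a_closed b_closed C in auto)
  interpret L: hilbert_space L by (rule hilbert_space_L)
  let ?e = "restrict M.J (vecs L)"
  have e: "?e \<in> bops L"
  proof (rule L.bopsI[where C = C])
    fix f g assume "f \<in> vecs L" "g \<in> vecs L"
    then show "?e (vadd L f g) = vadd L (?e f) (?e g)"
      using M.J_add[unfolded K_eq_L] by (simp add: L.add_closed)
  next
    fix c f assume "f \<in> vecs L"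
    then show "?e (vscale L c f) = vscale L c (?e f)"
      using M.J_scale[unfolded K_eq_L] by (simp add: L.scale_closed)
  qed (use M.J_closed[unfolded K_eq_L] M.J_norm[unfolded K_eq_L] in auto)
  show ?thesis
  proof (intro bexI[OF _ e] allI impI ballI)
    fix n x assume "m \<le> n" "x \<in> vecs (E n)"
    then show "?e (emb n x) = emb n (A n x)"
      using M.J_kernel_gen[of "(n, x)"]
      by (simp add: emb_closed) (simp add: limit_emb_def ext_def max_absorb1)
  qed
qed

end


section \<open>Infinite tensor products\<close>

text \<open>At each \<open>z\<close> the adjoints of \<open>X\<close> and \<open>Y\<close> differ by
  a vector orthogonal to \<open>S\<close>, hence agree.\<close>

lemma (in hilbert_space) bops_eq_on_separating:
  assumes X: "X \<in> bops H" and Y: "Y \<in> bops H" and S: "S \<subseteq> vecs H"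
    and separating: "\<And>w. \<lbrakk>w \<in> vecs H; \<And>s. s \<in> S \<Longrightarrow> ip H w s = 0\<rbrakk> \<Longrightarrow> w = vzero H"
    and eq: "\<And>s. s \<in> S \<Longrightarrow> X s = Y s"
  shows "X = Y"
proof (rule bops_eqI[OF X Y])
  note X' = adjoint_closed[OF X] and Y' = adjoint_closed[OF Y]
  fix x assume x: "x \<in> vecs H"
  show "X x = Y x"
  proof (rule eq_by_ip)
    fix z assume z: "z \<in> vecs H"
    have z': "adjoint H X z \<in> vecs H" "adjoint H Y z \<in> vecs H" using X' Y' z by (auto simp: bopsD(1))
    have "diff (adjoint H X z) (adjoint H Y z) = vzero H"
    proof (rule separating)
      fix s assume s: "s \<in> S"
      then have sH: "s \<in> vecs H" using S by blast
      have "ip H s (diff (adjoint H X z) (adjoint H Y z)) = 0"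
        using ip_adjoint[OF X sH z] ip_adjoint[OF Y sH z] eq[OF s] sH z' by (simp add: ip_diff_right)
      then show "ip H (diff (adjoint H X z) (adjoint H Y z)) s = 0"
        using ip_cnj[of s "diff (adjoint H X z) (adjoint H Y z)"] sH z' by (simp add: diff_closed)
    qed (use z' in \<open>simp add: diff_closed\<close>)
    then have "adjoint H X z = adjoint H Y z" using z' by (rule diff_eq_zeroD[rotated 2])
    then show "ip H (X x) z = ip H (Y x) z" using x z by (simp add: ip_adjoint[OF X] ip_adjoint[OF Y])
  qed (use X Y x in \<open>auto simp: bopsD(1)\<close>)
qed

lemma (in hilbert_space) ip_rank_one:
  "\<lbrakk>x \<in> vecs H; y \<in> vecs H; w \<in> vecs H\<rbrakk> \<Longrightarrow> ip H (rank_one w x) y = ip H x (rank_one w y)"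
  using ip_cnj[of y w] by (simp add: rank_one_def ip_scale ip_scale_right scale_closed)

definition slot :: "nat \<Rightarrow> ('a \<Rightarrow> 'a) \<Rightarrow> (nat \<Rightarrow> 'a) \<Rightarrow> (nat \<Rightarrow> 'a)" where
  "slot m T s = s(m := T (s m))"

text \<open>The infinite tensor with entries \<open>s 0, ..., s n\<close> followed by
  \<open>\<phi> (n + 1), \<phi> (n + 2), ...\<close>.\<close>

definition elem_vec :: "(nat \<Rightarrow> 'a hspace) \<Rightarrow> (nat \<Rightarrow> 'a) \<Rightarrow> nat \<Rightarrow> (nat \<Rightarrow> 'a) \<Rightarrow> 'a itensor" where
  "elem_vec H \<phi> n s = tensor_emb H \<phi> n (elem_tensor {..n} H s)"

section \<open>The infinite tensor product and its elementary vectors\<close>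

locale tensor_family =
  fixes H :: "nat \<Rightarrow> 'a hspace" and \<phi> :: "nat \<Rightarrow> 'a"
  assumes hilbert: "hilbert_space (H i)"
    and \<phi>_closed: "\<phi> i \<in> vecs (H i)"
    and \<phi>_norm: "vnorm (H i) (\<phi> i) = 1"
begin

abbreviation E where "E n \<equiv> fin_tensor {..n} H"
abbreviation tups where "tups n \<equiv> tuples {..n} H"
abbreviation tker where "tker n \<equiv> tensor_kernel {..n} H"
abbreviation K where "K \<equiv> inf_tensor H \<phi>"
abbreviation \<Theta> where "\<Theta> \<equiv> elem_vec H \<phi>"

lemma ip_\<phi>: "ip (H i) (\<phi> i) (\<phi> i) = 1"
  using hilbert_space.ip_self[OF hilbert \<phi>_closed] by (simp add: \<phi>_norm)

lemma psd: "psd_kernel (tups n) (tker n)"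
  by (rule psd_kernel_tensor) (auto intro: hilbert)

lemma hilbert_E: "hilbert_space (E n)"
  unfolding fin_tensor_def by (rule psd_kernel.hilbert_space_kernel_space[OF psd])

lemma tups_D: "\<lbrakk>s \<in> tups n; i \<le> n\<rbrakk> \<Longrightarrow> s i \<in> vecs (H i)"
  by (auto simp: tuples_def)

lemma tups_extensional: "s \<in> tups n \<Longrightarrow> (\<lambda>i\<in>{..n}. s i) = s"
  by (auto simp: tuples_def PiE_restrict)

lemma tups_I: "(\<And>i. i \<le> n \<Longrightarrow> s i \<in> vecs (H i)) \<Longrightarrow> (\<lambda>i\<in>{..n}. s i) \<in> tups n"
  by (auto simp: tuples_def)

text \<open>Presents \<open>append_vec\<close> as the operator induced by adding the entry
  \<open>\<phi> (Suc n)\<close>, so that closure, linearity and isometry come from \<open>J\<close>.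
  The weight is the factor of the new slot in the kernel; the bound is 1 because the new entry is a
  unit vector.\<close>

lemma append_map:
  "kernel_map (tups n) (tker n) (tups (Suc n)) (tker (Suc n)) (\<lambda>s. s(Suc n := \<phi> (Suc n)))
     (\<lambda>t. restrict t {..n}) (\<lambda>t. ip (H (Suc n)) (\<phi> (Suc n)) (t (Suc n))) 1"
proof -
  interpret X: psd_kernel "tups n" "tker n" by (rule psd)
  interpret Y: psd_kernel "tups (Suc n)" "tker (Suc n)" by (rule psd)
  have tker_Suc: "tker (Suc n) (s(Suc n := \<phi> (Suc n))) t =
      ip (H (Suc n)) (\<phi> (Suc n)) (t (Suc n)) * tker n s t" for s t
    by (simp add: tensor_kernel_def atMost_Suc)
  have tker_restrict: "tker n s (restrict t {..n}) = tker n s t" for s t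
    by (simp add: tensor_kernel_def)
  have tker_upd: "tker n s (t(Suc n := u)) = tker n s t" for s t u
    by (simp add: tensor_kernel_def)
  show ?thesis
  proof
    show "(\<lambda>s. s(Suc n := \<phi> (Suc n))) \<in> tups n \<rightarrow> tups (Suc n)"
      by (auto simp: tuples_def PiE_iff extensional_def \<phi>_closed le_Suc_eq)
    show "(\<lambda>t. restrict t {..n}) \<in> tups (Suc n) \<rightarrow> tups n"
      by (auto simp: tuples_def PiE_iff)
  next
    fix c assume c: "c \<in> free_space (tups n)"
    have "kernel_form (tker (Suc n)) (push (\<lambda>s. s(Suc n := \<phi> (Suc n))) c)
        (push (\<lambda>s. s(Suc n := \<phi> (Suc n))) c) = kernel_form (tker n) c c"
      unfolding kernel_form_pm_sum pm_sum_push by (simp add: tker_Suc tker_upd ip_\<phi>)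
    then show "Re (kernel_form (tker (Suc n)) (push (\<lambda>s. s(Suc n := \<phi> (Suc n))) c)
        (push (\<lambda>s. s(Suc n := \<phi> (Suc n))) c)) \<le> 1\<^sup>2 * Re (kernel_form (tker n) c c)" by simp
  qed (simp_all add: tker_Suc tker_restrict)
qed

lemma append_vec_eq: "append_vec H \<phi> n =
    kernel_map.J (tups (Suc n)) (\<lambda>t. restrict t {..n}) (\<lambda>t. ip (H (Suc n)) (\<phi> (Suc n)) (t (Suc n)))"
  by (simp add: fun_eq_iff kernel_map.J_def[OF append_map] append_vec_def)

lemma append_elem_tensor:
  "s \<in> tups n \<Longrightarrow> append_vec H \<phi> n (elem_tensor {..n} H s) = elem_tensor {..Suc n} H (s(Suc n := \<phi> (Suc n)))"
  unfolding append_vec_eq elem_tensor_def by (rule kernel_map.J_kernel_gen[OF append_map])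

lemma inductive_system: "inductive_system E (append_vec H \<phi>)"
proof (rule inductive_system.intro)
  fix n x y assume "x \<in> vecs (E n)" "y \<in> vecs (E n)"
  then show "ip (E (Suc n)) (append_vec H \<phi> n x) (append_vec H \<phi> n y) = ip (E n) x y"
    unfolding append_vec_eq fin_tensor_def
    by (intro kernel_map.J_isometric[OF append_map])
      (simp_all add: tensor_kernel_def atMost_Suc ip_\<phi>)
qed (simp_all only: append_vec_eq fin_tensor_def kernel_map.J_closed[OF append_map]
      kernel_map.J_add[OF append_map] kernel_map.J_scale[OF append_map] hilbert_E[unfolded fin_tensor_def])

sublocale S: inductive_system E "append_vec H \<phi>"
  by (rule inductive_system)

lemma L_eq: "S.L = K"
  by (simp add: inf_tensor_def)

sublocale K: hilbert_space K
  using S.hilbert_space_L by (simp add: L_eq)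

lemma elem_tensor_closed: "s \<in> tups n \<Longrightarrow> elem_tensor {..n} H s \<in> vecs (E n)"
  unfolding elem_tensor_def fin_tensor_def by (rule psd_kernel.kernel_gen_closed[OF psd])

lemma ip_elem_tensor: "\<lbrakk>x \<in> vecs (E n); s \<in> tups n\<rbrakk> \<Longrightarrow> ip (E n) x (elem_tensor {..n} H s) = x s"
  unfolding elem_tensor_def fin_tensor_def by (rule psd_kernel.ip_kernel_gen[OF psd])

lemma elem_tensor_separating:
  "\<lbrakk>x \<in> vecs (E n); \<And>s. s \<in> tups n \<Longrightarrow> ip (E n) x (elem_tensor {..n} H s) = 0\<rbrakk> \<Longrightarrow> x = vzero (E n)"
  using psd_kernel.eq_zero_by_gens[OF psd, of x n] ip_elem_tensor[of x n] unfolding fin_tensor_def by simp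

lemma \<Theta>_emb: "\<Theta> n s = S.emb n (elem_tensor {..n} H s)"
  by (simp add: elem_vec_def tensor_emb_def)

lemma \<Theta>_closed: "s \<in> tups n \<Longrightarrow> \<Theta> n s \<in> vecs K"
  unfolding \<Theta>_emb L_eq[symmetric] by (intro S.emb_closed elem_tensor_closed)

lemma ip_\<Theta>:
  assumes "s \<in> tups n" "t \<in> tups n"
  shows "ip K (\<Theta> n s) (\<Theta> n t) = (\<Prod>i\<le>n. ip (H i) (s i) (t i))"
  unfolding \<Theta>_emb L_eq[symmetric] using assms
  by (simp add: S.ip_emb_emb elem_tensor_closed ip_elem_tensor)
    (simp add: elem_tensor_def kernel_gen_def tensor_kernel_def)

lemma norm_\<Theta>:
  assumes s: "s \<in> tups n"
  shows "vnorm K (\<Theta> n s) = (\<Prod>i\<le>n. vnorm (H i) (s i))"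
proof -
  have "ip K (\<Theta> n s) (\<Theta> n s) = (\<Prod>i\<le>n. of_real ((vnorm (H i) (s i))\<^sup>2))"
    using s by (simp add: ip_\<Theta> tups_D hilbert_space.ip_self[OF hilbert])
  also have "\<dots> = of_real ((\<Prod>i\<le>n. vnorm (H i) (s i))\<^sup>2)" by (simp add: prod_power_distrib)
  finally have "Re (ip K (\<Theta> n s) (\<Theta> n s)) = (\<Prod>i\<le>n. vnorm (H i) (s i))\<^sup>2"
    by (simp only: Re_complex_of_real)
  moreover have "0 \<le> (\<Prod>i\<le>n. vnorm (H i) (s i))"
    using s by (intro prod_nonneg) (auto intro!: hilbert_space.norm_nonneg[OF hilbert] tups_D)
  ultimately show ?thesis by (simp add: vnorm_def[of K])
qed

lemma \<Theta>_append: "s \<in> tups n \<Longrightarrow> \<Theta> (Suc n) (s(Suc n := \<phi> (Suc n))) = \<Theta> n s"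
  using S.emb_lift[of n "Suc n" "elem_tensor {..n} H s"]
  by (simp add: \<Theta>_emb S.lift_Suc append_elem_tensor elem_tensor_closed)

definition extend :: "nat \<Rightarrow> nat \<Rightarrow> (nat \<Rightarrow> 'a) \<Rightarrow> (nat \<Rightarrow> 'a)" where
  "extend n N s = (\<lambda>i\<in>{..N}. if i \<le> n then s i else \<phi> i)"

lemma extend_closed: "s \<in> tups n \<Longrightarrow> extend n N s \<in> tups N"
  unfolding extend_def by (rule tups_I) (auto intro: tups_D \<phi>_closed)

lemma \<Theta>_extend: "\<lbrakk>n \<le> N; s \<in> tups n\<rbrakk> \<Longrightarrow> \<Theta> N (extend n N s) = \<Theta> n s"
proof (induction N rule: dec_induct)
  case base
  have "extend n n s = (\<lambda>i\<in>{..n}. s i)" by (auto simp: extend_def fun_eq_iff)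
  then show ?case using base by (simp add: tups_extensional)
next
  case (step N)
  have "extend n (Suc N) s = (extend n N s)(Suc N := \<phi> (Suc N))"
    using step by (auto simp: extend_def fun_eq_iff)
  then show ?case
    using step.IH[OF step.prems] \<Theta>_append[OF extend_closed[OF step.prems], of N] by (simp only:)
qed

text \<open>Turns slotwise rank one operators into a multiple of the reference vector in
  \<open>rank_one_\<Omega>_\<Theta>\<close>.\<close>

lemma \<Theta>_scale:
  assumes s: "s \<in> tups n"
  shows "\<Theta> n (\<lambda>i\<in>{..n}. vscale (H i) (c i) (s i)) = vscale K (\<Prod>i\<le>n. c i) (\<Theta> n s)"
proof -
  have "elem_tensor {..n} H (\<lambda>i\<in>{..n}. vscale (H i) (c i) (s i)) =
      vscale (E n) (\<Prod>i\<le>n. c i) (elem_tensor {..n} H s)"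
  proof
    fix t
    have "(\<Prod>i\<le>n. ip (H i) (vscale (H i) (c i) (s i)) (t i)) = (\<Prod>i\<le>n. c i * ip (H i) (s i) (t i))"
      if "t \<in> tups n"
      using s that by (intro prod.cong) (auto simp: hilbert_space.ip_scale[OF hilbert] tups_D)
    then show "elem_tensor {..n} H (\<lambda>i\<in>{..n}. vscale (H i) (c i) (s i)) t =
        vscale (E n) (\<Prod>i\<le>n. c i) (elem_tensor {..n} H s) t"
      by (simp add: elem_tensor_def kernel_gen_def fin_tensor_def tensor_kernel_def prod.distrib
          psd_kernel.kernel_space_simps[OF psd])
  qed
  then show ?thesis
    unfolding \<Theta>_emb L_eq[symmetric] using s by (simp add: S.emb_scale elem_tensor_closed)
qed

lemma \<Theta>_separating:
  assumes "w \<in> vecs K" "\<And>n s. \<lbrakk>m \<le> n; s \<in> tups n\<rbrakk> \<Longrightarrow> ip K w (\<Theta> n s) = 0"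
  shows "w = vzero K"
  unfolding L_eq[symmetric]
proof (rule S.eq_zero_if_orthogonal[where m = m and S = "\<lambda>n. elem_tensor {..n} H ` tups n"])
  fix n v assume "v \<in> vecs (E n)" "\<And>s. s \<in> elem_tensor {..n} H ` tups n \<Longrightarrow> ip (E n) v s = 0"
  then show "v = vzero (E n)" by (intro elem_tensor_separating) auto
qed (use assms in \<open>auto simp: L_eq \<Theta>_emb elem_tensor_closed\<close>)

lemma bops_eq_on_\<Theta>:
  assumes "X \<in> bops K" "Y \<in> bops K" "\<And>n s. \<lbrakk>m \<le> n; s \<in> tups n\<rbrakk> \<Longrightarrow> X (\<Theta> n s) = Y (\<Theta> n s)"
  shows "X = Y"
proof (rule K.bops_eq_on_separating[where S = "{\<Theta> n s | n s. m \<le> n \<and> s \<in> tups n}"])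
  fix w assume "w \<in> vecs K" "\<And>s. s \<in> {\<Theta> n s | n s. m \<le> n \<and> s \<in> tups n} \<Longrightarrow> ip K w s = 0"
  then show "w = vzero K" by (intro \<Theta>_separating[of w m]) auto
qed (use assms \<Theta>_closed in auto)

text \<open>Entries between vectors of equal level suffice: padding with the reference vectors
  raises a vector of level \<open>n\<close> to any higher level, and the test vectors of levels from
  \<open>n\<close> on separate.\<close>

lemma bops_eq_by_matrix:
  assumes X: "X \<in> bops K" and Y: "Y \<in> bops K"
    and eq: "\<And>n s t. \<lbrakk>m \<le> n; s \<in> tups n; t \<in> tups n\<rbrakk> \<Longrightarrow> ip K (X (\<Theta> n s)) (\<Theta> n t) = ip K (Y (\<Theta> n s)) (\<Theta> n t)"
  shows "X = Y"
proof (rule bops_eq_on_\<Theta>[OF X Y])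
  fix n s assume n: "m \<le> n" and s: "s \<in> tups n"
  have closed: "X (\<Theta> n s) \<in> vecs K" "Y (\<Theta> n s) \<in> vecs K"
    using X Y \<Theta>_closed[OF s] by (auto simp: K.bopsD(1))
  have "K.diff (X (\<Theta> n s)) (Y (\<Theta> n s)) = vzero K"
  proof (rule \<Theta>_separating[of _ n])
    fix N t assume N: "n \<le> N" and t: "t \<in> tups N"
    show "ip K (K.diff (X (\<Theta> n s)) (Y (\<Theta> n s))) (\<Theta> N t) = 0"
      using eq[OF _ extend_closed[OF s, of N] t] N n s t closed
      by (simp add: K.ip_diff_left \<Theta>_closed \<Theta>_extend)
  qed (use closed in \<open>simp add: K.diff_closed\<close>)
  then show "X (\<Theta> n s) = Y (\<Theta> n s)" using closed by (rule K.diff_eq_zeroD[rotated 2])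
qed

section \<open>Operators acting in finitely many slots\<close>

lemma slot_closed: "\<lbrakk>T \<in> bops (H m); m \<le> n; s \<in> tups n\<rbrakk> \<Longrightarrow> slot m T s \<in> tups n"
  using hilbert_space.bopsD(1)[OF hilbert, of T m "s m"]
  by (auto simp: slot_def tuples_def PiE_iff extensional_def)

text \<open>For the bound, the difference of kernels factors into the tensor kernel of the other
  slots and \<open>C^2 \<langle>x, y\<rangle> - \<langle>T x, T y\<rangle>\<close> in slot
  \<open>m\<close>; both factors are positive, hence so is their product.\<close>

lemma slot_map:
  assumes m: "m \<le> n" and T: "T \<in> bops (H m)" and T': "T' \<in> bops (H m)"
    and adj: "\<And>x y. \<lbrakk>x \<in> vecs (H m); y \<in> vecs (H m)\<rbrakk> \<Longrightarrow> ip (H m) (T x) y = ip (H m) x (T' y)"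
    and C: "\<And>x. x \<in> vecs (H m) \<Longrightarrow> vnorm (H m) (T x) \<le> C * vnorm (H m) x" "0 \<le> C"
  shows "kernel_map (tups n) (tker n) (tups n) (tker n) (slot m T) (slot m T') (\<lambda>_. 1) C"
proof -
  interpret X: psd_kernel "tups n" "tker n" by (rule psd)
  interpret Hm: hilbert_space "H m" by (rule hilbert)
  show ?thesis
  proof
    fix s t assume s: "s \<in> tups n" and t: "t \<in> tups n"
    show "tker n (slot m T s) t = 1 * tker n s (slot m T' t)"
      using m adj[of "s m" "t m"] tups_D[OF s] tups_D[OF t]
      by (auto simp: tensor_kernel_def slot_def intro!: prod.cong)
  next
    fix c assume c: "c \<in> free_space (tups n)"
    let ?P = "\<lambda>s t. \<Prod>i\<in>{..n} - {m}. ip (H i) (s i) (t i)"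
    have "gram_psd (tups n) (\<lambda>s t. ?P s t *
        (of_real (C\<^sup>2) * ip (H m) (s m) (t m) - ip (H m) (T (s m)) (T (t m))))"
      using m by (intro gram_psd_mult gram_psd_tensor Hm.gram_psd_bounded T C hilbert) (auto intro: tups_D)
    also have "?this \<longleftrightarrow> gram_psd (tups n) (\<lambda>s t. of_real (C\<^sup>2) * tker n s t - tker n (slot m T s) (slot m T t))"
    proof (rule gram_psd_cong)
      fix s t
      have "tker n s t = ip (H m) (s m) (t m) * ?P s t"
        unfolding tensor_kernel_def using m by (intro prod.remove) auto
      moreover have "tker n (slot m T s) (slot m T t) = ip (H m) (T (s m)) (T (t m)) * ?P s t"
        unfolding tensor_kernel_def using m
        by (subst prod.remove[of _ m]) (auto simp: slot_def)
      ultimately show "?P s t * (of_real (C\<^sup>2) * ip (H m) (s m) (t m) - ip (H m) (T (s m)) (T (t m))) =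
          of_real (C\<^sup>2) * tker n s t - tker n (slot m T s) (slot m T t)"
        by (simp add: algebra_simps)
    qed
    finally show "Re (kernel_form (tker n) (push (slot m T) c) (push (slot m T) c))
        \<le> C\<^sup>2 * Re (kernel_form (tker n) c c)"
      using c by (rule bounded_if_gram_psd[where k = "tker n" and l = "tker n" and a = "slot m T"])
  qed (use C m T T' slot_closed in auto)
qed

text \<open>From level \<open>m\<close> on, \<open>T\<close> acts in slot \<open>m\<close>, and this
  commutes with appending because the appended slot comes after \<open>m\<close>. So the level
  operators extend to the limit.\<close>

lemma single_site_operator:
  assumes T: "T \<in> bops (H m)"
  shows "\<exists>X\<in>bops K. \<forall>n\<ge>m. \<forall>s\<in>tups n. X (\<Theta> n s) = \<Theta> n (slot m T s)"
proof -
  interpret Hm: hilbert_space "H m" by (rule hilbert)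
  define T' where "T' = adjoint (H m) T"
  have T': "T' \<in> bops (H m)" unfolding T'_def using T by (rule Hm.adjoint_closed)
  have adj: "ip (H m) (T x) y = ip (H m) x (T' y)" if "x \<in> vecs (H m)" "y \<in> vecs (H m)" for x y
    unfolding T'_def using T that by (rule Hm.ip_adjoint)
  have adj': "ip (H m) (T' x) y = ip (H m) x (T y)" if "x \<in> vecs (H m)" "y \<in> vecs (H m)" for x y
    using adj[OF that(2,1)] Hm.ip_cnj[of "T y" x] Hm.ip_cnj[of y "T' x"] that T T'
    by (simp add: Hm.bopsD(1))
  obtain C where C: "0 \<le> C" "\<And>x. x \<in> vecs (H m) \<Longrightarrow> vnorm (H m) (T x) \<le> C * vnorm (H m) x"
    using Hm.bops_bound[OF T] by blast
  obtain D where D: "0 \<le> D" "\<And>x. x \<in> vecs (H m) \<Longrightarrow> vnorm (H m) (T' x) \<le> D * vnorm (H m) x"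
    using Hm.bops_bound[OF T'] by blast
  have mapA: "kernel_map (tups n) (tker n) (tups n) (tker n) (slot m T) (slot m T') (\<lambda>_. 1) C"
    and mapB: "kernel_map (tups n) (tker n) (tups n) (tker n) (slot m T') (slot m T) (\<lambda>_. 1) D"
    if "m \<le> n" for n
    using slot_map[OF that T T'] slot_map[OF that T' T] adj adj' C D by blast+
  \<comment> \<open>\<open>J S\<close> precomposes functionals with \<open>slot m S\<close>. Hence
    \<open>J T'\<close>, not \<open>J T\<close>, is the operator that puts \<open>T\<close> into
    slot \<open>m\<close> of elementary tensors, and \<open>J T\<close> is its adjoint.\<close>
  define J where "J S n = (\<lambda>x\<in>vecs (E n). kernel_map.J (tups n) (slot m S) (\<lambda>_. 1) x)"
    for S n
  have J_closed: "J S n \<in> bops (E n)"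
    if "kernel_map (tups n) (tker n) (tups n) (tker n) (slot m S') (slot m S) (\<lambda>_. 1) c" for S S' c n
  proof -
    interpret En: hilbert_space "E n" by (rule hilbert_E)
    interpret M: kernel_map "tups n" "tker n" "tups n" "tker n" "slot m S'" "slot m S" "\<lambda>_. 1" c
      by (rule that)
    note E = fin_tensor_def[of "{..n}" H, symmetric]
    show ?thesis
      by (rule En.bopsI[where C = c])
        (auto simp: J_def M.J_closed[unfolded E] M.J_norm[unfolded E] M.J_add[unfolded E]
          M.J_scale[unfolded E] En.add_closed En.scale_closed)
  qed
  have J_apply: "J S n x = (\<lambda>y. if y \<in> tups n then x (slot m S y) else 0)"
    if "kernel_map (tups n) (tker n) (tups n) (tker n) (slot m S') (slot m S) (\<lambda>_. 1) c"
      "x \<in> vecs (E n)" for S S' c n x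
    using that(2) by (simp add: J_def kernel_map.J_def[OF that(1)] cong: if_cong)
  have J_append: "J S (Suc n) (append_vec H \<phi> n x) = append_vec H \<phi> n (J S n x)"
    if S: "S \<in> bops (H m)" and n: "m \<le> n" and x: "x \<in> vecs (E n)"
      and map: "\<And>n. m \<le> n \<Longrightarrow> kernel_map (tups n) (tker n) (tups n) (tker n) (slot m S') (slot m S) (\<lambda>_. 1) c"
    for S S' c n x
  proof
    fix t
    have "restrict (slot m S t) {..n} = slot m S (restrict t {..n})"
      using n by (auto simp: slot_def fun_eq_iff)
    moreover have "restrict t {..n} \<in> tups n" if "t \<in> tups (Suc n)"
      using that by (auto simp: tuples_def)
    ultimately show "J S (Suc n) (append_vec H \<phi> n x) t = append_vec H \<phi> n (J S n x) t"
      using n slot_closed[OF S, of "Suc n" t]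
      by (simp add: J_apply[OF map] x S.j_closed) (auto simp: append_vec_def slot_def)
  qed
  have "\<exists>e\<in>bops S.L. \<forall>n\<ge>m. \<forall>x\<in>vecs (E n). e (S.emb n x) = S.emb n (J T' n x)"
  proof (rule S.operator_extension[where B = "J T" and C = C])
    fix n x y assume n: "m \<le> n" and x: "x \<in> vecs (E n)" and y: "y \<in> vecs (E n)"
    show "ip (E n) (J T' n x) y = ip (E n) x (J T n y)"
      using kernel_map.J_adjoint[OF mapA[OF n] mapB[OF n]] x y by (simp add: J_def fin_tensor_def)
  next
    fix n x assume n: "m \<le> n" and x: "x \<in> vecs (E n)"
    show "vnorm (E n) (J T' n x) \<le> C * vnorm (E n) x"
      using kernel_map.J_norm[OF mapA[OF n]] x by (simp add: J_def fin_tensor_def)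
  qed (auto intro!: J_append J_closed mapA mapB T T' C)
  then obtain e where e: "e \<in> bops K"
    "\<And>n x. \<lbrakk>m \<le> n; x \<in> vecs (E n)\<rbrakk> \<Longrightarrow> e (S.emb n x) = S.emb n (J T' n x)"
    unfolding L_eq by blast
  have "e (\<Theta> n s) = \<Theta> n (slot m T s)" if "m \<le> n" "s \<in> tups n" for n s
    using that kernel_map.J_kernel_gen[OF mapA] 
    by (simp add: \<Theta>_emb e elem_tensor_closed)
      (simp add: J_def elem_tensor_closed, simp add: elem_tensor_def)
  then show ?thesis using e(1) by blast
qed

text \<open>One single-site operator is composed per step. The condition
  \<open>k \<le> Suc n\<close> says that the slots \<open>0, ..., k - 1\<close> exist at level
  \<open>n\<close>.\<close>

lemma finite_sites_operator:
  assumes T: "\<And>i. T i \<in> bops (H i)"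
  shows "\<exists>X\<in>bops K. \<forall>n s. k \<le> Suc n \<longrightarrow> s \<in> tups n \<longrightarrow>
    X (\<Theta> n s) = \<Theta> n (\<lambda>i\<in>{..n}. if i < k then T i (s i) else s i)"
proof (induction k)
  case 0
  show ?case
    by (intro bexI[OF _ K.id_op_closed]) (simp add: id_op_def \<Theta>_closed tups_extensional)
next
  case (Suc k)
  then obtain X where X: "X \<in> bops K" "\<And>n s. \<lbrakk>k \<le> Suc n; s \<in> tups n\<rbrakk> \<Longrightarrow>
    X (\<Theta> n s) = \<Theta> n (\<lambda>i\<in>{..n}. if i < k then T i (s i) else s i)" by blast
  obtain Y where Y: "Y \<in> bops K" "\<And>n s. \<lbrakk>k \<le> n; s \<in> tups n\<rbrakk> \<Longrightarrow> Y (\<Theta> n s) = \<Theta> n (slot k (T k) s)"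
    using single_site_operator[OF T] by blast
  have "mult_op K Y X (\<Theta> n s) = \<Theta> n (\<lambda>i\<in>{..n}. if i < Suc k then T i (s i) else s i)"
    if "Suc k \<le> Suc n" "s \<in> tups n" for n s
  proof -
    let ?s = "\<lambda>i\<in>{..n}. if i < k then T i (s i) else s i"
    have s: "?s \<in> tups n"
      using that by (intro tups_I) (simp add: hilbert_space.bopsD(1)[OF hilbert T] tups_D)
    have "slot k (T k) ?s = (\<lambda>i\<in>{..n}. if i < Suc k then T i (s i) else s i)"
      using that by (auto simp: slot_def fun_eq_iff less_Suc_eq)
    then show ?thesis
      using X(2)[of n s] Y(2)[of n ?s] that s by (simp add: K.mult_op_apply \<Theta>_closed)
  qed
  then show ?case using K.mult_op_closed[OF Y(1) X(1)] by blast
qed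

text \<open>Settles the definite description: existence by \<open>finite_sites_operator\<close> up
  to the end \<open>N\<close> of the support, uniqueness because the elementary vectors of levels
  from \<open>N\<close> on separate.\<close>

lemma tensor_op:
  assumes T: "\<And>i. T i \<in> bops (H i)" and fin: "finite {i. T i \<noteq> id_op (H i)}"
  shows tensor_op_closed: "tensor_op H \<phi> T \<in> bops K"
    and tensor_op_\<Theta>: "\<lbrakk>\<forall>i>n. T i = id_op (H i); s \<in> tups n\<rbrakk> \<Longrightarrow>
      tensor_op H \<phi> T (\<Theta> n s) = \<Theta> n (\<lambda>i\<in>{..n}. T i (s i))"
proof -
  define N where "N = Max (insert 0 {i. T i \<noteq> id_op (H i)})"
  have N: "T i = id_op (H i)" if "i > N" for i
    using that fin Max_ge[of "insert 0 {i. T i \<noteq> id_op (H i)}" i] unfolding N_def by (auto simp: not_less)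
  obtain X where X: "X \<in> bops K" "\<And>n s. \<lbrakk>Suc N \<le> Suc n; s \<in> tups n\<rbrakk> \<Longrightarrow>
    X (\<Theta> n s) = \<Theta> n (\<lambda>i\<in>{..n}. if i < Suc N then T i (s i) else s i)"
    using finite_sites_operator[OF T, of "Suc N"] by blast
  have X_\<Theta>: "X (\<Theta> n s) = \<Theta> n (\<lambda>i\<in>{..n}. T i (s i))" if "N \<le> n" "s \<in> tups n" for n s
  proof -
    have "(\<lambda>i\<in>{..n}. if i < Suc N then T i (s i) else s i) = (\<lambda>i\<in>{..n}. T i (s i))"
      using that N by (auto simp: fun_eq_iff id_op_def tups_D)
    then show ?thesis using X(2) that by simp
  qed
  have spec: "X (\<Theta> n s) = \<Theta> n (\<lambda>i\<in>{..n}. T i (s i))"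
    if n: "\<forall>i>n. T i = id_op (H i)" and s: "s \<in> tups n" for n s
  proof -
    let ?M = "max n N"
    have s': "(\<lambda>i\<in>{..n}. T i (s i)) \<in> tups n"
      using s by (intro tups_I) (simp add: hilbert_space.bopsD(1)[OF hilbert T] tups_D)
    have "(\<lambda>i\<in>{..?M}. T i (extend n ?M s i)) = extend n ?M (\<lambda>i\<in>{..n}. T i (s i))"
      using n by (auto simp: extend_def fun_eq_iff id_op_def \<phi>_closed)
    then show ?thesis
      using X_\<Theta>[OF _ extend_closed[OF s], of ?M] s s' by (simp add: \<Theta>_extend)
  qed
  have "tensor_op H \<phi> T = X"
    unfolding tensor_op_def elem_vec_def[symmetric]
  proof (rule the_equality)
    fix Y assume Y0: "Y \<in> bops K \<and> (\<forall>n. (\<forall>i>n. T i = id_op (H i)) \<longrightarrow>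
      (\<forall>s\<in>tups n. Y (\<Theta> n s) = \<Theta> n (\<lambda>i\<in>{..n}. T i (s i))))"
    then have Y_\<Theta>: "Y (\<Theta> n s) = \<Theta> n (\<lambda>i\<in>{..n}. T i (s i))"
      if "\<forall>i>n. T i = id_op (H i)" "s \<in> tups n" for n s
      using that by blast
    show "Y = X"
    proof (rule bops_eq_on_\<Theta>[OF _ X(1)])
      fix n s assume "N \<le> n" "s \<in> tups n"
      then show "Y (\<Theta> n s) = X (\<Theta> n s)" using N by (simp add: Y_\<Theta> spec)
    qed (use Y0 in blast)
  qed (use X(1) spec in blast)
  then show "tensor_op H \<phi> T \<in> bops K"
    "\<lbrakk>\<forall>i>n. T i = id_op (H i); s \<in> tups n\<rbrakk> \<Longrightarrow>
      tensor_op H \<phi> T (\<Theta> n s) = \<Theta> n (\<lambda>i\<in>{..n}. T i (s i))"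
    using X(1) spec by auto
qed

end


section \<open>Automorphisms of the von Neumann tensor product\<close>

text \<open>From index \<open>n\<close> on the partial products decrease, with a limit of at least
  \<delta> and hence non-zero. The later factors are quotients of consecutive partial
  products.\<close>

lemma factors_tendsto_one:
  fixes d :: "nat \<Rightarrow> real"
  assumes nonneg: "\<And>i. 0 \<le> d i" and le_1: "\<And>i. n < i \<Longrightarrow> d i \<le> 1"
    and \<delta>: "0 < \<delta>" "\<And>N. n \<le> N \<Longrightarrow> \<delta> \<le> (\<Prod>i\<le>N. d i)"
  shows "d \<longlonglongrightarrow> 1"
proof -
  define Q where "Q k = (\<Prod>i\<le>k + n. d i)" for k
  have Q_Suc: "Q (Suc k) = Q k * d (k + Suc n)" for k
    by (simp add: Q_def)
  have Q_ge: "\<delta> \<le> Q k" for k unfolding Q_def by (rule \<delta>) simp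
  have "decseq Q"
  proof (rule decseq_SucI)
    fix k
    have "0 \<le> Q k" using Q_ge[of k] \<delta>(1) by simp
    then show "Q (Suc k) \<le> Q k" unfolding Q_Suc using le_1[of "k + Suc n"] by (simp add: mult_left_le)
  qed
  then obtain l where l: "Q \<longlonglongrightarrow> l" using decseq_convergent[of Q \<delta>] Q_ge by metis
  have "\<delta> \<le> l" using l by (rule LIMSEQ_le_const) (use Q_ge in auto)
  then have "(\<lambda>k. Q (Suc k) / Q k) \<longlonglongrightarrow> l / l"
    using \<delta>(1) by (intro tendsto_divide LIMSEQ_Suc l) auto
  moreover have "Q (Suc k) / Q k = d (k + Suc n)" for k
    using Q_ge[of k] \<delta>(1) by (simp add: Q_Suc)
  ultimately have "(\<lambda>k. d (k + Suc n)) \<longlonglongrightarrow> 1" using \<open>\<delta> \<le> l\<close> \<delta>(1) by simp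
  then show ?thesis by (rule LIMSEQ_offset)
qed

context tensor_family
begin

abbreviation R where "R i \<equiv> hilbert_space.rank_one (H i)"

text \<open>For a unit vector \<open>w m\<close>, the projection onto its line at site
  \<open>m\<close>. The family \<open>w\<close> and the test \<open>i \<in> {m}\<close> give it
  literally the shape treated in \<open>is_alg_tensor_action\<close> with
  \<open>J = {m}\<close>.\<close>

definition site :: "nat \<Rightarrow> (nat \<Rightarrow> 'a) \<Rightarrow> 'a itensor \<Rightarrow> 'a itensor" where
  "site m w = tensor_op H \<phi> (\<lambda>i. if i \<in> {m} then R i (w i) else id_op (H i))"

lemma R_closed: "w \<in> vecs (H i) \<Longrightarrow> R i w \<in> bops (H i)"
  by (rule hilbert_space.rank_one_closed[OF hilbert])

lemma R_apply: "x \<in> vecs (H i) \<Longrightarrow> R i w x = vscale (H i) (ip (H i) x w) w"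
  by (simp add: hilbert_space.rank_one_def[OF hilbert])

lemma site_ops: "w m \<in> vecs (H m) \<Longrightarrow> (if i \<in> {m} then R i (w i) else id_op (H i)) \<in> bops (H i)"
  by (auto simp: R_closed hilbert_space.id_op_closed[OF hilbert])

lemma site_support: "finite {i. (if i \<in> {m} then R i (w i) else id_op (H i)) \<noteq> id_op (H i)}"
  by (rule finite_subset[of _ "{m}"]) auto

lemma site_closed: "w m \<in> vecs (H m) \<Longrightarrow> site m w \<in> bops K"
  unfolding site_def by (intro tensor_op_closed site_ops site_support)

lemma site_\<Theta>:
  assumes "w m \<in> vecs (H m)" "m \<le> n" "s \<in> tups n"
  shows "site m w (\<Theta> n s) = \<Theta> n (slot m (R m (w m)) s)"
proof -
  have "(\<lambda>i\<in>{..n}. (if i \<in> {m} then R i (w i) else id_op (H i)) (s i)) = slot m (R m (w m)) s"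
    using assms by (auto simp: slot_def fun_eq_iff id_op_def tups_D tuples_def PiE_iff extensional_def)
  then show ?thesis
    unfolding site_def using assms tensor_op_\<Theta>[OF site_ops[of w m] site_support[of m w], of n s] by auto
qed

text \<open>Comparing matrix entries identifies \<open>site m w\<close> with its adjoint, since
  \<open>rank_one\<close> is symmetric in the slot \<open>m\<close>.\<close>

lemma site_symmetric:
  assumes w: "w m \<in> vecs (H m)" and x: "x \<in> vecs K" and y: "y \<in> vecs K"
  shows "ip K (site m w x) y = ip K x (site m w y)"
proof -
  note e = site_closed[of w m, OF w]
  have slot: "slot m (R m (w m)) s \<in> tups n" if "m \<le> n" "s \<in> tups n" for n s
    using R_closed[OF w] that by (rule slot_closed)
  have sym: "ip K (site m w (\<Theta> n s)) (\<Theta> n t) = ip K (\<Theta> n s) (site m w (\<Theta> n t))"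
    if "m \<le> n" "s \<in> tups n" "t \<in> tups n" for n s t
    using that w hilbert_space.ip_rank_one[OF hilbert, of "s m" m "t m" "w m"]
    by (simp add: site_\<Theta> ip_\<Theta> slot tups_D) (auto simp: slot_def intro!: prod.cong)
  have "adjoint K (site m w) = site m w"
  proof (rule bops_eq_by_matrix[OF K.adjoint_closed[OF e] e])
    fix n s t assume n: "m \<le> n" and s: "s \<in> tups n" and t: "t \<in> tups n"
    note cl = \<Theta>_closed[OF s] \<Theta>_closed[OF t]
    have "ip K (adjoint K (site m w) (\<Theta> n s)) (\<Theta> n t) = cnj (ip K (\<Theta> n t) (adjoint K (site m w) (\<Theta> n s)))"
      using cl K.bopsD(1)[OF K.adjoint_closed[OF e]] by (intro K.ip_cnj) auto
    also have "\<dots> = cnj (ip K (\<Theta> n t) (site m w (\<Theta> n s)))"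
      using K.ip_adjoint[OF e cl(2,1)] sym[OF n t s] by simp
    also have "\<dots> = ip K (site m w (\<Theta> n s)) (\<Theta> n t)"
      using cl K.bopsD(1)[OF e] by (intro K.ip_cnj[symmetric]) auto
    finally show "ip K (adjoint K (site m w) (\<Theta> n s)) (\<Theta> n t) = ip K (site m w (\<Theta> n s)) (\<Theta> n t)" .
  qed
  then show ?thesis using K.ip_adjoint[OF e x y] by simp
qed

definition \<Omega> where "\<Omega> = \<Theta> 0 (\<lambda>i\<in>{..0}. \<phi> i)"

lemma \<phi>_tups: "(\<lambda>i\<in>{..n}. \<phi> i) \<in> tups n"
  by (intro tups_I \<phi>_closed)

lemma \<Theta>_\<phi>: "\<Theta> n (\<lambda>i\<in>{..n}. \<phi> i) = \<Omega>"
proof -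
  have "extend 0 n (\<lambda>i\<in>{..0}. \<phi> i) = (\<lambda>i\<in>{..n}. \<phi> i)" by (auto simp: extend_def fun_eq_iff)
  then show ?thesis using \<Theta>_extend[OF _ \<phi>_tups, of 0 n] by (simp add: \<Omega>_def)
qed

lemma \<Omega>_closed: "\<Omega> \<in> vecs K"
  unfolding \<Omega>_def by (intro \<Theta>_closed \<phi>_tups)

lemma ip_\<Omega>: "ip K \<Omega> \<Omega> = 1"
  unfolding \<Omega>_def ip_\<Theta>[OF \<phi>_tups \<phi>_tups] by (simp add: ip_\<phi>)

lemma site_\<Omega>: "site m \<phi> \<Omega> = \<Omega>"
proof -
  interpret Hm: hilbert_space "H m" by (rule hilbert)
  have "slot m (R m (\<phi> m)) (\<lambda>i\<in>{..m}. \<phi> i) = (\<lambda>i\<in>{..m}. \<phi> i)"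
    by (auto simp: slot_def fun_eq_iff R_apply \<phi>_closed ip_\<phi> Hm.scale_one)
  then show ?thesis
    using site_\<Theta>[of \<phi> m m "\<lambda>i\<in>{..m}. \<phi> i"] by (simp add: \<phi>_closed \<phi>_tups \<Theta>_\<phi>)
qed

text \<open>Entries beyond \<open>n\<close> are the reference vectors and contribute the factor 1,
  so at level \<open>n\<close> finitely many slotwise projections do the work.\<close>

lemma rank_one_\<Omega>_\<Theta>:
  assumes s: "s \<in> tups n"
  shows "K.rank_one \<Omega> (\<Theta> n s) = \<Theta> n (\<lambda>i\<in>{..n}. R i (\<phi> i) (s i))"
proof -
  have "(\<lambda>i\<in>{..n}. R i (\<phi> i) (s i)) =
      (\<lambda>i\<in>{..n}. vscale (H i) (ip (H i) (s i) (\<phi> i)) ((\<lambda>i\<in>{..n}. \<phi> i) i))"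
    using s by (auto simp: fun_eq_iff R_apply tups_D)
  then have "\<Theta> n (\<lambda>i\<in>{..n}. R i (\<phi> i) (s i)) = vscale K (\<Prod>i\<le>n. ip (H i) (s i) (\<phi> i)) \<Omega>"
    using \<Theta>_scale[OF \<phi>_tups, of n "\<lambda>i. ip (H i) (s i) (\<phi> i)"] by (simp add: \<Theta>_\<phi>)
  moreover have "ip K (\<Theta> n s) \<Omega> = (\<Prod>i\<le>n. ip (H i) (s i) (\<phi> i))"
    using ip_\<Theta>[OF s \<phi>_tups] by (simp add: \<Theta>_\<phi>)
  ultimately show ?thesis using s by (simp add: K.rank_one_def \<Theta>_closed)
qed

text \<open>On vectors of level \<open>n\<close> the rank one projection acts as the product of the site projections
  up to \<open>n\<close>; these are moved one at a time across the inner product.\<close>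

lemma commutes_with_rank_one:
  assumes T: "T \<in> bops K" and comm: "\<And>m. mult_op K T (site m \<phi>) = mult_op K (site m \<phi>) T"
  shows "mult_op K T (K.rank_one \<Omega>) = mult_op K (K.rank_one \<Omega>) T"
proof (rule bops_eq_by_matrix)
  note p = K.rank_one_closed[OF \<Omega>_closed]
  show "mult_op K T (K.rank_one \<Omega>) \<in> bops K" "mult_op K (K.rank_one \<Omega>) T \<in> bops K"
    using T p by (auto intro: K.mult_op_closed)
  fix n s t assume s: "s \<in> tups n" and t: "t \<in> tups n"
  \<comment> \<open>At stage \<open>k\<close> the slots below \<open>k\<close> are projected on the
    left and the others on the right. At stage 0 all projections sit on the right, at stage
    \<open>Suc n\<close> on the left.\<close>
  define lo where "lo k = (\<lambda>i\<in>{..n}. if i < k then R i (\<phi> i) (s i) else s i)" for k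
  define hi where "hi k = (\<lambda>i\<in>{..n}. if k \<le> i then R i (\<phi> i) (t i) else t i)" for k
  have R_vec: "R i (\<phi> i) x \<in> vecs (H i)" if "x \<in> vecs (H i)" for i x
    using hilbert_space.bopsD(1)[OF hilbert R_closed[OF \<phi>_closed] that] .
  have lo: "lo k \<in> tups n" for k unfolding lo_def using s by (intro tups_I) (simp add: R_vec tups_D)
  have hi: "hi k \<in> tups n" for k unfolding hi_def using t by (intro tups_I) (simp add: R_vec tups_D)
  have swap: "T (site m \<phi> x) = site m \<phi> (T x)" if "x \<in> vecs K" for m x
    using fun_cong[OF comm[of m], of x] that by (simp add: K.mult_op_apply)
  have step: "ip K (T (\<Theta> n (lo (Suc k)))) (\<Theta> n (hi (Suc k))) = ip K (T (\<Theta> n (lo k))) (\<Theta> n (hi k))"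
    if k: "k \<le> n" for k
  proof -
    have "lo (Suc k) = slot k (R k (\<phi> k)) (lo k)"
      using k by (auto simp: lo_def slot_def fun_eq_iff less_Suc_eq)
    then have "ip K (T (\<Theta> n (lo (Suc k)))) (\<Theta> n (hi (Suc k))) =
        ip K (T (site k \<phi> (\<Theta> n (lo k)))) (\<Theta> n (hi (Suc k)))"
      using k lo by (simp add: site_\<Theta> \<phi>_closed)
    also have "\<dots> = ip K (T (\<Theta> n (lo k))) (site k \<phi> (\<Theta> n (hi (Suc k))))"
      using lo hi T by (simp add: swap \<Theta>_closed site_symmetric \<phi>_closed K.bopsD(1))
    also have "site k \<phi> (\<Theta> n (hi (Suc k))) = \<Theta> n (slot k (R k (\<phi> k)) (hi (Suc k)))"
      using k hi by (simp add: site_\<Theta> \<phi>_closed)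
    also have "slot k (R k (\<phi> k)) (hi (Suc k)) = hi k"
      using k by (auto simp: hi_def slot_def fun_eq_iff Suc_le_eq)
    finally show ?thesis .
  qed
  have all: "ip K (T (\<Theta> n (lo k))) (\<Theta> n (hi k)) = ip K (T (\<Theta> n (lo 0))) (\<Theta> n (hi 0))" if "k \<le> Suc n" for k
    using that by (induction k) (auto simp: step)
  have "lo 0 = (\<lambda>i\<in>{..n}. s i)" "hi (Suc n) = (\<lambda>i\<in>{..n}. t i)"
    "lo (Suc n) = (\<lambda>i\<in>{..n}. R i (\<phi> i) (s i))" "hi 0 = (\<lambda>i\<in>{..n}. R i (\<phi> i) (t i))"
    by (auto simp: lo_def hi_def fun_eq_iff)
  then have ends: "lo 0 = s" "hi (Suc n) = t" "\<Theta> n (lo (Suc n)) = K.rank_one \<Omega> (\<Theta> n s)"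
    "\<Theta> n (hi 0) = K.rank_one \<Omega> (\<Theta> n t)"
    using s t by (simp_all only: rank_one_\<Omega>_\<Theta> tups_extensional)
  have "ip K (T (K.rank_one \<Omega> (\<Theta> n s))) (\<Theta> n t) = ip K (T (\<Theta> n s)) (K.rank_one \<Omega> (\<Theta> n t))"
    using all[of "Suc n"] by (simp add: ends)
  also have "\<dots> = ip K (K.rank_one \<Omega> (T (\<Theta> n s))) (\<Theta> n t)"
    using s t T by (simp add: K.ip_rank_one \<Omega>_closed \<Theta>_closed K.bopsD(1))
  finally show "ip K (mult_op K T (K.rank_one \<Omega>) (\<Theta> n s)) (\<Theta> n t) =
      ip K (mult_op K (K.rank_one \<Omega>) T (\<Theta> n s)) (\<Theta> n t)"
    using s by (simp add: K.mult_op_apply \<Theta>_closed)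
qed

section \<open>Elements of the von Neumann tensor product and their images under
  automorphisms\<close>

abbreviation M where "M \<equiv> vn_tensor H \<phi> (\<lambda>i. bops (H i))"

lemma elem_ops_subset: "elem_ops H \<phi> (\<lambda>i. bops (H i)) \<subseteq> bops K"
  by (auto simp: elem_ops_def tensor_op_closed)

lemma vn_tensor_subset: "M \<subseteq> bops K"
  unfolding vn_tensor_def by (intro hull_minimal elem_ops_subset K.von_neumann_algebra_bops)

lemma site_in_elem_ops: "w m \<in> vecs (H m) \<Longrightarrow> site m w \<in> elem_ops H \<phi> (\<lambda>i. bops (H i))"
  unfolding elem_ops_def site_def using site_ops[of w m] site_support[of m w] by blast

lemma site_in_vn_tensor: "w m \<in> vecs (H m) \<Longrightarrow> site m w \<in> M"
  unfolding vn_tensor_def by (rule subsetD[OF hull_subset site_in_elem_ops])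

text \<open>Membership is tested in each algebra \<open>A\<close> of the intersection. Whatever
  commutes with \<open>A\<close> commutes with the site projections, hence with \<open>X\<close>, so
  \<open>X\<close> lies in the double commutant of \<open>A\<close>.\<close>

lemma vn_tensor_intersection:
  assumes X: "X \<in> bops K"
    and comm: "\<And>T. \<lbrakk>T \<in> bops K; \<And>m. mult_op K T (site m \<phi>) = mult_op K (site m \<phi>) T\<rbrakk>
      \<Longrightarrow> mult_op K T X = mult_op K X T"
  shows "X \<in> M"
  unfolding vn_tensor_def hull_def
proof (intro InterI, elim CollectE conjE)
  fix A assume A: "von_neumann_algebra K A" "elem_ops H \<phi> (\<lambda>i. bops (H i)) \<subseteq> A"
  have "X \<in> commutant K (commutant K A)"
    unfolding commutant_def[of K "commutant K A"]
  proof (intro CollectI conjI ballI X)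
    fix T assume T: "T \<in> commutant K A"
    have "site m \<phi> \<in> A" for m using A(2) site_in_elem_ops \<phi>_closed by blast
    then show "mult_op K X T = mult_op K T X"
      using T by (intro comm[symmetric]) (auto simp: commutant_def)
  qed
  then show "X \<in> A" using A(1) by (simp add: von_neumann_algebra_def)
qed

lemma rank_one_\<Omega>_in_vn_tensor: "K.rank_one \<Omega> \<in> M"
  by (intro vn_tensor_intersection K.rank_one_closed \<Omega>_closed commutes_with_rank_one)

lemma scale_op_zero: "T \<in> bops K \<Longrightarrow> scale_op K 0 T = zero_op K"
  by (auto simp: scale_op_def zero_op_def fun_eq_iff K.scale_zero K.bopsD(1))

text \<open>An automorphism is constrained only on \<open>M\<close>, so zero has to be located there
  before its image can be computed.\<close>

lemma zero_op_in_vn_tensor: "zero_op K \<in> M"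
proof (rule vn_tensor_intersection[OF K.zero_op_closed])
  fix T assume T: "T \<in> bops K"
  then have "T (vzero K) = vzero K"
    using K.bopsD(3)[OF T K.zero_closed, of 0] K.scale_zero K.zero_closed by (simp add: K.bopsD(1))
  then show "mult_op K T (zero_op K) = mult_op K (zero_op K) T"
    using T by (intro K.bops_eqI K.mult_op_closed K.zero_op_closed)
      (auto simp: K.mult_op_apply zero_op_def K.bopsD(1))
qed

text \<open>Any non-zero value of the operator \<open>\<theta> ?p\<close> serves: multiplicativity
  gives \<open>site m w\<close> times \<open>\<theta> ?p\<close> equal to \<open>\<theta> ?p\<close>
  for every \<open>m\<close>, and injectivity keeps \<open>\<theta> ?p\<close> away from
  zero.\<close>

lemma automorphism_fixed_vector:
  assumes \<theta>: "star_automorphism K M \<theta>" and w: "\<And>i. w i \<in> vecs (H i)"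
    and \<theta>_site: "\<And>m. \<theta> (site m \<phi>) = site m w"
  obtains \<xi> where "\<xi> \<in> vecs K" "\<xi> \<noteq> vzero K" "\<And>m. site m w \<xi> = \<xi>"
proof -
  let ?p = "K.rank_one \<Omega>"
  have mult: "\<theta> (mult_op K S T) = mult_op K (\<theta> S) (\<theta> T)" if "S \<in> M" "T \<in> M" for S T
    using \<theta> that unfolding star_automorphism_def by blast
  have mem: "\<theta> T \<in> bops K" if "T \<in> M" for T
    using \<theta> that vn_tensor_subset unfolding star_automorphism_def bij_betw_def by blast
  have inj: "inj_on \<theta> M" using \<theta> unfolding star_automorphism_def bij_betw_def by blast
  note p = rank_one_\<Omega>_in_vn_tensor and z = zero_op_in_vn_tensor
  have "?p \<Omega> = \<Omega>" by (simp add: K.rank_one_def \<Omega>_closed ip_\<Omega> K.scale_one)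
  moreover have "\<Omega> \<noteq> vzero K" using ip_\<Omega> K.ip_zero_left[OF \<Omega>_closed] by auto
  ultimately have "?p \<noteq> zero_op K" using \<Omega>_closed by (auto simp: zero_op_def)
  then have "\<theta> ?p \<noteq> \<theta> (zero_op K)" using inj p z by (auto dest: inj_onD)
  moreover have "\<theta> (zero_op K) = zero_op K"
  proof -
    \<comment> \<open>Zero is 0 times itself, so homogeneity sends it to 0 times an
      operator.\<close>
    have "\<theta> (scale_op K 0 (zero_op K)) = scale_op K 0 (\<theta> (zero_op K))"
      using \<theta> z unfolding star_automorphism_def by blast
    then show ?thesis using mem[OF z] K.zero_op_closed by (simp add: scale_op_zero)
  qed
  ultimately obtain x where x: "x \<in> vecs K" "\<theta> ?p x \<noteq> vzero K"
    using K.bops_eqI[OF mem[OF p] K.zero_op_closed] by (auto simp: zero_op_def)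
  have "mult_op K (site m \<phi>) ?p = ?p" for m
  proof (rule K.bops_eqI)
    fix y assume y: "y \<in> vecs K"
    then show "mult_op K (site m \<phi>) ?p y = ?p y"
      using K.bopsD(3)[OF site_closed[of \<phi> m, OF \<phi>_closed] \<Omega>_closed] \<Omega>_closed
      by (simp add: K.mult_op_apply K.rank_one_def site_\<Omega>)
  qed (auto intro: K.mult_op_closed site_closed \<phi>_closed K.rank_one_closed \<Omega>_closed)
  then have "mult_op K (site m w) (\<theta> ?p) = \<theta> ?p" for m
    using mult[OF site_in_vn_tensor p, of \<phi> m] \<phi>_closed \<theta>_site by simp
  then have "site m w (\<theta> ?p x) = \<theta> ?p x" for m
    using x(1) by (metis K.mult_op_apply)
  then show ?thesis using that x K.bopsD(1)[OF mem[OF p]] by blast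
qed

lemma overlap_tendsto_one:
  assumes w: "\<And>i. w i \<in> vecs (H i)" "\<And>i. vnorm (H i) (w i) = 1"
    and \<xi>: "\<xi> \<in> vecs K" "\<xi> \<noteq> vzero K" "\<And>m. site m w \<xi> = \<xi>"
  shows "(\<lambda>i. cmod (ip (H i) (\<phi> i) (w i))) \<longlonglongrightarrow> 1"
proof -
  obtain n s where s: "s \<in> tups n" "ip K \<xi> (\<Theta> n s) \<noteq> 0"
    using \<Theta>_separating[OF \<xi>(1), of 0] \<xi>(2) by auto
  let ?c = "\<lambda>i. cmod (ip (H i) (\<phi> i) (w i))"
  \<comment> \<open>\<open>d i\<close> is the norm of entry \<open>i\<close> of the final tuple
    \<open>t N\<close> below. The entries up to \<open>n\<close> are arbitrary, so only the later
    factors are known to be at most 1.\<close>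
  define d where "d i = (if i \<le> n then vnorm (H i) (s i) else ?c i)" for i
  have R_vec: "R i (w i) x \<in> vecs (H i)" if "x \<in> vecs (H i)" for i x
    using hilbert_space.bopsD(1)[OF hilbert R_closed[OF w(1)] that] .
  have bound: "cmod (ip K \<xi> (\<Theta> n s)) \<le> vnorm K \<xi> * (\<Prod>i\<le>N. d i)" if N: "n \<le> N" for N
  proof -
    \<comment> \<open>The slots \<open>n + 1, ..., k\<close> have been projected. Each projection
      can be moved onto \<xi>, which it fixes, so the inner product stays the same while the norm of
      the tensor acquires one more overlap.\<close>
    define t where "t k = (\<lambda>i\<in>{..N}. if i \<le> n then s i else if i \<le> k then R i (w i) (\<phi> i) else \<phi> i)" for k
    have t: "t k \<in> tups N" for k
      unfolding t_def using s by (intro tups_I) (simp add: R_vec tups_D \<phi>_closed)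
    have "ip K \<xi> (\<Theta> N (t k)) = ip K \<xi> (\<Theta> n s)" if "n \<le> k" "k \<le> N" for k
      using that
    proof (induction k rule: dec_induct)
      case base
      have "t n = extend n N s" by (auto simp: t_def extend_def fun_eq_iff)
      then show ?case using \<Theta>_extend[OF N s(1)] by simp
    next
      case (step k)
      have "t (Suc k) = slot (Suc k) (R (Suc k) (w (Suc k))) (t k)"
        using step by (auto simp: t_def slot_def fun_eq_iff le_Suc_eq)
      then have "ip K \<xi> (\<Theta> N (t (Suc k))) = ip K \<xi> (site (Suc k) w (\<Theta> N (t k)))"
        using step t w by (simp add: site_\<Theta>)
      also have "\<dots> = ip K \<xi> (\<Theta> N (t k))"
        using site_symmetric[of w "Suc k", OF w(1) \<xi>(1) \<Theta>_closed[OF t[of k]]] \<xi>(3)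
        by simp
      finally show ?case using step by simp
    qed
    then have "cmod (ip K \<xi> (\<Theta> n s)) \<le> vnorm K \<xi> * vnorm K (\<Theta> N (t N))"
      using K.cauchy_schwarz[OF \<xi>(1) \<Theta>_closed[OF t[of N]]] N by simp
    also have "vnorm K (\<Theta> N (t N)) = (\<Prod>i\<le>N. d i)"
      unfolding norm_\<Theta>[OF t]
      by (intro prod.cong) (auto simp: t_def d_def R_apply \<phi>_closed w hilbert_space.norm_scale[OF hilbert])
    finally show ?thesis .
  qed
  have norm_\<xi>: "0 < vnorm K \<xi>"
  proof (rule ccontr)
    assume "\<not> 0 < vnorm K \<xi>"
    then have "cmod (ip K \<xi> (\<Theta> n s)) \<le> 0"
      using bound[of n] K.norm_nonneg[OF \<xi>(1)] by (simp add: order_antisym_conv)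
    then show False using s(2) by simp
  qed
  have "d \<longlonglongrightarrow> 1"
  proof (rule factors_tendsto_one[where n = n and \<delta> = "cmod (ip K \<xi> (\<Theta> n s)) / vnorm K \<xi>"])
    fix i show "0 \<le> d i"
      using hilbert_space.norm_nonneg[OF hilbert tups_D[OF s(1)]] by (simp add: d_def)
    show "d i \<le> 1" if "n < i"
      using that hilbert_space.cauchy_schwarz[OF hilbert \<phi>_closed w(1), of i]
      by (simp add: d_def \<phi>_norm w)
  qed (use bound norm_\<xi> s(2) in \<open>simp_all add: divide_le_eq mult.commute\<close>)
  moreover have "\<forall>\<^sub>F i in sequentially. d i = ?c i"
    using eventually_gt_at_top[of n] by eventually_elim (simp add: d_def)
  ultimately show ?thesis by (rule Lim_transform_eventually)
qed

end


section \<open>Cocycles\<close>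

text \<open>The value 1 at 0 keeps phases on the circle even where an overlap vanishes.\<close>

definition phase :: "complex \<Rightarrow> complex" where
  "phase z = (if z = 0 then 1 else sgn z)"

lemma cmod_phase [simp]: "cmod (phase z) = 1"
  by (simp add: phase_def norm_sgn)

lemma phase_mult_cmod: "phase z * of_real (cmod z) = z"
  by (simp add: phase_def sgn_eq)

lemma cmod_diff_phase: "cmod z \<le> 1 \<Longrightarrow> cmod (z - phase z) = 1 - cmod z"
proof -
  assume "cmod z \<le> 1"
  have "z - phase z = phase z * of_real (cmod z - 1)"
    using phase_mult_cmod[of z] by (simp add: algebra_simps)
  then show ?thesis using \<open>cmod z \<le> 1\<close> by (simp add: norm_mult del: of_real_diff)
qed

lemma unit_mult_cnj: "cmod z = 1 \<Longrightarrow> z * cnj z = 1"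
  by (simp add: complex_norm_square[symmetric])

text \<open>Both sides of \<open>u (g, h) * z (g \<otimes> h) = \<langle>U g (U h f),
  f\<rangle>\<close> are simplified. Replacing \<open>U h f\<close> by \<open>phase (z h)\<close>
  times \<open>f\<close> yields \<open>phase (z h) * z g\<close> and costs the square root;
  replacing \<open>z (g \<otimes> h)\<close> and \<open>z g\<close> by their phases costs the other
  two terms.\<close>

lemma (in hilbert_space) cocycle_near_coboundary:
  fixes G (structure)
  assumes G: "group G" and U: "projective_rep G H u U" and f: "f \<in> vecs H" "vnorm H f = 1"
    and g: "g \<in> carrier G" and h: "h \<in> carrier G"
  defines "z \<equiv> \<lambda>g. ip H (U g f) f"
  shows "cmod (u (g, h) - phase (z g) * phase (z h) * cnj (phase (z (g \<otimes> h))))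
    \<le> (1 - cmod (z (g \<otimes> h))) + (1 - cmod (z g)) + sqrt (2 * (1 - cmod (z h)))"
proof -
  interpret group G by (rule G)
  have gh: "g \<otimes> h \<in> carrier G" using g h by simp
  have un: "U k \<in> unitaries H" if "k \<in> carrier G" for k
    using U that by (auto simp: projective_rep_def)
  then have bo: "U k \<in> bops H" if "k \<in> carrier G" for k using that by (auto simp: unitaries_def)
  have Uv: "U k x \<in> vecs H" if "k \<in> carrier G" "x \<in> vecs H" for k x
    using bo that by (simp add: bopsD(1))
  have norm_U: "vnorm H (U k x) = vnorm H x" if "k \<in> carrier G" "x \<in> vecs H" for k x
    using un that by (simp add: vnorm_def unitary_ip)
  have u1: "cmod (u (g, h)) = 1" using U g h by (auto simp: projective_rep_def Z2_def)
  have z_le: "cmod (z k) \<le> 1" if "k \<in> carrier G" for k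
    using cauchy_schwarz[of "U k f" f] that f Uv norm_U by (simp add: z_def)
  have eq: "U g (U h f) = vscale H (u (g, h)) (U (g \<otimes> h) f)"
  proof -
    have "mult_op H (U g) (U h) = scale_op H (u (g, h)) (U (g \<otimes> h))"
      using U g h by (auto simp: projective_rep_def)
    from fun_cong[OF this, of f] show ?thesis using f by (simp add: mult_op_apply scale_op_def)
  qed
  \<comment> \<open>The error of replacing \<open>U h f\<close>. Its squared norm is
    \<open>2 - 2 * cmod (z h)\<close>, because the phase makes the cross terms real.\<close>
  let ?r = "diff (U h f) (vscale H (phase (z h)) f)"
  have r: "?r \<in> vecs H" using f h Uv by (intro diff_closed scale_closed) auto
  have "ip H ?r ?r = ip H (U h f) (U h f) - cnj (phase (z h)) * z h - phase (z h) * cnj (z h)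
      + phase (z h) * cnj (phase (z h)) * ip H f f"
    using f h Uv ip_cnj[of "U h f" f]
    by (simp add: z_def ip_diff_left ip_diff_right ip_scale ip_scale_right scale_closed diff_closed algebra_simps)
  also have "ip H (U h f) (U h f) = 1" using un[OF h] f by (simp add: unitary_ip ip_self)
  also have "ip H f f = 1" using f by (simp add: ip_self)
  also have "phase (z h) * cnj (phase (z h)) = 1" by (rule unit_mult_cnj) simp
  also have "cnj (phase (z h)) * z h = of_real (cmod (z h))"
  proof -
    have "cnj (phase (z h)) * z h = (phase (z h) * cnj (phase (z h))) * of_real (cmod (z h))"
      by (subst (2) phase_mult_cmod[symmetric]) (simp add: mult_ac)
    then show ?thesis by (simp add: unit_mult_cnj)
  qed
  also have "phase (z h) * cnj (z h) = of_real (cmod (z h))"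
  proof -
    have "phase (z h) * cnj (z h) = (phase (z h) * cnj (phase (z h))) * of_real (cmod (z h))"
      by (subst (2) phase_mult_cmod[symmetric]) (simp add: mult_ac)
    then show ?thesis by (simp add: unit_mult_cnj)
  qed
  finally have norm_r: "vnorm H ?r = sqrt (2 * (1 - cmod (z h)))"
    by (simp add: vnorm_def)
  have "u (g, h) * z (g \<otimes> h) = ip H (U g (U h f)) f"
    using eq f Uv[OF gh f(1)] by (simp add: ip_scale z_def)
  also have "U h f = vadd H ?r (vscale H (phase (z h)) f)"
  proof (rule eq_by_ip)
    fix x assume "x \<in> vecs H"
    then show "ip H (U h f) x = ip H (vadd H ?r (vscale H (phase (z h)) f)) x"
      using f r h Uv by (simp add: ip_add ip_scale scale_closed)
  qed (use f r h Uv in \<open>auto intro: add_closed scale_closed\<close>)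
  also have "ip H (U g (vadd H ?r (vscale H (phase (z h)) f))) f = ip H (U g ?r) f + phase (z h) * z g"
    using r f g Uv bopsD(2)[OF bo[OF g] r scale_closed[OF f(1)]] bopsD(3)[OF bo[OF g] f(1)]
    by (simp add: ip_add ip_scale scale_closed z_def)
  finally have key: "u (g, h) * z (g \<otimes> h) = ip H (U g ?r) f + phase (z h) * z g" .
  have Ur: "cmod (ip H (U g ?r) f) \<le> sqrt (2 * (1 - cmod (z h)))"
    using cauchy_schwarz[OF Uv[OF g r] f(1)] norm_U[OF g r] norm_r f by simp
  let ?c = "phase (z (g \<otimes> h))"
  \<comment> \<open>Multiplying by the unit \<open>?c\<close> removes the conjugate and preserves
    the modulus.\<close>
  have "u (g, h) - phase (z g) * phase (z h) * cnj ?c = cnj ?c * (u (g, h) * ?c - phase (z g) * phase (z h))"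
    using unit_mult_cnj[of ?c] by (simp add: algebra_simps)
  then have "cmod (u (g, h) - phase (z g) * phase (z h) * cnj ?c) =
      cmod (u (g, h) * ?c - phase (z g) * phase (z h))" by (simp add: norm_mult)
  also have "u (g, h) * ?c - phase (z g) * phase (z h) =
      - (u (g, h) * (z (g \<otimes> h) - ?c)) + (phase (z h) * (z g - phase (z g)) + ip H (U g ?r) f)"
    using key by (simp add: algebra_simps)
  also have "cmod \<dots> \<le> cmod (u (g, h) * (z (g \<otimes> h) - ?c))
      + (cmod (phase (z h) * (z g - phase (z g))) + cmod (ip H (U g ?r) f))"
    by (metis norm_triangle_ineq norm_triangle_le norm_minus_cancel add_left_mono)
  also have "\<dots> \<le> (1 - cmod (z (g \<otimes> h))) + ((1 - cmod (z g)) + sqrt (2 * (1 - cmod (z h))))"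
    using Ur z_le g gh u1 by (simp add: norm_mult cmod_diff_phase)
  finally show ?thesis by (simp add: add.assoc)
qed

text \<open>\<open>B2 G\<close> is closed under pointwise convergence because the circle-valued functions on \<open>G\<close> form a
  compact space by Tychonoff's theorem.\<close>

lemma B2_closed:
  fixes G (structure) and \<sigma> :: "nat \<Rightarrow> 'g \<Rightarrow> complex"
  assumes G: "group G" and v: "v \<in> carrier (Z2 G)" and \<sigma>: "\<And>i g. cmod (\<sigma> i g) = 1"
    and lim: "\<And>g h. \<lbrakk>g \<in> carrier G; h \<in> carrier G\<rbrakk> \<Longrightarrow>
      (\<lambda>i. \<sigma> i g * \<sigma> i h * cnj (\<sigma> i (g \<otimes> h))) \<longlonglongrightarrow> v (g, h)"
  shows "v \<in> B2 G"
proof -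
  interpret group G by (rule G)
  define S :: "('g \<Rightarrow> complex) set" where "S = (\<Pi>\<^sub>E g\<in>UNIV. {z. cmod z = 1})"
  have "{z :: complex. cmod z = 1} = cis ` {- pi..pi}"
  proof (intro equalityI subsetI)
    fix z :: complex assume "z \<in> {z. cmod z = 1}"
    then have "z \<noteq> 0" "cmod z = 1" by auto
    then have "z = cis (Arg z)" using cis_Arg[of z] by (simp add: sgn_eq)
    then show "z \<in> cis ` {- pi..pi}" using Arg_bounded[of z] by force
  qed auto
  moreover have "compact (cis ` {- pi..pi})"
    by (intro compact_continuous_image compact_Icc continuous_intros)
  ultimately have "compact {z :: complex. cmod z = 1}" by simp
  then have "compactin (product_topology (\<lambda>_. euclidean) UNIV) S"
    unfolding S_def compactin_PiE by simp
  then have "compact S" by (simp add: euclidean_product_topology)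
  \<comment> \<open>A cluster point replaces a convergent subsequence, which need not exist for
    uncountable \<open>G\<close>. Limits are taken along the filter refining both
    \<open>nhds s\<close> and the image of the sequence.\<close>
  let ?F = "filtermap \<sigma> sequentially"
  have "?F \<noteq> bot" by (simp add: filtermap_bot_iff)
  moreover have "eventually (\<lambda>s. s \<in> S) ?F"
    using \<sigma> by (simp add: eventually_filtermap S_def PiE_UNIV_domain Pi_iff)
  ultimately obtain s where s: "s \<in> S" "inf (nhds s) ?F \<noteq> bot"
    using \<open>compact S\<close> unfolding compact_filter by blast
  have coord: "((\<lambda>t. t g) \<longlongrightarrow> s g) (nhds s)" for g
  proof -
    have "((\<lambda>t. t g) \<longlongrightarrow> s g) (at s)"
      using continuous_on_product_coordinates[of g] by (auto simp: continuous_on_def)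
    then show ?thesis using tendsto_at_iff_tendsto_nhds[of "\<lambda>t. t g" s] by simp
  qed
  have s_v: "s g * s h * cnj (s (g \<otimes> h)) = v (g, h)" if "g \<in> carrier G" "h \<in> carrier G" for g h
  proof (rule tendsto_unique[OF s(2)])
    show "((\<lambda>t. t g * t h * cnj (t (g \<otimes> h))) \<longlongrightarrow> s g * s h * cnj (s (g \<otimes> h))) (inf (nhds s) ?F)"
      by (rule tendsto_mono[OF inf_le1]) (intro tendsto_mult tendsto_cnj coord)
    show "((\<lambda>t. t g * t h * cnj (t (g \<otimes> h))) \<longlongrightarrow> v (g, h)) (inf (nhds s) ?F)"
      by (rule tendsto_mono[OF inf_le2]) (use lim[OF that] in \<open>simp add: filterlim_filtermap\<close>)
  qed
  have unit: "cmod (s g) = 1" for g using s(1) by (auto simp: S_def)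
  have "v = coboundary G s"
  proof
    fix p :: "'g \<times> 'g"
    show "v p = coboundary G s p"
      using v s_v by (cases p) (auto simp: coboundary_def Z2_def PiE_iff extensional_def)
  qed
  \<comment> \<open>At \<open>(\<one>, \<one>)\<close> the coboundary of a circle-valued
    \<open>s\<close> is \<open>s \<one>\<close> itself, and \<open>v\<close> is normalised.\<close>
  moreover have "s \<one> = 1"
  proof -
    have "v (\<one>, \<one>) = 1" using v by (auto simp: Z2_def)
    then show ?thesis using s_v[of \<one> \<one>] unit_mult_cnj[OF unit[of \<one>]] by (simp add: mult.assoc)
  qed
  ultimately show ?thesis unfolding B2_def using unit by auto
qed

text \<open>The constant 1 has trivial coboundary, so \<open>a\<close> lies in its own coset and
  therefore in that of \<open>b\<close>.\<close>

lemma cohomologousD: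
  fixes G (structure)
  assumes G: "group G" and a: "a \<in> carrier (Z2 G)" and eq: "cohomology_class G a = cohomology_class G b"
  shows "\<exists>\<rho>. (\<forall>g\<in>carrier G. cmod (\<rho> g) = 1) \<and>
    (\<forall>g\<in>carrier G. \<forall>h\<in>carrier G. a (g, h) = \<rho> g * \<rho> h * cnj (\<rho> (g \<otimes> h)) * b (g, h))"
proof -
  interpret group G by (rule G)
  let ?one = "coboundary G (\<lambda>_. 1)"
  have "?one \<in> B2 G" unfolding B2_def by auto
  moreover have "?one \<otimes>\<^bsub>Z2 G\<^esub> a = a"
    using a by (auto simp: Z2_def coboundary_def fun_eq_iff PiE_iff extensional_def)
  ultimately have "a \<in> cohomology_class G a"
    unfolding cohomology_class_def r_coset_def by (metis (no_types, lifting) UN_iff singletonI)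
  then obtain c where c: "c \<in> B2 G" "a = c \<otimes>\<^bsub>Z2 G\<^esub> b"
    unfolding eq unfolding cohomology_class_def r_coset_def by blast
  then obtain \<rho> where "c = coboundary G \<rho>" "\<rho> \<in> carrier G \<rightarrow> {z. cmod z = 1}"
    unfolding B2_def by blast
  then show ?thesis using c(2) by (intro exI[of _ \<rho>]) (auto simp: Z2_def coboundary_def)
qed

text \<open>The unit of the quotient is \<open>B2 G\<close>. Its coset by a coboundary is again
  \<open>B2 G\<close>, since coboundaries multiply pointwise and conjugating \<sigma> gives the
  inverse.\<close>

lemma cohomology_class_B2:
  fixes G (structure)
  assumes G: "group G" and v: "v \<in> B2 G"
  shows "cohomology_class G v = \<one>\<^bsub>H2 G\<^esub>"
proof -
  interpret group G by (rule G)
  obtain \<sigma> where \<sigma>: "v = coboundary G \<sigma>" "\<sigma> \<in> carrier G \<rightarrow> {z. cmod z = 1}" "\<sigma> \<one> = 1"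
    using v unfolding B2_def by blast
  have unit: "\<sigma> g * cnj (\<sigma> g) = 1" if "g \<in> carrier G" for g
    using \<sigma>(2) that by (intro unit_mult_cnj) auto
  have mult: "coboundary G \<rho> \<otimes>\<^bsub>Z2 G\<^esub> v = coboundary G (\<lambda>g. \<rho> g * \<sigma> g)" for \<rho>
    by (auto simp: \<sigma>(1) Z2_def coboundary_def fun_eq_iff)
  have cong: "coboundary G \<rho> = coboundary G \<rho>'" if "\<And>g. g \<in> carrier G \<Longrightarrow> \<rho> g = \<rho>' g" for \<rho> \<rho>'
    using that by (auto simp: coboundary_def fun_eq_iff)
  have "cohomology_class G v = B2 G"
  proof (intro equalityI subsetI)
    fix x assume "x \<in> cohomology_class G v"
    then obtain \<rho> where \<rho>: "\<rho> \<in> carrier G \<rightarrow> {z. cmod z = 1}" "\<rho> \<one> = 1" "x = coboundary G \<rho> \<otimes>\<^bsub>Z2 G\<^esub> v"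
      unfolding cohomology_class_def r_coset_def B2_def by blast
    then have "x = coboundary G (\<lambda>g. \<rho> g * \<sigma> g)" using \<rho>(3) mult by simp
    then show "x \<in> B2 G"
      unfolding B2_def using \<sigma>(2,3) \<rho>(1,2)
      by (intro CollectI exI[of _ "\<lambda>g. \<rho> g * \<sigma> g"]) (auto simp: norm_mult Pi_iff)
  next
    fix x assume "x \<in> B2 G"
    then obtain \<rho> where \<rho>: "\<rho> \<in> carrier G \<rightarrow> {z. cmod z = 1}" "\<rho> \<one> = 1" "x = coboundary G \<rho>"
      unfolding B2_def by blast
    have "coboundary G (\<lambda>g. \<rho> g * cnj (\<sigma> g)) \<in> B2 G"
      unfolding B2_def using \<rho> \<sigma> by (auto simp: norm_mult Pi_iff)
    moreover have "coboundary G (\<lambda>g. \<rho> g * cnj (\<sigma> g)) \<otimes>\<^bsub>Z2 G\<^esub> v = x"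
    proof -
      have "\<rho> g * cnj (\<sigma> g) * \<sigma> g = \<rho> g" if "g \<in> carrier G" for g
        using unit[OF that] by (simp add: mult.assoc mult.commute[of "cnj _"])
      then show ?thesis unfolding mult \<rho>(3) by (rule cong)
    qed
    ultimately show "x \<in> cohomology_class G v"
      unfolding cohomology_class_def r_coset_def by blast
  qed
  then show ?thesis by (simp add: H2_def FactGroup_def)
qed

theorem theorem5p6:
  fixes G :: "('g, 'm) monoid_scheme"
    and H :: "nat \<Rightarrow> 'a hspace"
    and \<alpha> :: "nat \<Rightarrow> 'g \<Rightarrow> ('a \<Rightarrow> 'a) \<Rightarrow> ('a \<Rightarrow> 'a)"
    and U :: "nat \<Rightarrow> 'g \<Rightarrow> 'a \<Rightarrow> 'a"
    and u :: "nat \<Rightarrow> 'g \<times> 'g \<Rightarrow> complex"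
    and v :: "'g \<times> 'g \<Rightarrow> complex"
  assumes "group G" and "carrier G \<noteq> {\<one>\<^bsub>G\<^esub>}"
    and "\<And>i. hilbert_space (H i)"
    and "\<And>i. is_action G (H i) (bops (H i)) (\<alpha> i)"
    and "\<And>i. projective_rep G (H i) (u i) (U i)"
    and "\<And>i g T. \<lbrakk>g \<in> carrier G; T \<in> bops (H i)\<rbrakk> \<Longrightarrow> \<alpha> i g T = Ad (H i) (U i g) T"
    and "v \<in> carrier (Z2 G)"
    and "\<And>i. cohomology_class G (u i) = cohomology_class G v"
    and "cohomology_class G v \<noteq> \<one>\<^bsub>H2 G\<^esub>"
  shows "\<forall>\<phi>. (\<forall>i. \<phi> i \<in> vecs (H i) \<and> vnorm (H i) (\<phi> i) = 1) \<longrightarrow>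
    \<not> (\<exists>\<beta>. is_action G (inf_tensor H \<phi>) (vn_tensor H \<phi> (\<lambda>i. bops (H i))) \<beta> \<and>
            extends_alg_tensor_action G H \<phi> (\<lambda>i. bops (H i)) \<alpha> \<beta>)"
proof (intro allI impI notI, elim exE conjE)
  fix \<phi> \<beta>
  assume \<phi>: "\<forall>i. \<phi> i \<in> vecs (H i) \<and> vnorm (H i) (\<phi> i) = 1"
    and \<beta>: "is_action G (inf_tensor H \<phi>) (vn_tensor H \<phi> (\<lambda>i. bops (H i))) \<beta>"
    and ext: "extends_alg_tensor_action G H \<phi> (\<lambda>i. bops (H i)) \<alpha> \<beta>"
  interpret group G by (rule assms(1))
  interpret tensor_family H \<phi> by (rule tensor_family.intro) (use assms(3) \<phi> in auto)
  have un: "U i g \<in> unitaries (H i)" if "g \<in> carrier G" for i g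
    using assms(5)[of i] that by (auto simp: projective_rep_def)
  have Uv: "U i g (\<phi> i) \<in> vecs (H i)" if "g \<in> carrier G" for i g
    using un[OF that, of i] hilbert_space.bopsD(1)[OF hilbert _ \<phi>_closed] by (auto simp: unitaries_def)
  have norm_U: "vnorm (H i) (U i g (\<phi> i)) = 1" if "g \<in> carrier G" for i g
    using hilbert_space.unitary_ip[OF hilbert un[OF that] \<phi>_closed \<phi>_closed]
    by (simp add: vnorm_def ip_\<phi>)
  have overlap: "(\<lambda>i. cmod (ip (H i) (U i g (\<phi> i)) (\<phi> i))) \<longlonglongrightarrow> 1" if g: "g \<in> carrier G" for g
  proof -
    let ?w = "\<lambda>i. U i g (\<phi> i)"
    have ext_g: "restrict (\<beta> g) (alg_tensor H \<phi> (\<lambda>i. bops (H i)))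
          (tensor_op H \<phi> (\<lambda>i. if i \<in> J then T i else id_op (H i))) =
        tensor_op H \<phi> (\<lambda>i. if i \<in> J then \<alpha> i g (T i) else id_op (H i))"
      if "finite J" "\<forall>i\<in>J. T i \<in> bops (H i)" for J T
      using ext g that unfolding extends_alg_tensor_action_def is_alg_tensor_action_def by blast
    have "\<beta> g (site m \<phi>) = site m ?w" for m
    proof -
      \<comment> \<open>The hypothesis on \<beta> speaks of its restriction, which agrees with
        \<open>\<beta> g\<close> only on \<open>alg_tensor\<close>.\<close>
      have "site m \<phi> \<in> alg_tensor H \<phi> (\<lambda>i. bops (H i))"
        unfolding alg_tensor_def by (rule subsetD[OF hull_subset site_in_elem_ops[OF \<phi>_closed]])
      then have "\<beta> g (site m \<phi>) = restrict (\<beta> g) (alg_tensor H \<phi> (\<lambda>i. bops (H i))) (site m \<phi>)"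
        by simp
      also have "\<dots> = tensor_op H \<phi> (\<lambda>i. if i \<in> {m} then \<alpha> i g (R i (\<phi> i)) else id_op (H i))"
        unfolding site_def
        by (rule ext_g[of "{m}" "\<lambda>i. R i (\<phi> i)"]) (auto simp: R_closed \<phi>_closed)
      also have "(\<lambda>i. if i \<in> {m} then \<alpha> i g (R i (\<phi> i)) else id_op (H i)) =
          (\<lambda>i. if i \<in> {m} then R i (?w i) else id_op (H i))"
        using assms(6)[OF g R_closed[OF \<phi>_closed]]
          hilbert_space.Ad_rank_one[OF hilbert un[OF g] \<phi>_closed] by auto
      finally show ?thesis by (simp add: site_def)
    qed
    moreover have "star_automorphism K M (\<beta> g)" using \<beta> g by (simp add: is_action_def)
    ultimately obtain \<xi> where "\<xi> \<in> vecs K" "\<xi> \<noteq> vzero K" "\<And>m. site m ?w \<xi> = \<xi>"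
      using automorphism_fixed_vector[of "\<beta> g" ?w] Uv[OF g] by blast
    then have "(\<lambda>i. cmod (ip (H i) (\<phi> i) (?w i))) \<longlonglongrightarrow> 1"
      by (intro overlap_tendsto_one Uv norm_U g)
    moreover have "cmod (ip (H i) (\<phi> i) (?w i)) = cmod (ip (H i) (?w i) (\<phi> i))" for i
      using hilbert_space.ip_cnj[OF hilbert Uv[OF g] \<phi>_closed, of i] by simp
    ultimately show ?thesis by simp
  qed
  define c where "c i g = phase (ip (H i) (U i g (\<phi> i)) (\<phi> i))" for i g
  have "u i \<in> carrier (Z2 G)" for i using assms(5)[of i] by (simp add: projective_rep_def)
  then have "\<exists>\<rho>. (\<forall>g\<in>carrier G. cmod (\<rho> g) = 1) \<and> (\<forall>g\<in>carrier G. \<forall>h\<in>carrier G.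
      u i (g, h) = \<rho> g * \<rho> h * cnj (\<rho> (g \<otimes>\<^bsub>G\<^esub> h)) * v (g, h))" for i
    using cohomologousD[OF assms(1) _ assms(8)] by blast
  then obtain \<rho> where \<rho>: "\<And>i g. g \<in> carrier G \<Longrightarrow> cmod (\<rho> i g) = 1"
    "\<And>i g h. \<lbrakk>g \<in> carrier G; h \<in> carrier G\<rbrakk> \<Longrightarrow>
      u i (g, h) = \<rho> i g * \<rho> i h * cnj (\<rho> i (g \<otimes>\<^bsub>G\<^esub> h)) * v (g, h)"
    by metis
  \<comment> \<open>Correcting by \<open>\<rho> i\<close> passes from \<open>u i\<close> to
    \<open>v\<close>. The value 1 off the carrier keeps \<open>\<sigma> i\<close> circle-valued on
    the whole type, as the compact product in \<open>B2_closed\<close> requires.\<close>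
  define \<sigma> where "\<sigma> i g = (if g \<in> carrier G then c i g * cnj (\<rho> i g) else 1)" for i g
  have "v \<in> B2 G"
  proof (rule B2_closed[OF assms(1,7)])
    show "cmod (\<sigma> i g) = 1" for i g by (simp add: \<sigma>_def c_def norm_mult \<rho>)
    fix g h assume g: "g \<in> carrier G" and h: "h \<in> carrier G"
    let ?z = "\<lambda>i g. cmod (ip (H i) (U i g (\<phi> i)) (\<phi> i))"
    let ?e = "\<lambda>i. (1 - ?z i (g \<otimes>\<^bsub>G\<^esub> h)) + (1 - ?z i g) + sqrt (2 * (1 - ?z i h))"
    have gh: "g \<otimes>\<^bsub>G\<^esub> h \<in> carrier G" using g h by simp
    have "(\<lambda>i. \<sigma> i g * \<sigma> i h * cnj (\<sigma> i (g \<otimes>\<^bsub>G\<^esub> h)) - v (g, h)) \<longlonglongrightarrow> 0"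
    proof (rule tendsto_zero_comparison)
      have "?e \<longlonglongrightarrow> (1 - 1) + (1 - 1) + sqrt (2 * (1 - 1))"
        by (intro tendsto_intros overlap g h gh)
      then show "?e \<longlonglongrightarrow> 0" by simp
      fix i
      \<comment> \<open>At \<open>(g, h)\<close> one has \<open>u i = d * v\<close>; since
        \<open>d\<close> has modulus one, multiplying by its conjugate carries the estimate for
        \<open>u i\<close> over to \<open>v\<close>.\<close>
      define d where "d = \<rho> i g * \<rho> i h * cnj (\<rho> i (g \<otimes>\<^bsub>G\<^esub> h))"
      have d: "cmod d = 1" using \<rho>(1) g h gh by (simp add: d_def norm_mult)
      have "\<sigma> i g * \<sigma> i h * cnj (\<sigma> i (g \<otimes>\<^bsub>G\<^esub> h)) - v (g, h) =
          cnj d * (c i g * c i h * cnj (c i (g \<otimes>\<^bsub>G\<^esub> h)) - u i (g, h))"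
        using unit_mult_cnj[OF d] \<rho>(2)[OF g h, of i, folded d_def] g h gh
        by (simp add: \<sigma>_def d_def[symmetric] right_diff_distrib mult.assoc[symmetric] mult.commute[of "cnj d" d])
          (simp add: d_def mult_ac)
      then have "cmod (\<sigma> i g * \<sigma> i h * cnj (\<sigma> i (g \<otimes>\<^bsub>G\<^esub> h)) - v (g, h)) =
          cmod (u i (g, h) - c i g * c i h * cnj (c i (g \<otimes>\<^bsub>G\<^esub> h)))"
        using d by (simp add: norm_mult norm_minus_commute)
      also have "\<dots> \<le> ?e i"
        unfolding c_def
        by (rule hilbert_space.cocycle_near_coboundary[OF hilbert assms(1,5) \<phi>_closed \<phi>_norm g h])
      finally show "norm (\<sigma> i g * \<sigma> i h * cnj (\<sigma> i (g \<otimes>\<^bsub>G\<^esub> h)) - v (g, h)) \<le> ?e i" .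
    qed
    then show "(\<lambda>i. \<sigma> i g * \<sigma> i h * cnj (\<sigma> i (g \<otimes>\<^bsub>G\<^esub> h))) \<longlonglongrightarrow> v (g, h)"
      by (simp add: LIM_zero_iff)
  qed
  then show False using cohomology_class_B2[OF assms(1)] assms(9) by blast
qed

end
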